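(* Let $c_1,c_2$ be deformation parameters. There is a two-parameter Hopf algebra $U_{c_1,c_2}(\mathcal S)$, a quantum deformation of the extended Schrödinger Lie bialgebra with $r=c_1D\wedge M+c_2P\wedge K$, generated by $D,H,P,K,C,M$ with commutation rules $[D,P]=-P$, $[D,K]=K$, $[K,P]=\dfrac{1-e^{-2c_2M}}{2c_2}$, $[D,H]=-2H$, $[D,C]=2C$, $[H,C]=D$, $[K,H]=P$, $[K,C]=0$, $[P,C]=-K$, $[P,H]=0$, $[M,\cdot]=0$, coproduct $\Delta(D)=1\otimes D+D\otimes1$, $\Delta(M)=1\otimes M+M\otimes1$, $\Delta(P)=1\otimes P+P\otimes e^{(c_1-c_2)M}$, $\Delta(K)=1\otimes K+K\otimes e^{-(c_1+c_2)M}$, $\Delta(H)=1\otimes H+H\otimes e^{2c_1M}$, $\Delta(C)=1\otimes C+C\otimes e^{-2c_1M}$, and trivial counit ($\epsilon(X)=0$ on generators).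
   Context: $\mathcal S$ is the (centrally extended, $(1+1)$-dimensional) Schrödinger algebra, i.e. the real Lie algebra with basis $\{D,H,P,K,C,M\}$ and brackets $[D,P]=-P$, $[D,K]=K$, $[K,P]=M$, $[D,H]=-2H$, $[D,C]=2C$, $[H,C]=D$, $[K,H]=P$, $[K,C]=0$, $[P,C]=-K$, $[P,H]=0$, $[M,\cdot]=0$. $X\wedge Y=X\otimes Y-Y\otimes X$; the Lie bialgebra defined by $r$ has cocommutator $\delta(X)=[1\otimes X+X\otimes1,r]$. Exponentials and $\frac{1-e^{-2c_2M}}{2c_2}$ are understood as formal power series in the deformation parameters, so the Hopf algebra is a topological one over $\mathbb R[[c_1,c_2]]$ (with completed tensor products). It is a quantum deformation of $(\mathcal S,\delta)$ in the sense that it reduces to $U(\mathcal S)$ with primitive generators when the parameters vanish, and that $\Delta(X)-\sigma\circ\Delta(X)=\delta(X)$ up to terms of order two in the parameters for each generator $X$, where $\sigma(X\otimes Y)=Y\otimes X$. *)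

theory Defs
  imports
    "HOL-Algebra.QuotRing"
    "HOL-Algebra.Module"
    "HOL-Library.Poly_Mapping"
    "HOL-Computational_Algebra.Formal_Power_Series"
begin

section \<open>The base ring of formal power series in two parameters\<close>

text \<open>The ring of real formal power series in c1 and c2 is represented as
  power series in c2 over power series in c1.\<close>

type_synonym kk = "real fps fps"

definition c1 :: kk where "c1 = fps_const fps_X"

definition c2 :: kk where "c2 = fps_X"

definition kreal :: "real \<Rightarrow> kk" where "kreal a = fps_const (fps_const a)"

text \<open>The coefficient of c1 to the i, c2 to the j.\<close>

definition kcoeff :: "kk \<Rightarrow> nat \<Rightarrow> nat \<Rightarrow> real" where
  "kcoeff t i j = fps_nth (fps_nth t j) i"

definition kalg :: "(kk, kk) module" where
  "kalg = \<lparr>carrier = UNIV, monoid.mult = (*), one = 1, zero = 0, add = (+), smult = (*)\<rparr>"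


section \<open>Topological algebras over the base ring\<close>

text \<open>Associative unital, not necessarily commutative (unlike the library's
  locale for algebras).\<close>

definition kalgebra :: "(kk, 'a) module \<Rightarrow> bool" where
  "kalgebra A \<longleftrightarrow> ring A \<and> Module.module kalg A \<and>
    (\<forall>t. \<forall>x\<in>carrier A. \<forall>y\<in>carrier A.
       (t \<odot>\<^bsub>A\<^esub> x) \<otimes>\<^bsub>A\<^esub> y = t \<odot>\<^bsub>A\<^esub> (x \<otimes>\<^bsub>A\<^esub> y) \<and>
       x \<otimes>\<^bsub>A\<^esub> (t \<odot>\<^bsub>A\<^esub> y) = t \<odot>\<^bsub>A\<^esub> (x \<otimes>\<^bsub>A\<^esub> y))"

definition klinear :: "(kk, 'a) module \<Rightarrow> (kk, 'b) module \<Rightarrow> ('a \<Rightarrow> 'b) \<Rightarrow> bool" where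
  "klinear A B f \<longleftrightarrow> f \<in> carrier A \<rightarrow> carrier B \<and>
    (\<forall>x\<in>carrier A. \<forall>y\<in>carrier A. f (x \<oplus>\<^bsub>A\<^esub> y) = f x \<oplus>\<^bsub>B\<^esub> f y) \<and>
    (\<forall>t. \<forall>x\<in>carrier A. f (t \<odot>\<^bsub>A\<^esub> x) = t \<odot>\<^bsub>B\<^esub> f x)"

text \<open>The submodule \<open>J\<^sup>n A\<close>, where J is the ideal of the base ring generated by c1 and c2.
  These submodules are the basic neighbourhoods of zero. Every \<^const>\<open>klinear\<close> map is
  continuous for the resulting topologies.\<close>

definition adic_nbhd :: "(kk, 'a) module \<Rightarrow> nat \<Rightarrow> 'a set" where
  "adic_nbhd A n =
    {\<Oplus>\<^bsub>A\<^esub> i\<in>{..n}. (c1 ^ i * c2 ^ (n - i)) \<odot>\<^bsub>A\<^esub> f i | f. f \<in> {..n} \<rightarrow> carrier A}"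

definition adic_limit :: "(kk, 'a) module \<Rightarrow> (nat \<Rightarrow> 'a) \<Rightarrow> 'a \<Rightarrow> bool" where
  "adic_limit A f s \<longleftrightarrow> s \<in> carrier A \<and>
    (\<forall>n. \<exists>N. \<forall>m\<ge>N. f m \<ominus>\<^bsub>A\<^esub> s \<in> adic_nbhd A n)"

definition adic_complete :: "(kk, 'a) module \<Rightarrow> bool" where
  "adic_complete A \<longleftrightarrow>
    (\<Inter>n. adic_nbhd A n) = {\<zero>\<^bsub>A\<^esub>} \<and>
    (\<forall>f. (\<forall>m. f m \<in> carrier A) \<and>
         (\<forall>n. \<exists>N. \<forall>m\<ge>N. \<forall>l\<ge>N. f m \<ominus>\<^bsub>A\<^esub> f l \<in> adic_nbhd A n)
       \<longrightarrow> (\<exists>s. adic_limit A f s))"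

definition adic_closure :: "(kk, 'a) module \<Rightarrow> 'a set \<Rightarrow> 'a set" where
  "adic_closure A T = {x \<in> carrier A. \<forall>n. \<exists>y\<in>T. x \<ominus>\<^bsub>A\<^esub> y \<in> adic_nbhd A n}"

text \<open>The exponential of t x, as the sum of the exponential series.\<close>

definition adic_exp :: "(kk, 'a) module \<Rightarrow> kk \<Rightarrow> 'a \<Rightarrow> 'a" where
  "adic_exp A t x = (THE s. adic_limit A
     (\<lambda>m. \<Oplus>\<^bsub>A\<^esub> i\<in>{..<m}. (kreal (1 / fact i) * t ^ i) \<odot>\<^bsub>A\<^esub> (x [^]\<^bsub>A\<^esub> i)) s)"


section \<open>Constructions of algebras\<close>

text \<open>The real monoid algebra.\<close>

definition monalg :: "('g, 'm) monoid_scheme \<Rightarrow> (real, 'g \<Rightarrow>\<^sub>0 real) module" where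
  "monalg G =
    \<lparr>carrier = {p. Poly_Mapping.keys p \<subseteq> carrier G},
     monoid.mult = (\<lambda>p q. \<Sum>a\<in>Poly_Mapping.keys p. \<Sum>b\<in>Poly_Mapping.keys q.
       Poly_Mapping.single (a \<otimes>\<^bsub>G\<^esub> b) (Poly_Mapping.lookup p a * Poly_Mapping.lookup q b)),
     one = Poly_Mapping.single \<one>\<^bsub>G\<^esub> 1,
     zero = 0,
     add = (+),
     smult = (\<lambda>r. Poly_Mapping.map (\<lambda>s. r * s))\<rparr>"

text \<open>The algebra A[[c1,c2]] of formal power series with coefficients in a real algebra A.
  The element \<open>f\<close> stands for the sum of all \<open>f i j\<close> times c1 to the i, c2 to the j.\<close>

definition pser :: "(real, 'a) module \<Rightarrow> (kk, nat \<Rightarrow> nat \<Rightarrow> 'a) module" where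
  "pser A =
    \<lparr>carrier = {f. \<forall>i j. f i j \<in> carrier A},
     monoid.mult = (\<lambda>f g i j. \<Oplus>\<^bsub>A\<^esub> i'\<in>{..i}. \<Oplus>\<^bsub>A\<^esub> j'\<in>{..j}.
       f i' j' \<otimes>\<^bsub>A\<^esub> g (i - i') (j - j')),
     one = (\<lambda>i j. if i = 0 \<and> j = 0 then \<one>\<^bsub>A\<^esub> else \<zero>\<^bsub>A\<^esub>),
     zero = (\<lambda>i j. \<zero>\<^bsub>A\<^esub>),
     add = (\<lambda>f g i j. f i j \<oplus>\<^bsub>A\<^esub> g i j),
     smult = (\<lambda>t f i j. \<Oplus>\<^bsub>A\<^esub> i'\<in>{..i}. \<Oplus>\<^bsub>A\<^esub> j'\<in>{..j}.
       kcoeff t i' j' \<odot>\<^bsub>A\<^esub> f (i - i') (j - j'))\<rparr>"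

text \<open>The completed free module over the base ring on the carrier of G, with the product of G.
  It is the completion of the monoid algebra of G over the base ring.\<close>

abbreviation cmonalg :: "('g, 'm) monoid_scheme \<Rightarrow> (kk, nat \<Rightarrow> nat \<Rightarrow> ('g \<Rightarrow>\<^sub>0 real)) module" where
  "cmonalg G \<equiv> pser (monalg G)"

definition cmon :: "'g \<Rightarrow> nat \<Rightarrow> nat \<Rightarrow> ('g \<Rightarrow>\<^sub>0 real)" where
  "cmon g = (\<lambda>i j. if i = 0 \<and> j = 0 then Poly_Mapping.single g 1 else 0)"

text \<open>The quotient algebra by a two-sided ideal; its elements are the cosets.\<close>

definition quot_alg :: "('k, 'a) module \<Rightarrow> 'a set \<Rightarrow> ('k, 'a set) module" where
  "quot_alg A I =
    \<lparr>carrier = carrier (A Quot I), monoid.mult = monoid.mult (A Quot I),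
     one = \<one>\<^bsub>A Quot I\<^esub>, zero = \<zero>\<^bsub>A Quot I\<^esub>, add = add (A Quot I),
     smult = (\<lambda>t X. \<Union>x\<in>X. I +>\<^bsub>A\<^esub> (t \<odot>\<^bsub>A\<^esub> x))\<rparr>"

definition closed_ideal :: "(kk, 'a) module \<Rightarrow> 'a set \<Rightarrow> 'a set" where
  "closed_ideal A R = adic_closure A (Idl\<^bsub>A\<^esub> R)"


section \<open>The completed tensor product\<close>

text \<open>The completed free module on pairs (a,b), modulo the closed ideal generated by the
  bilinearity relations. As pairs multiply componentwise, multiplying a bilinearity
  relation by a pair gives another one, so the closed ideal is also the closed submodule
  generated by these relations; hence the underlying module is the completion of the algebraic
  tensor product over the base ring.\<close>

definition bilin_rels ::
  "(kk, 'a) module \<Rightarrow> (kk, 'b) module \<Rightarrow> (nat \<Rightarrow> nat \<Rightarrow> ('a \<times> 'b \<Rightarrow>\<^sub>0 real)) set" where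
  "bilin_rels A B = (let F = cmonalg (A \<times>\<times> B) in
     {cmon (a \<oplus>\<^bsub>A\<^esub> a', b) \<ominus>\<^bsub>F\<^esub> (cmon (a, b) \<oplus>\<^bsub>F\<^esub> cmon (a', b)) | a a' b.
        a \<in> carrier A \<and> a' \<in> carrier A \<and> b \<in> carrier B} \<union>
     {cmon (a, b \<oplus>\<^bsub>B\<^esub> b') \<ominus>\<^bsub>F\<^esub> (cmon (a, b) \<oplus>\<^bsub>F\<^esub> cmon (a, b')) | a b b'.
        a \<in> carrier A \<and> b \<in> carrier B \<and> b' \<in> carrier B} \<union>
     {cmon (t \<odot>\<^bsub>A\<^esub> a, b) \<ominus>\<^bsub>F\<^esub> t \<odot>\<^bsub>F\<^esub> cmon (a, b) | t a b.
        a \<in> carrier A \<and> b \<in> carrier B} \<union>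
     {cmon (a, t \<odot>\<^bsub>B\<^esub> b) \<ominus>\<^bsub>F\<^esub> t \<odot>\<^bsub>F\<^esub> cmon (a, b) | t a b.
        a \<in> carrier A \<and> b \<in> carrier B})"

definition tensor_ideal ::
  "(kk, 'a) module \<Rightarrow> (kk, 'b) module \<Rightarrow> (nat \<Rightarrow> nat \<Rightarrow> ('a \<times> 'b \<Rightarrow>\<^sub>0 real)) set" where
  "tensor_ideal A B = closed_ideal (cmonalg (A \<times>\<times> B)) (bilin_rels A B)"

definition ctensor ::
  "(kk, 'a) module \<Rightarrow> (kk, 'b) module \<Rightarrow> (kk, (nat \<Rightarrow> nat \<Rightarrow> ('a \<times> 'b \<Rightarrow>\<^sub>0 real)) set) module" where
  "ctensor A B = quot_alg (cmonalg (A \<times>\<times> B)) (tensor_ideal A B)"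

definition tens ::
  "(kk, 'a) module \<Rightarrow> (kk, 'b) module \<Rightarrow> 'a \<Rightarrow> 'b \<Rightarrow> (nat \<Rightarrow> nat \<Rightarrow> ('a \<times> 'b \<Rightarrow>\<^sub>0 real)) set" where
  "tens A B a b = tensor_ideal A B +>\<^bsub>cmonalg (A \<times>\<times> B)\<^esub> cmon (a, b)"

text \<open>The linear map on the completed tensor product induced by a bilinear map
  with values in a complete module N.\<close>

definition tensor_lift ::
  "(kk, 'a) module \<Rightarrow> (kk, 'b) module \<Rightarrow> (kk, 'c) module \<Rightarrow> ('a \<Rightarrow> 'b \<Rightarrow> 'c) \<Rightarrow>
   (nat \<Rightarrow> nat \<Rightarrow> ('a \<times> 'b \<Rightarrow>\<^sub>0 real)) set \<Rightarrow> 'c" where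
  "tensor_lift A B N \<beta> = (THE \<phi>. klinear (ctensor A B) N \<phi> \<and>
     \<phi> \<in> extensional (carrier (ctensor A B)) \<and>
     (\<forall>a\<in>carrier A. \<forall>b\<in>carrier B. \<phi> (tens A B a b) = \<beta> a b))"

definition tensor_map where
  "tensor_map A B A' B' f g =
     tensor_lift A B (ctensor A' B') (\<lambda>a b. tens A' B' (f a) (g b))"

definition tensor_flip where
  "tensor_flip A B = tensor_lift A B (ctensor B A) (\<lambda>a b. tens B A b a)"

definition tensor_assoc where
  "tensor_assoc A B C = tensor_lift (ctensor A B) C (ctensor A (ctensor B C))
     (\<lambda>u c. tensor_lift A B (ctensor A (ctensor B C))
        (\<lambda>a b. tens A (ctensor B C) a (tens B C b c)) u)"


section \<open>Topological Hopf algebras\<close>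

definition topological_hopf_algebra where
  "topological_hopf_algebra A \<Delta> \<epsilon> S \<longleftrightarrow>
     kalgebra A \<and> adic_complete A \<and>
     klinear A (ctensor A A) \<Delta> \<and> \<Delta> \<in> ring_hom A (ctensor A A) \<and>
     klinear A kalg \<epsilon> \<and> \<epsilon> \<in> ring_hom A kalg \<and>
     klinear A A S \<and>
     (\<forall>x\<in>carrier A.
        tensor_assoc A A A (tensor_map A A (ctensor A A) A \<Delta> (\<lambda>a. a) (\<Delta> x)) =
        tensor_map A A A (ctensor A A) (\<lambda>a. a) \<Delta> (\<Delta> x)) \<and>
     (\<forall>x\<in>carrier A.
        tensor_lift A A A (\<lambda>a b. \<epsilon> a \<odot>\<^bsub>A\<^esub> b) (\<Delta> x) = x \<and>
        tensor_lift A A A (\<lambda>a b. \<epsilon> b \<odot>\<^bsub>A\<^esub> a) (\<Delta> x) = x) \<and>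
     (\<forall>x\<in>carrier A.
        tensor_lift A A A (\<lambda>a b. S a \<otimes>\<^bsub>A\<^esub> b) (\<Delta> x) = \<epsilon> x \<odot>\<^bsub>A\<^esub> \<one>\<^bsub>A\<^esub> \<and>
        tensor_lift A A A (\<lambda>a b. a \<otimes>\<^bsub>A\<^esub> S b) (\<Delta> x) = \<epsilon> x \<odot>\<^bsub>A\<^esub> \<one>\<^bsub>A\<^esub>)"


section \<open>The extended Schroedinger Lie bialgebra\<close>

datatype schr = bD | bH | bP | bK | bC | bM

text \<open>The bracket of two basis vectors as a coefficient vector.
  The auxiliary function lists each bracket in one of the two orders only.\<close>

fun schr_half :: "schr \<Rightarrow> schr \<Rightarrow> schr \<Rightarrow> real" where
  "schr_half bD bP = (\<lambda>_. 0)(bP := -1)"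
| "schr_half bD bK = (\<lambda>_. 0)(bK := 1)"
| "schr_half bK bP = (\<lambda>_. 0)(bM := 1)"
| "schr_half bD bH = (\<lambda>_. 0)(bH := -2)"
| "schr_half bD bC = (\<lambda>_. 0)(bC := 2)"
| "schr_half bH bC = (\<lambda>_. 0)(bD := 1)"
| "schr_half bK bH = (\<lambda>_. 0)(bP := 1)"
| "schr_half bP bC = (\<lambda>_. 0)(bK := -1)"
| "schr_half _ _ = (\<lambda>_. 0)"

definition schr_bracket :: "schr \<Rightarrow> schr \<Rightarrow> schr \<Rightarrow> real" where
  "schr_bracket x y z = schr_half x y z - schr_half y x z"

text \<open>Elements of the tensor square of the Lie algebra, with scalars extended to the base ring,
  are given by their coefficients on pairs of basis vectors.\<close>

definition wedge :: "schr \<Rightarrow> schr \<Rightarrow> schr \<Rightarrow> schr \<Rightarrow> kk" where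
  "wedge x y a b = of_bool (a = x \<and> b = y) - of_bool (a = y \<and> b = x)"

definition schr_r :: "schr \<Rightarrow> schr \<Rightarrow> kk" where
  "schr_r a b = c1 * wedge bD bM a b + c2 * wedge bP bK a b"

text \<open>The element \<open>[1 \<otimes> x + x \<otimes> 1, r]\<close> for a basis vector x.\<close>

definition cocommutator :: "(schr \<Rightarrow> schr \<Rightarrow> kk) \<Rightarrow> schr \<Rightarrow> schr \<Rightarrow> schr \<Rightarrow> kk" where
  "cocommutator r x a b =
     (\<Sum>y\<in>UNIV. r a y * kreal (schr_bracket x y b)) +
     (\<Sum>y\<in>UNIV. r y b * kreal (schr_bracket x y a))"


section \<open>The universal enveloping algebra\<close>

abbreviation words :: "schr list monoid" where
  "words \<equiv> \<lparr>carrier = UNIV, monoid.mult = (@), one = []\<rparr>"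

definition env_ideal :: "(schr list \<Rightarrow>\<^sub>0 real) set" where
  "env_ideal = Idl\<^bsub>monalg words\<^esub>
     {Poly_Mapping.single [x, y] 1 - Poly_Mapping.single [y, x] 1
        - (\<Sum>z\<in>UNIV. Poly_Mapping.single [z] (schr_bracket x y z)) | x y. True}"

definition schr_env :: "(real, (schr list \<Rightarrow>\<^sub>0 real) set) module" where
  "schr_env = quot_alg (monalg words) env_ideal"

definition env_gen :: "schr \<Rightarrow> (schr list \<Rightarrow>\<^sub>0 real) set" where
  "env_gen x = env_ideal +>\<^bsub>monalg words\<^esub> Poly_Mapping.single [x] 1"


section \<open>Quantum deformations\<close>

text \<open>Here A is a topological Hopf algebra with distinguished generators \<open>X x\<close>.
  The map \<open>\<pi>\<close> identifies A modulo J A with the universal enveloping algebra, and \<open>\<phi>\<close>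
  witnesses that A is topologically free.\<close>

definition quantum_deformation where
  "quantum_deformation A X \<Delta> \<epsilon> S r \<longleftrightarrow>
     (\<exists>\<pi>. \<pi> \<in> ring_hom A schr_env \<and>
        (\<forall>t. \<forall>x\<in>carrier A. \<pi> (t \<odot>\<^bsub>A\<^esub> x) = kcoeff t 0 0 \<odot>\<^bsub>schr_env\<^esub> \<pi> x) \<and>
        \<pi> ` carrier A = carrier schr_env \<and>
        (\<forall>x\<in>carrier A. \<pi> x = \<zero>\<^bsub>schr_env\<^esub> \<longleftrightarrow> x \<in> adic_nbhd A 1) \<and>
        (\<forall>x. \<pi> (X x) = env_gen x) \<and>
        (\<exists>\<phi>. klinear A (pser schr_env) \<phi> \<and>
           bij_betw \<phi> (carrier A) (carrier (pser schr_env)) \<and>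
           (\<forall>x\<in>carrier A. \<phi> x 0 0 = \<pi> x))) \<and>
     (\<forall>x. \<Delta> (X x) \<ominus>\<^bsub>ctensor A A\<^esub>
            (tens A A \<one>\<^bsub>A\<^esub> (X x) \<oplus>\<^bsub>ctensor A A\<^esub> tens A A (X x) \<one>\<^bsub>A\<^esub>)
          \<in> adic_nbhd (ctensor A A) 1) \<and>
     (\<forall>x. \<epsilon> (X x) \<in> adic_nbhd kalg 1) \<and>
     (\<forall>x. S (X x) \<oplus>\<^bsub>A\<^esub> X x \<in> adic_nbhd A 1) \<and>
     (\<forall>x. (\<Delta> (X x) \<ominus>\<^bsub>ctensor A A\<^esub> tensor_flip A A (\<Delta> (X x))) \<ominus>\<^bsub>ctensor A A\<^esub>
            (\<Oplus>\<^bsub>ctensor A A\<^esub> p\<in>UNIV. cocommutator r x (fst p) (snd p) \<odot>\<^bsub>ctensor A A\<^esub>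
               tens A A (X (fst p)) (X (snd p)))
          \<in> adic_nbhd (ctensor A A) 2)"


section \<open>The two-parameter quantum Schroedinger algebra\<close>

abbreviation qfree :: "(kk, nat \<Rightarrow> nat \<Rightarrow> (schr list \<Rightarrow>\<^sub>0 real)) module" where
  "qfree \<equiv> cmonalg words"

definition letter :: "schr \<Rightarrow> nat \<Rightarrow> nat \<Rightarrow> (schr list \<Rightarrow>\<^sub>0 real)" where
  "letter x = cmon [x]"

text \<open>The formal power series \<open>(1 - exp (-2 c2 M)) / (2 c2)\<close>. The quotient is unique, as c2 is
  not a zero divisor on the completed free algebra.\<close>

definition qM :: "nat \<Rightarrow> nat \<Rightarrow> (schr list \<Rightarrow>\<^sub>0 real)" where
  "qM = (THE q. q \<in> carrier qfree \<and>
     (2 * c2) \<odot>\<^bsub>qfree\<^esub> q = \<one>\<^bsub>qfree\<^esub> \<ominus>\<^bsub>qfree\<^esub> adic_exp qfree (- 2 * c2) (letter bM))"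

text \<open>A relator: the commutator of x and y minus z.\<close>

definition comm_rel where
  "comm_rel x y z = (letter x \<otimes>\<^bsub>qfree\<^esub> letter y \<ominus>\<^bsub>qfree\<^esub> letter y \<otimes>\<^bsub>qfree\<^esub> letter x) \<ominus>\<^bsub>qfree\<^esub> z"

definition q_ideal :: "(nat \<Rightarrow> nat \<Rightarrow> (schr list \<Rightarrow>\<^sub>0 real)) set" where
  "q_ideal = closed_ideal qfree
     ({comm_rel bD bP (kreal (-1) \<odot>\<^bsub>qfree\<^esub> letter bP),
       comm_rel bD bK (letter bK),
       comm_rel bK bP qM,
       comm_rel bD bH (kreal (-2) \<odot>\<^bsub>qfree\<^esub> letter bH),
       comm_rel bD bC (kreal 2 \<odot>\<^bsub>qfree\<^esub> letter bC),
       comm_rel bH bC (letter bD),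
       comm_rel bK bH (letter bP),
       comm_rel bK bC \<zero>\<^bsub>qfree\<^esub>,
       comm_rel bP bC (kreal (-1) \<odot>\<^bsub>qfree\<^esub> letter bK),
       comm_rel bP bH \<zero>\<^bsub>qfree\<^esub>} \<union>
      {comm_rel bM x \<zero>\<^bsub>qfree\<^esub> | x. True})"

definition schr_q :: "(kk, (nat \<Rightarrow> nat \<Rightarrow> (schr list \<Rightarrow>\<^sub>0 real)) set) module" where
  "schr_q = quot_alg qfree q_ideal"

definition qgen :: "schr \<Rightarrow> (nat \<Rightarrow> nat \<Rightarrow> (schr list \<Rightarrow>\<^sub>0 real)) set" where
  "qgen x = q_ideal +>\<^bsub>qfree\<^esub> letter x"

text \<open>The exponential of t M.\<close>

abbreviation qexp :: "kk \<Rightarrow> (nat \<Rightarrow> nat \<Rightarrow> (schr list \<Rightarrow>\<^sub>0 real)) set" where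
  "qexp t \<equiv> adic_exp schr_q t (qgen bM)"

abbreviation qtens (infix "\<otimes>q" 75) where
  "a \<otimes>q b \<equiv> tens schr_q schr_q a b"

abbreviation qplus (infixl "\<oplus>q" 65) where
  "u \<oplus>q v \<equiv> u \<oplus>\<^bsub>ctensor schr_q schr_q\<^esub> v"

abbreviation qone ("\<one>q") where
  "\<one>q \<equiv> \<one>\<^bsub>schr_q\<^esub>"

end

theory Submission
  imports Defs
begin

text \<open>The completed free algebra modulo the closed ideal of the relations has the expected universal
  property with respect to complete algebras. So the coproduct, the counit and the antipode (a
  homomorphism to the opposite algebra) exist as soon as the proposed images of the generators
  satisfy the relations. All coproducts are of the form \<open>1 \<otimes> X + X \<otimes> exp (w M)\<close> with a weight \<open>w\<close>
  that is additive along the brackets, and the only nonlinear relation amounts to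
  \<open>m(x + y) = m(x) + m(y) exp (-2 c2 x)\<close> for \<open>m(x) = (1 - exp (-2 c2 x)) / (2 c2)\<close> and commuting \<open>x\<close>, \<open>y\<close>.
  As the tensor square is not yet known to be torsion-free, this identity is proved by a Cauchy
  product. Coassociativity and the counit axiom compare homomorphisms on generators.

  Topological freeness needs no Poincare-Birkhoff-Witt theorem: rescaling \<open>P\<close> and \<open>K\<close> by the central
  power series \<open>sqrt (m(M) / M)\<close> identifies the quantum algebra with \<open>U(S)[[c1, c2]]\<close>.\<close>


section \<open>Associative algebras\<close>

text \<open>The weights \<open>w\<close> are forced by \<open>r\<close>: the cobracket is
  \<open>\<delta>(X) = w X \<wedge> M\<close> on every generator, and
  \<open>exp (w M) = 1 + w M\<close> up to order two. They fail to be additive only at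
  \<open>[K, P]\<close>, where they sum to \<open>-2 c2\<close> although \<open>M\<close> has weight
  zero; the factor \<open>exp (-2 c2 x)\<close> in the addition rule for \<open>m\<close> absorbs
  this defect in the coproduct, and \<open>m(-x) = - m(x) exp (2 c2 x)\<close> does so for the
  antipode. A square root appears because brackets with \<open>H\<close> and \<open>C\<close>
  exchange \<open>P\<close> and \<open>K\<close>: both must be rescaled by the same factor
  \<open>s(M)\<close>, and \<open>[K, P]\<close> then requires \<open>s(M)^2 M = m(M)\<close>. The
  completed tensor product is a quotient by the closure of an ideal, and only its universal
  property, separatedness and completeness are used. Maps on it are therefore compared on pure
  tensors, and every linear map is continuous for free. The antipode axioms concern maps that are
  not multiplicative, so they need an induction on words instead of a comparison of
  homomorphisms.\<close>

locale assoc_alg = ring A for A :: "('k::comm_ring_1, 'a) module" (structure) +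
  assumes smult_closed [simp, intro]: "x \<in> carrier A \<Longrightarrow> t \<odot> x \<in> carrier A"
    and smult_l_distr: "x \<in> carrier A \<Longrightarrow> (s + t) \<odot> x = s \<odot> x \<oplus> t \<odot> x"
    and smult_r_distr: "x \<in> carrier A \<Longrightarrow> y \<in> carrier A \<Longrightarrow> t \<odot> (x \<oplus> y) = t \<odot> x \<oplus> t \<odot> y"
    and smult_assoc: "x \<in> carrier A \<Longrightarrow> (s * t) \<odot> x = s \<odot> (t \<odot> x)"
    and smult_one [simp]: "x \<in> carrier A \<Longrightarrow> 1 \<odot> x = x"
    and smult_mult_l: "x \<in> carrier A \<Longrightarrow> y \<in> carrier A \<Longrightarrow> (t \<odot> x) \<otimes> y = t \<odot> (x \<otimes> y)"
    and smult_mult_r: "x \<in> carrier A \<Longrightarrow> y \<in> carrier A \<Longrightarrow> x \<otimes> (t \<odot> y) = t \<odot> (x \<otimes> y)"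
begin

lemma smult_zero_r [simp]: "t \<odot> \<zero> = \<zero>"
proof -
  have "t \<odot> \<zero> \<oplus> t \<odot> \<zero> = t \<odot> \<zero> \<oplus> \<zero>"
    by (simp flip: smult_r_distr)
  then show ?thesis using add.l_cancel_one[of "t \<odot> \<zero>" "t \<odot> \<zero>"] by simp
qed

lemma smult_zero_l [simp]: "x \<in> carrier A \<Longrightarrow> 0 \<odot> x = \<zero>"
proof -
  assume x: "x \<in> carrier A"
  have "0 \<odot> x \<oplus> 0 \<odot> x = 0 \<odot> x \<oplus> \<zero>"
    using x by (simp flip: smult_l_distr)
  then show ?thesis using x add.l_cancel_one[of "0 \<odot> x" "0 \<odot> x"] by simp
qed

lemma smult_minus_l: "x \<in> carrier A \<Longrightarrow> (- t) \<odot> x = \<ominus> (t \<odot> x)"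
  by (rule minus_equality[symmetric]) (simp_all flip: smult_l_distr)

lemma smult_minus_r: "x \<in> carrier A \<Longrightarrow> t \<odot> (\<ominus> x) = \<ominus> (t \<odot> x)"
  by (rule minus_equality[symmetric]) (simp_all flip: smult_r_distr add: l_neg)

lemma smult_comm: "x \<in> carrier A \<Longrightarrow> s \<odot> (t \<odot> x) = t \<odot> (s \<odot> x)"
  by (metis mult.commute smult_assoc)

lemma diff_add_cancel: "x \<in> carrier A \<Longrightarrow> y \<in> carrier A \<Longrightarrow> (x \<ominus> y) \<oplus> y = x"
  by (simp add: minus_eq a_assoc l_neg)

lemma diff_trans:
  "x \<in> carrier A \<Longrightarrow> y \<in> carrier A \<Longrightarrow> z \<in> carrier A \<Longrightarrow> x \<ominus> z = (x \<ominus> y) \<oplus> (y \<ominus> z)"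
  by (simp add: minus_eq) (metis a_assoc a_inv_closed l_neg l_zero add.m_closed)

lemma add_diff_add:
  assumes "x \<in> carrier A" "y \<in> carrier A" "u \<in> carrier A" "v \<in> carrier A"
  shows "(x \<oplus> y) \<ominus> (u \<oplus> v) = (x \<ominus> u) \<oplus> (y \<ominus> v)"
  using assms by (simp add: minus_eq minus_add a_ac)

lemma eq_diff_zero: "x \<in> carrier A \<Longrightarrow> y \<in> carrier A \<Longrightarrow> x \<ominus> y = \<zero> \<longleftrightarrow> x = y"
  by (metis diff_add_cancel l_zero minus_eq r_neg)

lemma diff_mult_r:
  "x \<in> carrier A \<Longrightarrow> y \<in> carrier A \<Longrightarrow> z \<in> carrier A \<Longrightarrow> z \<otimes> (x \<ominus> y) = z \<otimes> x \<ominus> z \<otimes> y"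
  by (simp add: minus_eq r_distr r_minus)

lemma diff_mult_l:
  "x \<in> carrier A \<Longrightarrow> y \<in> carrier A \<Longrightarrow> z \<in> carrier A \<Longrightarrow> (x \<ominus> y) \<otimes> z = x \<otimes> z \<ominus> y \<otimes> z"
  by (simp add: minus_eq l_distr l_minus)

text \<open>Scalars act through the unit,
  \<open>t \<odot> x = (t \<odot> \<one>) \<otimes> x\<close>, so a ring ideal is automatically a
  submodule.\<close>

lemma ideal_smult:
  "ideal I A \<Longrightarrow> x \<in> I \<Longrightarrow> t \<odot> x \<in> I"
  using ideal.I_l_closed[of I A x "t \<odot> \<one>"] additive_subgroup.a_Hcarr[of I A x]
  by (simp add: smult_mult_l ideal.axioms(1))

end

lemma kalgebra_iff_assoc_alg: "kalgebra A \<longleftrightarrow> assoc_alg A"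
proof
  assume "kalgebra A"
  then have a: "ring A" "Module.module kalg A" and
    b: "\<forall>t. \<forall>x\<in>carrier A. \<forall>y\<in>carrier A.
       (t \<odot>\<^bsub>A\<^esub> x) \<otimes>\<^bsub>A\<^esub> y = t \<odot>\<^bsub>A\<^esub> (x \<otimes>\<^bsub>A\<^esub> y) \<and>
       x \<otimes>\<^bsub>A\<^esub> (t \<odot>\<^bsub>A\<^esub> y) = t \<odot>\<^bsub>A\<^esub> (x \<otimes>\<^bsub>A\<^esub> y)"
    by (simp_all add: kalgebra_def)
  show "assoc_alg A"
    using a(1) b module.smult_closed[OF a(2)] module.smult_l_distr[OF a(2)]
      module.smult_r_distr[OF a(2)] module.smult_assoc1[OF a(2)] module.smult_one[OF a(2)]
    by (intro assoc_alg.intro assoc_alg_axioms.intro) (simp_all add: kalg_def)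
next
  assume "assoc_alg A"
  then interpret assoc_alg A .
  have "cring kalg"
    by (rule cringI; (rule abelian_groupI comm_monoidI)?)
      (auto simp: kalg_def algebra_simps intro: exI[of _ "- x" for x])
  then have "Module.module kalg A"
    by (intro moduleI) (auto simp: kalg_def smult_l_distr smult_r_distr smult_assoc is_abelian_group)
  then show "kalgebra A"
    using ring_axioms by (auto simp: kalgebra_def smult_mult_l smult_mult_r)
qed

lemma assoc_alg_kalg: "assoc_alg kalg"
proof -
  have "ring kalg"
    by (rule ringI; (rule abelian_groupI monoidI)?)
      (auto simp: kalg_def algebra_simps intro: exI[of _ "- x" for x])
  then show ?thesis
    by (intro assoc_alg.intro assoc_alg_axioms.intro) (auto simp: kalg_def algebra_simps)
qed

text \<open>All laws are equations, so they pull back along an injective map that respects the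
  operations; negatives come from the scalar \<open>-1\<close>. It is used to obtain
  \<open>pser\<close> from an iterated one-variable construction.\<close>

lemma assoc_alg_transfer:
  assumes A: "assoc_alg A"
    and p: "p \<in> carrier B \<rightarrow> carrier A" and inj: "inj_on p (carrier B)"
    and cl: "\<And>x y. x \<in> carrier B \<Longrightarrow> y \<in> carrier B \<Longrightarrow> x \<oplus>\<^bsub>B\<^esub> y \<in> carrier B"
      "\<And>x y. x \<in> carrier B \<Longrightarrow> y \<in> carrier B \<Longrightarrow> x \<otimes>\<^bsub>B\<^esub> y \<in> carrier B"
      "\<And>t x. x \<in> carrier B \<Longrightarrow> t \<odot>\<^bsub>B\<^esub> x \<in> carrier B"
      "\<zero>\<^bsub>B\<^esub> \<in> carrier B" "\<one>\<^bsub>B\<^esub> \<in> carrier B"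
    and h: "\<And>x y. x \<in> carrier B \<Longrightarrow> y \<in> carrier B \<Longrightarrow> p (x \<oplus>\<^bsub>B\<^esub> y) = p x \<oplus>\<^bsub>A\<^esub> p y"
      "\<And>x y. x \<in> carrier B \<Longrightarrow> y \<in> carrier B \<Longrightarrow> p (x \<otimes>\<^bsub>B\<^esub> y) = p x \<otimes>\<^bsub>A\<^esub> p y"
      "\<And>t x. x \<in> carrier B \<Longrightarrow> p (t \<odot>\<^bsub>B\<^esub> x) = t \<odot>\<^bsub>A\<^esub> p x"
      "p \<zero>\<^bsub>B\<^esub> = \<zero>\<^bsub>A\<^esub>" "p \<one>\<^bsub>B\<^esub> = \<one>\<^bsub>A\<^esub>"
  shows "assoc_alg B"
proof -
  interpret assoc_alg A by fact
  have eq: "x = y" if "x \<in> carrier B" "y \<in> carrier B" "p x = p y" for x y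
    using inj that by (auto dest: inj_onD)
  have pc [simp]: "p x \<in> carrier A" if "x \<in> carrier B" for x
    using p that by auto
  have neg: "\<exists>y\<in>carrier B. y \<oplus>\<^bsub>B\<^esub> x = \<zero>\<^bsub>B\<^esub>" if "x \<in> carrier B" for x
    using that cl h by (intro bexI[of _ "(-1) \<odot>\<^bsub>B\<^esub> x"] eq) (auto simp: smult_minus_l l_neg)
  note [simp] = cl h
  have "abelian_group B"
    by (rule abelian_groupI) (auto intro!: eq neg simp: a_ac)
  moreover have "Group.monoid B"
    by (rule monoidI) (auto intro!: eq simp: m_assoc)
  ultimately have "ring B"
    by (rule ringI) (auto intro!: eq simp: l_distr r_distr)
  then show ?thesis
    by (intro assoc_alg.intro assoc_alg_axioms.intro)
      (auto intro!: eq simp: smult_l_distr smult_r_distr smult_assoc smult_mult_l smult_mult_r)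
qed


subsection \<open>Partial sums\<close>

text \<open>A recursive substitute for \<open>finsum\<close> over an initial segment: induction and
  unfolding need no function-space side conditions, and the sum can be computed before the structure
  is known to be a group.\<close>

primrec psum :: "('a, 'm) ring_scheme \<Rightarrow> (nat \<Rightarrow> 'a) \<Rightarrow> nat \<Rightarrow> 'a" where
  "psum A d 0 = \<zero>\<^bsub>A\<^esub>"
| "psum A d (Suc n) = psum A d n \<oplus>\<^bsub>A\<^esub> d n"

lemma psum_cong: "(\<And>i. i < n \<Longrightarrow> d i = e i) \<Longrightarrow> psum A d n = psum A e n"
  by (induction n) auto

context abelian_group
begin

lemma psum_closed [simp, intro]: "(\<And>i. i < n \<Longrightarrow> d i \<in> carrier G) \<Longrightarrow> psum G d n \<in> carrier G"
  by (induction n) auto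

lemma psum_add:
  "(\<And>i. i < n \<Longrightarrow> d i \<in> carrier G) \<Longrightarrow> (\<And>i. i < n \<Longrightarrow> e i \<in> carrier G) \<Longrightarrow>
    psum G (\<lambda>i. d i \<oplus> e i) n = psum G d n \<oplus> psum G e n"
  by (induction n) (auto simp: a_ac)

lemma psum_zero: "(\<And>i. i < n \<Longrightarrow> d i = \<zero>) \<Longrightarrow> psum G d n = \<zero>"
  by (induction n) auto

lemma psum_single:
  assumes "j < n" "d j \<in> carrier G" "\<And>i. i < n \<Longrightarrow> i \<noteq> j \<Longrightarrow> d i = \<zero>"
  shows "psum G d n = d j"
  using assms
proof (induction n)
  case (Suc n)
  show ?case
  proof (cases "j = n")
    case True
    then show ?thesis using Suc.prems psum_zero[of n d] by simp
  next
    case False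
    then show ?thesis using Suc by (simp add: less_Suc_eq)
  qed
qed simp

lemma psum_shift:
  "(\<And>i. i \<le> n \<Longrightarrow> d i \<in> carrier G) \<Longrightarrow> psum G d (Suc n) = d 0 \<oplus> psum G (\<lambda>i. d (Suc i)) n"
  by (induction n) (auto simp: a_ac)

text \<open>Both sides sum over the triangle \<open>l + m < n\<close>, by diagonals
  \<open>k = l + m\<close> on the left and by rows on the right; the induction step adds the
  diagonal \<open>l + m = n\<close>.\<close>

lemma psum_triangle:
  assumes "\<And>l m. a l m \<in> carrier G"
  shows "psum G (\<lambda>k. psum G (\<lambda>l. a l (k - l)) (Suc k)) n = psum G (\<lambda>l. psum G (a l) (n - l)) n"
proof (induction n)
  case (Suc n)
  have "psum G (\<lambda>l. psum G (a l) (Suc n - l)) n = psum G (\<lambda>l. psum G (a l) (n - l) \<oplus> a l (n - l)) n"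
    by (rule psum_cong) (simp add: Suc_diff_le)
  also have "\<dots> = psum G (\<lambda>l. psum G (a l) (n - l)) n \<oplus> psum G (\<lambda>l. a l (n - l)) n"
    using assms by (intro psum_add) auto
  finally show ?case
    using Suc assms by (simp add: a_ac)
qed simp

lemma psum_swap:
  assumes "\<And>i j. a i j \<in> carrier G"
  shows "psum G (\<lambda>i. psum G (\<lambda>j. a i j) n) m = psum G (\<lambda>j. psum G (\<lambda>i. a i j) m) n"
  using assms by (induction m) (auto simp: psum_add psum_zero)

lemma psum_rev:
  "(\<And>i. i \<le> n \<Longrightarrow> d i \<in> carrier G) \<Longrightarrow> psum G (\<lambda>i. d (n - i)) (Suc n) = psum G d (Suc n)"
proof (induction n arbitrary: d)
  case (Suc n)
  have "psum G (\<lambda>i. d (Suc n - i)) (Suc (Suc n)) = psum G (\<lambda>i. d (Suc (n - i))) (Suc n) \<oplus> d 0"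
    using psum_cong[of "Suc n" "\<lambda>i. d (Suc n - i)" "\<lambda>i. d (Suc (n - i))" G]
    by (simp add: Suc_diff_le)
  also have "\<dots> = psum G (\<lambda>i. d (Suc i)) (Suc n) \<oplus> d 0"
    using Suc.prems by (subst Suc.IH) auto
  also have "\<dots> = psum G d (Suc (Suc n))"
    using Suc.prems by (subst (2) psum_shift) (auto intro: a_comm)
  finally show ?case .
qed simp

lemma finsum_lessThan_psum:
  "(\<And>i. i < n \<Longrightarrow> d i \<in> carrier G) \<Longrightarrow> (\<Oplus>i\<in>{..<n}. d i) = psum G d n"
  by (induction n) (auto simp: lessThan_Suc Pi_def a_comm)

lemma finsum_atMost_psum:
  "(\<And>i. i \<le> n \<Longrightarrow> d i \<in> carrier G) \<Longrightarrow> (\<Oplus>i\<in>{..n}. d i) = psum G d (Suc n)"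
  using finsum_lessThan_psum[of "Suc n" d] by (simp add: lessThan_Suc_atMost)

end

lemma (in ring) psum_mult_r:
  "(\<And>i. i < n \<Longrightarrow> d i \<in> carrier R) \<Longrightarrow> x \<in> carrier R \<Longrightarrow>
    psum R d n \<otimes> x = psum R (\<lambda>i. d i \<otimes> x) n"
  by (induction n) (auto simp: l_distr)

lemma (in ring) psum_mult_l:
  "(\<And>i. i < n \<Longrightarrow> d i \<in> carrier R) \<Longrightarrow> x \<in> carrier R \<Longrightarrow>
    x \<otimes> psum R d n = psum R (\<lambda>i. x \<otimes> d i) n"
  by (induction n) (auto simp: r_distr)

lemma (in assoc_alg) psum_smult:
  "(\<And>i. i < n \<Longrightarrow> d i \<in> carrier A) \<Longrightarrow> t \<odot> psum A d n = psum A (\<lambda>i. t \<odot> d i) n"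
  by (induction n) (auto simp: smult_r_distr)


subsection \<open>Linear maps and homomorphisms\<close>

text \<open>Polymorphic in the scalars, so that it serves real algebras as well as algebras over
  \<open>kk\<close>; \<open>klinear\<close> is the instance for \<open>kk\<close>.\<close>

definition lin :: "('k, 'a) module \<Rightarrow> ('k, 'b) module \<Rightarrow> ('a \<Rightarrow> 'b) \<Rightarrow> bool" where
  "lin A B f \<longleftrightarrow> f \<in> carrier A \<rightarrow> carrier B \<and>
    (\<forall>x\<in>carrier A. \<forall>y\<in>carrier A. f (x \<oplus>\<^bsub>A\<^esub> y) = f x \<oplus>\<^bsub>B\<^esub> f y) \<and>
    (\<forall>t. \<forall>x\<in>carrier A. f (t \<odot>\<^bsub>A\<^esub> x) = t \<odot>\<^bsub>B\<^esub> f x)"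

lemma klinear_eq_lin: "klinear = lin"
  by (intro ext) (simp add: klinear_def lin_def)

definition alg_hom :: "('k, 'a) module \<Rightarrow> ('k, 'b) module \<Rightarrow> ('a \<Rightarrow> 'b) \<Rightarrow> bool" where
  "alg_hom A B f \<longleftrightarrow> lin A B f \<and> f \<in> ring_hom A B"

lemma linI:
  "(\<And>x. x \<in> carrier A \<Longrightarrow> f x \<in> carrier B) \<Longrightarrow>
   (\<And>x y. x \<in> carrier A \<Longrightarrow> y \<in> carrier A \<Longrightarrow> f (x \<oplus>\<^bsub>A\<^esub> y) = f x \<oplus>\<^bsub>B\<^esub> f y) \<Longrightarrow>
   (\<And>t x. x \<in> carrier A \<Longrightarrow> f (t \<odot>\<^bsub>A\<^esub> x) = t \<odot>\<^bsub>B\<^esub> f x) \<Longrightarrow> lin A B f"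
  by (auto simp: lin_def)

lemma alg_homI:
  "lin A B f \<Longrightarrow> (\<And>x y. x \<in> carrier A \<Longrightarrow> y \<in> carrier A \<Longrightarrow> f (x \<otimes>\<^bsub>A\<^esub> y) = f x \<otimes>\<^bsub>B\<^esub> f y) \<Longrightarrow>
    f \<one>\<^bsub>A\<^esub> = \<one>\<^bsub>B\<^esub> \<Longrightarrow> alg_hom A B f"
  by (auto simp: alg_hom_def lin_def intro!: ring_hom_memI)

lemma lin_closed: "lin A B f \<Longrightarrow> x \<in> carrier A \<Longrightarrow> f x \<in> carrier B"
  and lin_add: "lin A B f \<Longrightarrow> x \<in> carrier A \<Longrightarrow> y \<in> carrier A \<Longrightarrow> f (x \<oplus>\<^bsub>A\<^esub> y) = f x \<oplus>\<^bsub>B\<^esub> f y"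
  and lin_smult: "lin A B f \<Longrightarrow> x \<in> carrier A \<Longrightarrow> f (t \<odot>\<^bsub>A\<^esub> x) = t \<odot>\<^bsub>B\<^esub> f x"
  by (auto simp: lin_def)

lemma alg_hom_lin: "alg_hom A B f \<Longrightarrow> lin A B f"
  and alg_hom_closed: "alg_hom A B f \<Longrightarrow> x \<in> carrier A \<Longrightarrow> f x \<in> carrier B"
  and alg_hom_add: "alg_hom A B f \<Longrightarrow> x \<in> carrier A \<Longrightarrow> y \<in> carrier A \<Longrightarrow> f (x \<oplus>\<^bsub>A\<^esub> y) = f x \<oplus>\<^bsub>B\<^esub> f y"
  and alg_hom_smult: "alg_hom A B f \<Longrightarrow> x \<in> carrier A \<Longrightarrow> f (t \<odot>\<^bsub>A\<^esub> x) = t \<odot>\<^bsub>B\<^esub> f x"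
  and alg_hom_mult: "alg_hom A B f \<Longrightarrow> x \<in> carrier A \<Longrightarrow> y \<in> carrier A \<Longrightarrow> f (x \<otimes>\<^bsub>A\<^esub> y) = f x \<otimes>\<^bsub>B\<^esub> f y"
  and alg_hom_one: "alg_hom A B f \<Longrightarrow> f \<one>\<^bsub>A\<^esub> = \<one>\<^bsub>B\<^esub>"
  by (auto simp: lin_def alg_hom_def ring_hom_def)

lemma lin_comp:
  assumes "lin A B f" "lin B C g" shows "lin A C (\<lambda>x. g (f x))"
  using assms unfolding lin_def by (auto simp: Pi_iff)

lemma alg_hom_comp:
  assumes "alg_hom A B f" "alg_hom B C g" shows "alg_hom A C (\<lambda>x. g (f x))"
  using assms lin_comp[OF assms[THEN alg_hom_lin]]
  by (intro alg_homI) (auto simp: alg_hom_def ring_hom_def Pi_iff)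

lemma lin_id: "lin A A (\<lambda>x. x)"
  by (simp add: lin_def)

lemma alg_hom_id: "alg_hom A A (\<lambda>x. x)"
  by (simp add: lin_id alg_homI)

lemma lin_zero:
  assumes "assoc_alg A" "assoc_alg B" "lin A B f" shows "f \<zero>\<^bsub>A\<^esub> = \<zero>\<^bsub>B\<^esub>"
proof -
  interpret A: assoc_alg A by fact
  interpret B: assoc_alg B by fact
  have "f (0 \<odot>\<^bsub>A\<^esub> \<zero>\<^bsub>A\<^esub>) = 0 \<odot>\<^bsub>B\<^esub> f \<zero>\<^bsub>A\<^esub>"
    using assms by (intro lin_smult) auto
  then show ?thesis by (simp add: lin_closed[OF assms(3)])
qed

lemma lin_minus:
  assumes "assoc_alg A" "assoc_alg B" "lin A B f" "x \<in> carrier A"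
  shows "f (\<ominus>\<^bsub>A\<^esub> x) = \<ominus>\<^bsub>B\<^esub> f x"
proof -
  interpret A: assoc_alg A by fact
  interpret B: assoc_alg B by fact
  have "f ((-1) \<odot>\<^bsub>A\<^esub> x) = (-1) \<odot>\<^bsub>B\<^esub> f x"
    using assms by (intro lin_smult) auto
  then show ?thesis using assms(4) by (simp add: lin_closed[OF assms(3)] A.smult_minus_l B.smult_minus_l)
qed

lemma lin_diff:
  assumes "assoc_alg A" "assoc_alg B" "lin A B f" "x \<in> carrier A" "y \<in> carrier A"
  shows "f (x \<ominus>\<^bsub>A\<^esub> y) = f x \<ominus>\<^bsub>B\<^esub> f y"
proof -
  interpret A: assoc_alg A by fact
  interpret B: assoc_alg B by fact
  show ?thesis using assms(4,5)
    by (simp add: A.minus_eq B.minus_eq lin_add[OF assms(3)] lin_minus[OF assms(1-3)])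
qed

lemma lin_psum:
  assumes "assoc_alg A" "assoc_alg B" "lin A B f" "\<And>i. i < n \<Longrightarrow> d i \<in> carrier A"
  shows "f (psum A d n) = psum B (\<lambda>i. f (d i)) n"
proof -
  interpret A: assoc_alg A by fact
  show ?thesis using assms(4)
    by (induction n) (auto simp: lin_zero[OF assms(1-3)] lin_add[OF assms(3)])
qed

lemma alg_hom_pow:
  assumes "assoc_alg A" "assoc_alg B" "alg_hom A B f" "x \<in> carrier A"
  shows "f (x [^]\<^bsub>A\<^esub> (n::nat)) = f x [^]\<^bsub>B\<^esub> n"
proof -
  interpret A: assoc_alg A by fact
  interpret B: assoc_alg B by fact
  show ?thesis using assms(4)
    by (induction n) (auto simp: alg_hom_one[OF assms(3)] alg_hom_mult[OF assms(3)])
qed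

lemma lin_factor:
  assumes p: "lin A Q p" and surj: "p ` carrier A = carrier Q"
    and f: "lin A B f" and k: "\<And>x. x \<in> carrier A \<Longrightarrow> p x = \<zero>\<^bsub>Q\<^esub> \<Longrightarrow> f x = \<zero>\<^bsub>B\<^esub>"
    and alg: "assoc_alg A" "assoc_alg Q" "assoc_alg B"
  obtains g where "lin Q B g" "\<And>x. x \<in> carrier A \<Longrightarrow> g (p x) = f x"
proof -
  interpret A: assoc_alg A by fact
  interpret B: assoc_alg B by fact
  interpret Q: assoc_alg Q by fact
  \<comment> \<open>A set-theoretic section of \<open>p\<close>; by hypothesis \<open>k\<close> the
    value of \<open>f\<close> does not depend on the chosen preimage.\<close>
  define r where "r y = (SOME x. x \<in> carrier A \<and> p x = y)" for y
  have r: "r y \<in> carrier A \<and> p (r y) = y" if "y \<in> carrier Q" for y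
  proof -
    have "y \<in> p ` carrier A" using surj that by simp
    then have "\<exists>x. x \<in> carrier A \<and> p x = y" by auto
    then show ?thesis unfolding r_def by (rule someI_ex)
  qed
  define g where "g y = f (r y)" for y
  have g: "g (p x) = f x" if x: "x \<in> carrier A" for x
  proof -
    have r': "r (p x) \<in> carrier A" "p (r (p x)) = p x"
      using r[OF lin_closed[OF p x]] by auto
    then have "p (r (p x) \<ominus>\<^bsub>A\<^esub> x) = \<zero>\<^bsub>Q\<^esub>"
      using x by (simp add: lin_diff[OF alg(1,2) p] lin_closed[OF p] Q.eq_diff_zero)
    then have "f (r (p x)) \<ominus>\<^bsub>B\<^esub> f x = \<zero>\<^bsub>B\<^esub>"
      using k[of "r (p x) \<ominus>\<^bsub>A\<^esub> x"] r' x
      by (simp add: lin_diff[OF alg(1,3) f])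
    then show ?thesis
      using r' x by (simp add: g_def B.eq_diff_zero lin_closed[OF f])
  qed
  have "lin Q B g"
  proof (rule linI)
    fix x assume "x \<in> carrier Q"
    then show "g x \<in> carrier B" using r by (simp add: g_def lin_closed[OF f])
  next
    fix x y assume "x \<in> carrier Q" "y \<in> carrier Q"
    then obtain x' y' where "x = p x'" "y = p y'" "x' \<in> carrier A" "y' \<in> carrier A"
      using surj by blast
    then show "g (x \<oplus>\<^bsub>Q\<^esub> y) = g x \<oplus>\<^bsub>B\<^esub> g y"
      by (simp flip: lin_add[OF p] add: g) (simp add: lin_add[OF f])
  next
    fix t x assume "x \<in> carrier Q"
    then obtain x' where "x = p x'" "x' \<in> carrier A"
      using surj by blast
    then show "g (t \<odot>\<^bsub>Q\<^esub> x) = t \<odot>\<^bsub>B\<^esub> g x"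
      by (simp flip: lin_smult[OF p] add: g) (simp add: lin_smult[OF f])
  qed
  with g show ?thesis using that by blast
qed

lemma alg_hom_factor:
  assumes p: "alg_hom A Q p" and surj: "p ` carrier A = carrier Q"
    and f: "alg_hom A B f" and k: "\<And>x. x \<in> carrier A \<Longrightarrow> p x = \<zero>\<^bsub>Q\<^esub> \<Longrightarrow> f x = \<zero>\<^bsub>B\<^esub>"
    and alg: "assoc_alg A" "assoc_alg Q" "assoc_alg B"
  obtains g where "alg_hom Q B g" "\<And>x. x \<in> carrier A \<Longrightarrow> g (p x) = f x"
proof -
  interpret A: assoc_alg A by fact
  obtain g where g: "lin Q B g" "\<And>x. x \<in> carrier A \<Longrightarrow> g (p x) = f x"
    using lin_factor[OF alg_hom_lin[OF p] surj alg_hom_lin[OF f] k alg] by blast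
  have "alg_hom Q B g"
  proof (rule alg_homI[OF g(1)])
    fix x y assume "x \<in> carrier Q" "y \<in> carrier Q"
    then obtain x' y' where "x = p x'" "y = p y'" "x' \<in> carrier A" "y' \<in> carrier A"
      using surj by blast
    then show "g (x \<otimes>\<^bsub>Q\<^esub> y) = g x \<otimes>\<^bsub>B\<^esub> g y"
      by (simp flip: alg_hom_mult[OF p] add: g) (simp add: alg_hom_mult[OF f])
  next
    show "g \<one>\<^bsub>Q\<^esub> = \<one>\<^bsub>B\<^esub>"
      using g(2)[of "\<one>\<^bsub>A\<^esub>"] by (simp add: alg_hom_one[OF p] alg_hom_one[OF f])
  qed
  with g(2) show ?thesis using that by blast
qed

lemma kernel_ideal:
  assumes "assoc_alg A" "assoc_alg B" "alg_hom A B f"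
  shows "ideal {x \<in> carrier A. f x = \<zero>\<^bsub>B\<^esub>} A"
proof -
  interpret A: assoc_alg A by fact
  interpret B: assoc_alg B by fact
  note f = lin_minus[OF assms(1,2) alg_hom_lin[OF assms(3)]] lin_zero[OF assms(1,2) alg_hom_lin[OF assms(3)]]
    alg_hom_add[OF assms(3)] alg_hom_mult[OF assms(3)] alg_hom_closed[OF assms(3)]
  show ?thesis
    by (rule idealI[OF A.ring_axioms A.add.subgroupI]) (auto simp: f)
qed


subsection \<open>Quotient algebras\<close>

context assoc_alg
begin

lemma quot_alg_simps:
  assumes "ideal I A"
  shows "carrier (quot_alg A I) = (\<lambda>x. I +> x) ` carrier A"
    and "x \<in> carrier A \<Longrightarrow> y \<in> carrier A \<Longrightarrow>
      (I +> x) \<otimes>\<^bsub>quot_alg A I\<^esub> (I +> y) = I +> (x \<otimes> y)"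
    and "x \<in> carrier A \<Longrightarrow> y \<in> carrier A \<Longrightarrow>
      (I +> x) \<oplus>\<^bsub>quot_alg A I\<^esub> (I +> y) = I +> (x \<oplus> y)"
    and "\<one>\<^bsub>quot_alg A I\<^esub> = I +> \<one>" "\<zero>\<^bsub>quot_alg A I\<^esub> = I +> \<zero>"
    and "x \<in> carrier A \<Longrightarrow> t \<odot>\<^bsub>quot_alg A I\<^esub> (I +> x) = I +> (t \<odot> x)"
proof -
  interpret I: ideal I A by fact
  show "carrier (quot_alg A I) = (\<lambda>x. I +> x) ` carrier A"
    by (auto simp: quot_alg_def FactRing_simps)
  show "(I +> x) \<otimes>\<^bsub>quot_alg A I\<^esub> (I +> y) = I +> (x \<otimes> y)"
    if "x \<in> carrier A" "y \<in> carrier A"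
    using that by (simp add: quot_alg_def FactRing_def I.rcoset_mult_add)
  show "(I +> x) \<oplus>\<^bsub>quot_alg A I\<^esub> (I +> y) = I +> (x \<oplus> y)"
    if "x \<in> carrier A" "y \<in> carrier A"
    using that by (simp add: quot_alg_def FactRing_def I.a_rcos_sum)
  show "\<one>\<^bsub>quot_alg A I\<^esub> = I +> \<one>" by (simp add: quot_alg_def FactRing_def)
  show "\<zero>\<^bsub>quot_alg A I\<^esub> = I +> \<zero>"
    using a_rcos_zero[OF assms] I.zero_closed by (simp add: quot_alg_def FactRing_def)
  show "t \<odot>\<^bsub>quot_alg A I\<^esub> (I +> x) = I +> (t \<odot> x)" if x: "x \<in> carrier A"
  proof -
    \<comment> \<open>The scalar action on cosets is a union over representatives; all members of
      the union coincide because \<open>I\<close> is stable under scalars.\<close>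
    have eq: "I +> (t \<odot> y) = I +> (t \<odot> x)" if y: "y \<in> I +> x" for y
    proof -
      obtain h where h: "h \<in> I" "y = h \<oplus> x"
        using y by (auto simp: a_r_coset_def')
      have "t \<odot> y = t \<odot> h \<oplus> t \<odot> x"
        using h x by (simp add: smult_r_distr)
      then have "t \<odot> y \<in> I +> (t \<odot> x)"
        using ideal_smult[OF assms h(1)] by (auto simp: a_r_coset_def')
      then show ?thesis using I.a_repr_independence'[of "t \<odot> y" "t \<odot> x"] x by simp
    qed
    have "t \<odot>\<^bsub>quot_alg A I\<^esub> (I +> x) = (\<Union>y\<in>I +> x. I +> (t \<odot> y))"
      by (simp add: quot_alg_def)
    also have "\<dots> = (\<Union>y\<in>I +> x. I +> (t \<odot> x))"
      by (rule SUP_cong) (simp_all add: eq)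
    also have "\<dots> = I +> (t \<odot> x)"
      using I.a_rcos_self[OF x] by (intro SUP_const) auto
    finally show ?thesis .
  qed
qed

lemma rcos_eq_zero_iff:
  assumes "ideal I A" "x \<in> carrier A"
  shows "I +> x = \<zero>\<^bsub>quot_alg A I\<^esub> \<longleftrightarrow> x \<in> I"
proof -
  interpret I: ideal I A by fact
  have "\<zero>\<^bsub>quot_alg A I\<^esub> = I" by (simp add: quot_alg_def FactRing_def)
  then show ?thesis
    using assms I.rcos_const_imp_mem a_rcos_zero by auto
qed

lemma assoc_alg_quot:
  assumes "ideal I A" shows "assoc_alg (quot_alg A I)"
proof -
  interpret I: ideal I A by fact
  interpret Q: ring "A Quot I" by (rule I.quotient_is_ring)
  let ?Q = "quot_alg A I"
  have "ring ?Q"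
    by (rule ringI; (rule abelian_groupI monoidI)?)
      (use Q.add.m_assoc Q.a_comm Q.l_neg Q.a_inv_closed in
        \<open>auto simp: quot_alg_def Q.m_assoc Q.l_distr Q.r_distr Q.a_ac intro!: bexI[of _ "\<ominus>\<^bsub>A Quot I\<^esub> x" for x]\<close>)
  then show ?thesis
    by (intro assoc_alg.intro assoc_alg_axioms.intro)
      (auto simp: quot_alg_simps[OF assms] smult_l_distr smult_r_distr smult_assoc smult_mult_l smult_mult_r)
qed

lemma alg_hom_rcos:
  assumes "ideal I A" shows "alg_hom A (quot_alg A I) (\<lambda>x. I +> x)"
  by (intro alg_homI linI) (simp_all add: quot_alg_simps[OF assms])

end


section \<open>The adic topology\<close>

lemma kalg_simps [simp]:
  "carrier kalg = UNIV" "x \<otimes>\<^bsub>kalg\<^esub> y = x * y" "x \<oplus>\<^bsub>kalg\<^esub> y = x + y"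
  "\<one>\<^bsub>kalg\<^esub> = 1" "\<zero>\<^bsub>kalg\<^esub> = 0" "x \<odot>\<^bsub>kalg\<^esub> y = x * y"
  by (simp_all add: kalg_def)

lemma kreal_simps [simp]:
  "kreal 0 = 0" "kreal 1 = 1" "kreal (a + b) = kreal a + kreal b" "kreal (a * b) = kreal a * kreal b"
  "kreal (- a) = - kreal a" "kreal (a - b) = kreal a - kreal b" "kreal (a ^ n) = kreal a ^ n"
proof -
  show m: "kreal (a * b) = kreal a * kreal b" for a b by (simp add: kreal_def)
  show 1: "kreal 1 = 1" by (simp add: kreal_def)
  show "kreal (a ^ n) = kreal a ^ n" by (induction n) (simp_all add: m 1)
qed (simp_all add: kreal_def fps_const_add[symmetric] fps_const_neg[symmetric] fps_const_sub[symmetric]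
    del: fps_const_add fps_const_neg fps_const_sub)

lemma kcoeff_simps [simp]:
  "kcoeff (s + t) i j = kcoeff s i j + kcoeff t i j"
  "kcoeff (s - t) i j = kcoeff s i j - kcoeff t i j"
  "kcoeff 0 i j = 0"
  by (simp_all add: kcoeff_def)

lemma kcoeff_sum: "kcoeff (sum f S) i j = (\<Sum>x\<in>S. kcoeff (f x) i j)"
  by (induction S rule: infinite_finite_induct) simp_all

lemma kcoeff_monom:
  "kcoeff (kreal a * (c1 ^ i * c2 ^ j)) i' j' = (if i = i' \<and> j = j' then a else 0)"
  by (auto simp: kcoeff_def kreal_def c1_def c2_def fps_const_power fps_X_power_mult_right_nth
      simp flip: mult.assoc)

locale topalg = assoc_alg A for A :: "(kk, 'a) module" (structure)
begin

lemma adic_nbhd_psum: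
  "adic_nbhd A n = {psum A (\<lambda>i. (c1 ^ i * c2 ^ (n - i)) \<odot> f i) (Suc n) | f. f \<in> {..n} \<rightarrow> carrier A}"
proof -
  have eq: "(\<Oplus>i\<in>{..n}. (c1 ^ i * c2 ^ (n - i)) \<odot> f i) = psum A (\<lambda>i. (c1 ^ i * c2 ^ (n - i)) \<odot> f i) (Suc n)"
    if "f \<in> {..n} \<rightarrow> carrier A" for f
    using that by (intro finsum_atMost_psum) auto
  show ?thesis
    unfolding adic_nbhd_def
  proof (intro Collect_cong ex_cong1)
    fix x f
    show "(x = (\<Oplus>i\<in>{..n}. (c1 ^ i * c2 ^ (n - i)) \<odot> f i) \<and> f \<in> {..n} \<rightarrow> carrier A) =
      (x = psum A (\<lambda>i. (c1 ^ i * c2 ^ (n - i)) \<odot> f i) (Suc n) \<and> f \<in> {..n} \<rightarrow> carrier A)"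
      by (cases "f \<in> {..n} \<rightarrow> carrier A") (simp_all only: eq simp_thms)
  qed
qed

lemma nbhd_closed [simp]: "x \<in> adic_nbhd A n \<Longrightarrow> x \<in> carrier A"
proof -
  assume "x \<in> adic_nbhd A n"
  then obtain f where f: "f \<in> {..n} \<rightarrow> carrier A"
    "x = psum A (\<lambda>i. (c1 ^ i * c2 ^ (n - i)) \<odot> f i) (Suc n)"
    unfolding adic_nbhd_psum by blast
  show ?thesis unfolding f(2) using f(1) by (intro psum_closed smult_closed) auto
qed

lemma nbhd_gen: "x \<in> carrier A \<Longrightarrow> i \<le> n \<Longrightarrow> (c1 ^ i * c2 ^ (n - i)) \<odot> x \<in> adic_nbhd A n"
  unfolding adic_nbhd_psum
  by (intro CollectI exI[of _ "\<lambda>j. if j = i then x else \<zero>"])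
    (auto simp del: psum.simps simp: psum_single[of i])

lemma nbhd_add:
  assumes "x \<in> adic_nbhd A n" "y \<in> adic_nbhd A n" shows "x \<oplus> y \<in> adic_nbhd A n"
proof -
  obtain f g where f: "f \<in> {..n} \<rightarrow> carrier A" "g \<in> {..n} \<rightarrow> carrier A"
    "x = psum A (\<lambda>i. (c1 ^ i * c2 ^ (n - i)) \<odot> f i) (Suc n)"
    "y = psum A (\<lambda>i. (c1 ^ i * c2 ^ (n - i)) \<odot> g i) (Suc n)"
    using assms unfolding adic_nbhd_psum by blast
  have "x \<oplus> y = psum A (\<lambda>i. (c1 ^ i * c2 ^ (n - i)) \<odot> f i \<oplus> (c1 ^ i * c2 ^ (n - i)) \<odot> g i) (Suc n)"
    unfolding f(3,4) using f(1,2) by (intro psum_add[symmetric]) (auto simp: Pi_iff)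
  also have "\<dots> = psum A (\<lambda>i. (c1 ^ i * c2 ^ (n - i)) \<odot> (f i \<oplus> g i)) (Suc n)"
    using f(1,2) by (intro psum_cong) (auto simp: Pi_iff smult_r_distr)
  finally show ?thesis
    unfolding adic_nbhd_psum using f(1,2)
    by (intro CollectI exI[of _ "\<lambda>i. f i \<oplus> g i"]) (auto simp del: psum.simps)
qed

lemma nbhd_smult:
  assumes "x \<in> adic_nbhd A n" shows "t \<odot> x \<in> adic_nbhd A n"
proof -
  obtain f where f: "f \<in> {..n} \<rightarrow> carrier A"
    "x = psum A (\<lambda>i. (c1 ^ i * c2 ^ (n - i)) \<odot> f i) (Suc n)"
    using assms unfolding adic_nbhd_psum by blast
  have "t \<odot> x = psum A (\<lambda>i. t \<odot> ((c1 ^ i * c2 ^ (n - i)) \<odot> f i)) (Suc n)"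
    unfolding f(2) using f(1) by (intro psum_smult) (auto simp: Pi_iff)
  also have "\<dots> = psum A (\<lambda>i. (c1 ^ i * c2 ^ (n - i)) \<odot> (t \<odot> f i)) (Suc n)"
    using f(1) by (intro psum_cong smult_comm) (auto simp: Pi_iff)
  finally show ?thesis
    unfolding adic_nbhd_psum using f(1)
    by (intro CollectI exI[of _ "\<lambda>i. t \<odot> f i"]) (auto simp del: psum.simps)
qed

lemma nbhd_zero [simp]: "\<zero> \<in> adic_nbhd A n"
  using nbhd_gen[of \<zero> 0 n] by simp

lemma nbhd_minus: "x \<in> adic_nbhd A n \<Longrightarrow> \<ominus> x \<in> adic_nbhd A n"
  using nbhd_smult[of x n "- 1"] by (simp add: smult_minus_l)

lemma nbhd_diff: "x \<in> adic_nbhd A n \<Longrightarrow> y \<in> adic_nbhd A n \<Longrightarrow> x \<ominus> y \<in> adic_nbhd A n"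
  by (simp add: minus_eq nbhd_add nbhd_minus)

lemma nbhd_psum: "(\<And>i. i < m \<Longrightarrow> d i \<in> adic_nbhd A n) \<Longrightarrow> psum A d m \<in> adic_nbhd A n"
  by (induction m) (auto simp: nbhd_add)

text \<open>The neighbourhood is the additive span of the monomial multiples of carrier elements, so
  additive properties need checking only there.\<close>

lemma nbhd_induct [consumes 1, case_names gen zero add]:
  assumes "x \<in> adic_nbhd A n"
    and "\<And>i x. i \<le> n \<Longrightarrow> x \<in> carrier A \<Longrightarrow> P ((c1 ^ i * c2 ^ (n - i)) \<odot> x)"
    and "P \<zero>" "\<And>x y. x \<in> adic_nbhd A n \<Longrightarrow> y \<in> adic_nbhd A n \<Longrightarrow> P x \<Longrightarrow> P y \<Longrightarrow> P (x \<oplus> y)"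
  shows "P x"
proof -
  obtain f where f: "f \<in> {..n} \<rightarrow> carrier A"
    "x = psum A (\<lambda>i. (c1 ^ i * c2 ^ (n - i)) \<odot> f i) (Suc n)"
    using assms(1) unfolding adic_nbhd_psum by blast
  have "P (psum A (\<lambda>i. (c1 ^ i * c2 ^ (n - i)) \<odot> f i) m)" if "m \<le> Suc n" for m
    using that
  proof (induction m)
    case (Suc m)
    then have "f m \<in> carrier A" using f(1) by auto
    then show ?case
      unfolding psum.simps using Suc f(1)
      by (intro assms(2,4) nbhd_psum nbhd_gen) (auto simp: Pi_iff)
  qed (simp add: assms(3))
  then show ?thesis unfolding f(2) by blast
qed

lemma nbhd_monom: "x \<in> carrier A \<Longrightarrow> n \<le> i + j \<Longrightarrow> (c1 ^ i * c2 ^ j) \<odot> x \<in> adic_nbhd A n"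
proof -
  assume x: "x \<in> carrier A" and n: "n \<le> i + j"
  \<comment> \<open>A divisor of degree exactly \<open>n\<close> is split off the monomial, using as
    many factors \<open>c1\<close> as are available.\<close>
  define k where "k = min i n"
  have "c1 ^ i * c2 ^ j = (c1 ^ k * c2 ^ (n - k)) * (c1 ^ (i - k) * c2 ^ (j - (n - k)))"
    using n by (simp add: k_def algebra_simps flip: power_add)
  then show ?thesis
    using nbhd_gen[of "(c1 ^ (i - k) * c2 ^ (j - (n - k))) \<odot> x" k n] x
    by (simp add: smult_assoc k_def)
qed

lemma nbhd_antimono: "x \<in> adic_nbhd A m \<Longrightarrow> n \<le> m \<Longrightarrow> x \<in> adic_nbhd A n"
  by (induction rule: nbhd_induct) (auto intro: nbhd_monom nbhd_add)

lemma nbhd_0 [simp]: "adic_nbhd A 0 = carrier A"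
  using nbhd_gen[of _ 0 0] by auto

lemma nbhd_monom_smult:
  "x \<in> adic_nbhd A n \<Longrightarrow> (c1 ^ i * c2 ^ j) \<odot> x \<in> adic_nbhd A (i + j + n)"
proof (induction rule: nbhd_induct)
  case (gen k x)
  have "(c1 ^ i * c2 ^ j) * (c1 ^ k * c2 ^ (n - k)) = c1 ^ (i + k) * c2 ^ (j + (n - k))"
    by (simp only: power_add mult_ac)
  then show ?case
    using gen nbhd_monom[of x "i + j + n" "i + k" "j + (n - k)"] by (simp flip: smult_assoc)
qed (auto simp: smult_r_distr nbhd_add)

lemma nbhd_mult_l: "x \<in> adic_nbhd A n \<Longrightarrow> y \<in> carrier A \<Longrightarrow> y \<otimes> x \<in> adic_nbhd A n"
  by (induction rule: nbhd_induct) (auto simp: smult_mult_r r_distr nbhd_add nbhd_gen)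

lemma nbhd_mult:
  assumes "x \<in> adic_nbhd A m" "y \<in> adic_nbhd A n" shows "x \<otimes> y \<in> adic_nbhd A (m + n)"
  using assms(1)
proof (induction rule: nbhd_induct)
  case (gen i x)
  then show ?case
    using nbhd_monom_smult[OF nbhd_mult_l[OF assms(2)], of x i "m - i"] assms(2)
    by (simp add: smult_mult_l)
qed (use assms in \<open>auto simp: l_distr nbhd_add\<close>)

lemma nbhd_mult_r: "x \<in> adic_nbhd A n \<Longrightarrow> y \<in> carrier A \<Longrightarrow> x \<otimes> y \<in> adic_nbhd A n"
  using nbhd_mult[of x n y 0] by simp

lemma nbhd_pow: "x \<in> adic_nbhd A 1 \<Longrightarrow> x [^] (n::nat) \<in> adic_nbhd A n"
proof (induction n)
  case (Suc n)
  then show ?case using nbhd_mult[of "x [^] n" n x 1] by simp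
qed simp

lemma nbhd_trans:
  "x \<in> carrier A \<Longrightarrow> y \<in> carrier A \<Longrightarrow> z \<in> carrier A \<Longrightarrow>
    x \<ominus> y \<in> adic_nbhd A n \<Longrightarrow> y \<ominus> z \<in> adic_nbhd A n \<Longrightarrow> x \<ominus> z \<in> adic_nbhd A n"
  using diff_trans[of x y z] nbhd_add by simp

lemma nbhd_sym:
  assumes "x \<in> carrier A" "y \<in> carrier A" "x \<ominus> y \<in> adic_nbhd A n"
  shows "y \<ominus> x \<in> adic_nbhd A n"
proof -
  have "y \<ominus> x = \<ominus> (x \<ominus> y)"
    using assms(1,2) by (simp add: minus_eq minus_add a_comm)
  then show ?thesis using nbhd_minus[OF assms(3)] by simp
qed

end

section \<open>Neighbourhoods under linear maps and in the base ring\<close>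

lemma topalg_kalg: "topalg kalg"
  by (simp add: topalg_def assoc_alg_kalg)

lemma lin_nbhd:
  assumes "topalg A" "topalg B" "lin A B f" "x \<in> adic_nbhd A n"
  shows "f x \<in> adic_nbhd B n"
proof -
  interpret A: topalg A by fact
  interpret B: topalg B by fact
  show ?thesis using assms(4)
    by (induction rule: A.nbhd_induct)
      (auto simp: lin_smult[OF assms(3)] lin_add[OF assms(3)] lin_closed[OF assms(3)]
        lin_zero[OF A.assoc_alg_axioms B.assoc_alg_axioms assms(3)] intro: B.nbhd_gen B.nbhd_add)
qed

text \<open>A generator lifts to the same monomial times a preimage. The gain is that the lift stays
  in the neighbourhood of the same order, so that convergent series can be lifted along quotient
  maps.\<close>

lemma lin_nbhd_surj:
  assumes "topalg A" "topalg B" "lin A B f" "f ` carrier A = carrier B" "y \<in> adic_nbhd B n"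
  shows "\<exists>x\<in>adic_nbhd A n. f x = y"
proof -
  interpret A: topalg A by fact
  interpret B: topalg B by fact
  show ?thesis using assms(5)
  proof (induction rule: B.nbhd_induct)
    case (gen i y)
    have "y \<in> f ` carrier A" using gen(2) assms(4) by simp
    then obtain x where "x \<in> carrier A" "f x = y" by auto
    then show ?case using gen(1) 
      by (intro bexI[of _ "(c1 ^ i * c2 ^ (n - i)) \<odot>\<^bsub>A\<^esub> x"])
        (auto simp: lin_smult[OF assms(3)] intro: A.nbhd_gen)
  next
    case zero
    show ?case
      by (intro bexI[of _ "\<zero>\<^bsub>A\<^esub>"])
        (auto simp: lin_zero[OF A.assoc_alg_axioms B.assoc_alg_axioms assms(3)])
  next
    case (add y y')
    then obtain x x' where "x \<in> adic_nbhd A n" "x' \<in> adic_nbhd A n" "f x = y" "f x' = y'" by auto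
    then show ?case
      by (intro bexI[of _ "x \<oplus>\<^bsub>A\<^esub> x'"]) (auto simp: lin_add[OF assms(3)] intro: A.nbhd_add)
  qed
qed

lemma (in topalg) nbhd_scalar:
  assumes "t \<in> adic_nbhd kalg m" "x \<in> adic_nbhd A n"
  shows "t \<odot> x \<in> adic_nbhd A (m + n)"
proof -
  interpret K: topalg kalg by (rule topalg_kalg)
  show ?thesis using assms(1)
  proof (induction rule: K.nbhd_induct)
    case (gen i t)
    then show ?case
      using nbhd_monom_smult[OF nbhd_smult[OF assms(2)], of i "m - i" t] assms(2)
      by (simp add: smult_assoc)
  qed (use assms(2) in \<open>auto simp: smult_l_distr nbhd_add\<close>)
qed

text \<open>Write \<open>t = c1^(n+1) w + c2 v\<close>: the part without \<open>c2\<close> vanishes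
  to order \<open>n + 1\<close> as a series in \<open>c1\<close>, and \<open>v\<close> vanishes to
  order \<open>n\<close>, so the induction hypothesis applies to it.\<close>

lemma kalg_nbhdI:
  assumes "\<And>i j. i + j < n \<Longrightarrow> kcoeff t i j = 0"
  shows "t \<in> adic_nbhd kalg n"
proof -
  interpret K: topalg kalg by (rule topalg_kalg)
  show ?thesis using assms
  proof (induction n arbitrary: t)
    case (Suc n)
    define v where "v = fps_shift 1 t"
    define w where "w = fps_shift (Suc n) (fps_nth t 0)"
    have "v \<in> adic_nbhd kalg n"
      by (rule Suc.IH) (use Suc.prems in \<open>simp add: v_def kcoeff_def\<close>)
    then have 1: "c2 * v \<in> adic_nbhd kalg (Suc n)"
      using K.nbhd_monom_smult[of v n 0 1] by simp
    have 2: "c1 ^ Suc n * fps_const w \<in> adic_nbhd kalg (Suc n)"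
      using K.nbhd_monom[of "fps_const w" "Suc n" "Suc n" 0] by simp
    have "fps_nth t 0 = fps_X ^ Suc n * w"
      using Suc.prems[of _ 0]
      by (intro fps_ext) (auto simp: w_def kcoeff_def fps_X_power_mult_nth simp del: power_Suc)
    then have "fps_const (fps_nth t 0) = c1 ^ Suc n * fps_const w"
      by (simp add: c1_def fps_const_power del: power_Suc flip: fps_const_mult)
    moreover have "t = fps_const (fps_nth t 0) + c2 * v"
      unfolding v_def c2_def by (intro fps_ext) (auto simp: fps_X_mult_nth)
    ultimately show ?case using K.nbhd_add[OF 2 1] by simp
  qed simp
qed

lemma kcoeff_mult_00: "kcoeff (s * t) 0 0 = kcoeff s 0 0 * kcoeff t 0 0"
  by (simp add: kcoeff_def)

lemma kalg_nbhd_1_iff: "t \<in> adic_nbhd kalg 1 \<longleftrightarrow> kcoeff t 0 0 = 0"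
proof
  interpret K: topalg kalg by (rule topalg_kalg)
  assume "t \<in> adic_nbhd kalg 1"
  then show "kcoeff t 0 0 = 0"
  proof (induction rule: K.nbhd_induct)
    case (gen i x)
    then show ?case
      using kcoeff_monom[of 1 i "1 - i" 0 0] by (simp add: kcoeff_mult_00 split: if_splits)
  qed simp_all
qed (rule kalg_nbhdI, simp)

text \<open>The approximation is the truncation to exponents \<open>i, j < n\<close>, a square that
  contains all monomials of total degree below \<open>n\<close>. A predicate \<open>Q\<close> with
  these closure properties holds for every polynomial.\<close>

lemma poly_dense:
  fixes t :: kk
  assumes "\<And>r. Q (kreal r)" "Q c1" "Q c2" "\<And>s t. Q s \<Longrightarrow> Q t \<Longrightarrow> Q (s + t)" "\<And>s t. Q s \<Longrightarrow> Q t \<Longrightarrow> Q (s * t)"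
  shows "\<exists>p. Q p \<and> t - p \<in> adic_nbhd kalg n"
proof -
  define p where "p = (\<Sum>i<n. \<Sum>j<n. kreal (kcoeff t i j) * (c1 ^ i * c2 ^ j))"
  have Q0: "Q 0" "Q 1" using assms(1)[of 0] assms(1)[of 1] by simp_all
  have Qp: "Q (x ^ i)" if "Q x" for x i
    using that by (induction i) (auto intro: assms Q0)
  have Qs: "Q (sum f S)" if "\<And>x. x \<in> S \<Longrightarrow> Q (f x)" for f :: "nat \<Rightarrow> kk" and S
    using that by (induction S rule: infinite_finite_induct) (auto intro: assms Q0)
  have "Q p" unfolding p_def by (intro Qs assms Qp)
  moreover have "kcoeff p i j = kcoeff t i j" if "i < n" "j < n" for i j
  proof -
    have "kcoeff p i j = (\<Sum>i'<n. \<Sum>j'<n. if i' = i then if j' = j then kcoeff t i j else 0 else 0)"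
      unfolding p_def kcoeff_sum kcoeff_monom by (intro sum.cong) auto
    also have "\<dots> = (\<Sum>i'<n. if i' = i then kcoeff t i j else 0)"
      using that by (intro sum.cong) auto
    finally show ?thesis using that by simp
  qed
  then have "t - p \<in> adic_nbhd kalg n" by (intro kalg_nbhdI) auto
  ultimately show ?thesis by blast
qed


subsection \<open>Convergent series\<close>

text \<open>Completeness is stated for series whose n-th term lies in the n-th neighbourhood: since
  neighbourhoods lift along surjections, this form passes to quotients.\<close>

locale calg = topalg A for A :: "(kk, 'a) module" (structure) +
  assumes separated: "x \<in> carrier A \<Longrightarrow> (\<And>n. x \<in> adic_nbhd A n) \<Longrightarrow> x = \<zero>"
    and series_convergent: "(\<And>n. d n \<in> adic_nbhd A n) \<Longrightarrow>
      \<exists>s\<in>carrier A. \<forall>n. s \<ominus> psum A d n \<in> adic_nbhd A n"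

text \<open>The rate of convergence is built in: the \<open>n\<close>-th partial sum is already
  correct modulo the \<open>n\<close>-th neighbourhood. This avoids choosing an index for each
  precision.\<close>

definition asum :: "(kk, 'a) module \<Rightarrow> (nat \<Rightarrow> 'a) \<Rightarrow> 'a" where
  "asum A d = (THE s. s \<in> carrier A \<and> (\<forall>n. s \<ominus>\<^bsub>A\<^esub> psum A d n \<in> adic_nbhd A n))"

context calg
begin

lemma eq_if_nbhd:
  assumes "x \<in> carrier A" "y \<in> carrier A" "\<And>n. x \<ominus> y \<in> adic_nbhd A n" shows "x = y"
  using separated[of "x \<ominus> y"] assms eq_diff_zero by simp

lemma asum_eqI:
  assumes "\<And>n. d n \<in> carrier A" "s \<in> carrier A" "\<And>n. s \<ominus> psum A d n \<in> adic_nbhd A n"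
  shows "asum A d = s"
  unfolding asum_def
proof (rule the_equality)
  fix s' assume s': "s' \<in> carrier A \<and> (\<forall>n. s' \<ominus> psum A d n \<in> adic_nbhd A n)"
  show "s' = s"
  proof (rule eq_if_nbhd)
    show "s' \<ominus> s \<in> adic_nbhd A n" for n
      by (rule nbhd_trans[of _ "psum A d n"]) (use s' assms nbhd_sym in auto)
  qed (use s' assms in auto)
qed (use assms in auto)

lemma
  assumes "\<And>n. d n \<in> adic_nbhd A n"
  shows asum_closed: "asum A d \<in> carrier A"
    and asum_approx: "asum A d \<ominus> psum A d n \<in> adic_nbhd A n"
proof -
  obtain s where s: "s \<in> carrier A" "\<And>n. s \<ominus> psum A d n \<in> adic_nbhd A n"
    using series_convergent[OF assms] by blast
  then have "asum A d = s" using nbhd_closed[OF assms] by (intro asum_eqI) auto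
  with s show "asum A d \<in> carrier A" "asum A d \<ominus> psum A d n \<in> adic_nbhd A n" by auto
qed

lemma asum_finite:
  assumes "\<And>n. d n \<in> adic_nbhd A n" "\<And>i. i \<ge> m \<Longrightarrow> d i = \<zero>"
  shows "asum A d = psum A d m"
proof (rule asum_eqI)
  note [simp] = nbhd_closed[OF assms(1)]
  show "psum A d m \<in> carrier A" "d n \<in> carrier A" for n by (auto intro: psum_closed)
  have 1: "psum A d (m + k) = psum A d m" for k
    using assms(2) by (induction k) auto
  show "psum A d m \<ominus> psum A d n \<in> adic_nbhd A n" for n
  proof (cases "n \<ge> m")
    case True
    then show ?thesis using 1[of "n - m"] assms by (simp add: eq_diff_zero[THEN iffD2])
  next
    case False
    have "psum A d (n + k) \<ominus> psum A d n \<in> adic_nbhd A n" for k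
    proof (induction k)
      case 0
      show ?case using assms by (simp add: eq_diff_zero[THEN iffD2])
    next
      case (Suc k)
      have "d (n + k) \<in> adic_nbhd A n"
        using assms(1) by (rule nbhd_antimono) simp
      moreover have "psum A d (n + Suc k) \<ominus> psum A d n = (psum A d (n + k) \<ominus> psum A d n) \<oplus> d (n + k)"
        using assms(1) by (simp add: minus_eq a_ac)
      ultimately show ?case using Suc nbhd_add by simp
    qed
    from this[of "m - n"] False show ?thesis by simp
  qed
qed

lemma asum_add:
  assumes "\<And>n. d n \<in> adic_nbhd A n" "\<And>n. e n \<in> adic_nbhd A n"
  shows "asum A (\<lambda>n. d n \<oplus> e n) = asum A d \<oplus> asum A e"
proof (rule asum_eqI)
  note [simp] = nbhd_closed[OF assms(1)] nbhd_closed[OF assms(2)]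
    asum_closed[OF assms(1)] asum_closed[OF assms(2)]
  show "asum A d \<oplus> asum A e \<ominus> psum A (\<lambda>n. d n \<oplus> e n) n \<in> adic_nbhd A n" for n
    using nbhd_add[OF asum_approx[OF assms(1)] asum_approx[OF assms(2)], of n]
    by (simp add: psum_add add_diff_add psum_closed)
qed (simp_all add: nbhd_closed[OF assms(1)] nbhd_closed[OF assms(2)]
    asum_closed[OF assms(1)] asum_closed[OF assms(2)])

lemma asum_shift:
  assumes "\<And>n. d n \<in> adic_nbhd A n"
  shows "asum A d = d 0 \<oplus> asum A (\<lambda>n. d (Suc n))"
proof (rule asum_eqI)
  have 1: "d (Suc n) \<in> adic_nbhd A n" for n
    using assms by (rule nbhd_antimono) simp
  show cl: "d 0 \<oplus> asum A (\<lambda>n. d (Suc n)) \<in> carrier A"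
    using nbhd_closed[OF assms] asum_closed[OF 1] by simp
  let ?s = "asum A (\<lambda>n. d (Suc n))"
  have s: "?s \<in> carrier A" using 1 by (rule asum_closed)
  have c: "d n \<in> carrier A" for n by (rule nbhd_closed[OF assms])
  have "d 0 \<oplus> ?s \<ominus> psum A d (Suc n) = ?s \<ominus> psum A (\<lambda>n. d (Suc n)) n" for n
    using c s by (simp add: psum_shift add_diff_add eq_diff_zero[THEN iffD2] del: psum.simps)
  then have 2: "d 0 \<oplus> ?s \<ominus> psum A d (Suc n) \<in> adic_nbhd A n" for n
    using asum_approx[OF 1] by simp
  \<comment> \<open>The estimate so far is for the partial sum of length \<open>Suc n\<close>, one
    term longer; that term \<open>d n\<close> lies itself in the \<open>n\<close>-th
    neighbourhood.\<close>
  have "d 0 \<oplus> ?s \<ominus> psum A d n \<in> adic_nbhd A n" for n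
  proof (rule nbhd_trans[OF _ _ _ 2])
    have "psum A d (Suc n) \<ominus> psum A d n = d n"
      using c by (simp add: minus_eq a_ac r_neg)
    then show "psum A d (Suc n) \<ominus> psum A d n \<in> adic_nbhd A n" using assms by simp
  qed (use cl c in auto)
  then show "d 0 \<oplus> ?s \<ominus> psum A d n \<in> adic_nbhd A n" for n .
  show "d n \<in> carrier A" for n by (rule c)
qed

text \<open>Cauchy product. The partial sum runs over the triangle \<open>k + m < n\<close>;
  completing row \<open>k\<close> to \<open>d k\<close> times the full sum of \<open>e\<close> costs
  \<open>d k\<close> times an element of the \<open>(n - k)\<close>-th neighbourhood, which is in
  the \<open>n\<close>-th.\<close>

lemma asum_mult:
  assumes d: "\<And>n. d n \<in> adic_nbhd A n" and e: "\<And>n. e n \<in> adic_nbhd A n"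
  shows "asum A d \<otimes> asum A e = asum A (\<lambda>n. psum A (\<lambda>k. d k \<otimes> e (n - k)) (Suc n))"
proof (rule asum_eqI[symmetric])
  have c [simp]: "d n \<in> carrier A" "e n \<in> carrier A" for n
    by (rule nbhd_closed[OF d] nbhd_closed[OF e])+
  have s [simp]: "asum A d \<in> carrier A" "asum A e \<in> carrier A"
    using d e by (auto intro: asum_closed)
  show "psum A (\<lambda>k. d k \<otimes> e (n - k)) (Suc n) \<in> carrier A" for n
    by (intro psum_closed) auto
  show "asum A d \<otimes> asum A e \<in> carrier A" by simp
  fix n
  let ?C = "psum A (\<lambda>n. psum A (\<lambda>k. d k \<otimes> e (n - k)) (Suc n)) n"
  have C: "?C = psum A (\<lambda>k. psum A (\<lambda>m. d k \<otimes> e m) (n - k)) n"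
    by (rule psum_triangle) simp
  show "asum A d \<otimes> asum A e \<ominus> ?C \<in> adic_nbhd A n"
  proof (rule nbhd_trans)
    show "asum A d \<otimes> asum A e \<ominus> psum A d n \<otimes> asum A e \<in> adic_nbhd A n"
      using nbhd_mult_r[OF asum_approx[of d n, OF d], of "asum A e"] by (simp add: diff_mult_l)
    have "psum A (\<lambda>k. d k \<otimes> asum A e) m \<ominus> psum A (\<lambda>k. psum A (\<lambda>m. d k \<otimes> e m) (n - k)) m \<in> adic_nbhd A n"
      if "m \<le> n" for m
      using that
    proof (induction m)
      case 0
      then show ?case by (simp add: minus_eq)
    next
      case (Suc m)
      have "d m \<otimes> (asum A e \<ominus> psum A e (n - m)) \<in> adic_nbhd A (m + (n - m))"
        by (rule nbhd_mult[OF d asum_approx[OF e]])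
      then have "d m \<otimes> asum A e \<ominus> psum A (\<lambda>j. d m \<otimes> e j) (n - m) \<in> adic_nbhd A n"
        using Suc.prems by (simp add: diff_mult_r psum_mult_l)
      with Suc show ?case
        by (simp add: add_diff_add nbhd_add)
    qed
    from this[of n] show "psum A d n \<otimes> asum A e \<ominus> ?C \<in> adic_nbhd A n"
      unfolding C by (simp add: psum_mult_r)
  qed (auto intro!: psum_closed)
qed

text \<open>Translation into \<open>adic_limit\<close>, the notion in which the exponential is
  defined.\<close>

lemma adic_limit_asum:
  assumes d: "\<And>n. d n \<in> adic_nbhd A n"
  shows "adic_limit A (\<lambda>m. \<Oplus>i\<in>{..<m}. d i) s \<longleftrightarrow> s = asum A d"
proof -
  have eq: "(\<Oplus>i\<in>{..<m}. d i) = psum A d m" for m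
    by (intro finsum_lessThan_psum nbhd_closed[OF d])
  have c [simp]: "d n \<in> carrier A" for n by (rule nbhd_closed[OF d])
  have s [simp]: "asum A d \<in> carrier A" using d by (rule asum_closed)
  have 1: "asum A d \<ominus> psum A d m \<in> adic_nbhd A n" if "n \<le> m" for n m
    using asum_approx[OF d] that by (rule nbhd_antimono)
  show ?thesis
  proof
    assume "adic_limit A (\<lambda>m. \<Oplus>i\<in>{..<m}. d i) s"
    then have s': "s \<in> carrier A" and 2: "\<forall>n. \<exists>N. \<forall>m\<ge>N. psum A d m \<ominus> s \<in> adic_nbhd A n"
      by (auto simp: adic_limit_def eq)
    show "s = asum A d"
    proof (rule eq_if_nbhd[OF s' s])
      fix n
      obtain N where "\<forall>m\<ge>N. psum A d m \<ominus> s \<in> adic_nbhd A n" using 2 by blast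
      then have "psum A d (max N n) \<ominus> s \<in> adic_nbhd A n" by simp
      moreover have "asum A d \<ominus> psum A d (max N n) \<in> adic_nbhd A n" by (rule 1) simp
      ultimately show "s \<ominus> asum A d \<in> adic_nbhd A n"
        using s' by (intro nbhd_sym[OF s] nbhd_trans[of "asum A d" "psum A d (max N n)" s]) auto
    qed
  next
    assume "s = asum A d"
    then show "adic_limit A (\<lambda>m. \<Oplus>i\<in>{..<m}. d i) s"
      unfolding adic_limit_def eq using 1 by (auto intro!: nbhd_sym[of "asum A d"] exI[of _ n for n])
  qed
qed

lemma adic_complete: "adic_complete A"
  unfolding adic_complete_def
proof (intro conjI allI impI)
  show "(\<Inter>n. adic_nbhd A n) = {\<zero>}"
    using separated nbhd_closed[of _ 0] by (auto simp del: nbhd_0)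
  fix f :: "nat \<Rightarrow> _"
  assume f: "(\<forall>m. f m \<in> carrier A) \<and> (\<forall>n. \<exists>N. \<forall>m\<ge>N. \<forall>l\<ge>N. f m \<ominus> f l \<in> adic_nbhd A n)"
  then have c [simp]: "f m \<in> carrier A" for m by blast
  obtain N where N: "f m \<ominus> f l \<in> adic_nbhd A n" if "m \<ge> N n" "l \<ge> N n" for m l n
    using f by metis
  \<comment> \<open>A monotone modulus of convergence: beyond index \<open>K n\<close> the sequence
    is constant modulo the \<open>n\<close>-th neighbourhood.\<close>
  define K where "K = rec_nat (N 0) (\<lambda>n k. max k (N (Suc n)))"
  have KS: "K 0 = N 0" "K (Suc n) = max (K n) (N (Suc n))" for n by (simp_all add: K_def)
  have K: "K n \<le> K (Suc n)" for n by (simp add: KS)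
  have K': "N n \<le> K n" for n by (cases n) (simp_all add: KS)
  \<comment> \<open>Telescoping along the subsequence \<open>K\<close>. It starts at
    \<open>K 1\<close>, not \<open>K 0\<close>, so that both indices in \<open>d (Suc n)\<close>
    exceed \<open>N (Suc n)\<close> and the difference has order \<open>Suc n\<close>.\<close>
  define d where "d = case_nat (f (K 1)) (\<lambda>n. f (K (Suc (Suc n))) \<ominus> f (K (Suc n)))"
  have d: "d n \<in> adic_nbhd A n" for n
    by (cases n) (auto simp: d_def intro!: N K' order_trans[OF K' K])
  have ps: "psum A d (Suc n) = f (K (Suc n))" for n
    proof (induction n)
    case (Suc n)
    have "psum A d (Suc (Suc n)) = f (K (Suc n)) \<oplus> (f (K (Suc (Suc n))) \<ominus> f (K (Suc n)))"
      using Suc by (simp add: d_def)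
    also have "\<dots> = f (K (Suc (Suc n)))"
      using diff_add_cancel[of "f (K (Suc (Suc n)))" "f (K (Suc n))"] by (simp add: a_comm)
    finally show ?case .
  qed (simp add: d_def)
  have "adic_limit A f (asum A d)"
    unfolding adic_limit_def
  proof (intro conjI allI exI impI)
    show "asum A d \<in> carrier A" using d by (rule asum_closed)
    fix n m assume m: "m \<ge> K n"
    show "f m \<ominus> asum A d \<in> adic_nbhd A n"
    proof (rule nbhd_trans)
      show "f m \<ominus> f (K (Suc n)) \<in> adic_nbhd A n"
        using m K[of n] K'[of n] by (intro N) auto
      have "asum A d \<ominus> psum A d (Suc n) \<in> adic_nbhd A n"
        using asum_approx[OF d, of "Suc n"] by (rule nbhd_antimono) simp
      then show "f (K (Suc n)) \<ominus> asum A d \<in> adic_nbhd A n"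
        unfolding ps using asum_closed[OF d] by (intro nbhd_sym[of "asum A d"]) auto
    qed (use asum_closed[OF d] in auto)
  qed
  then show "\<exists>s. adic_limit A f s" by blast
qed

end

text \<open>Linear maps preserve the neighbourhoods, so they commute with convergent series without
  a continuity hypothesis.\<close>

lemma lin_asum:
  assumes "calg A" "calg B" "lin A B f" "\<And>n. d n \<in> adic_nbhd A n"
  shows "f (asum A d) = asum B (\<lambda>n. f (d n))"
proof -
  interpret A: calg A by fact
  interpret B: calg B by fact
  have c: "d n \<in> carrier A" for n using A.nbhd_closed[OF assms(4)] .
  note l = A.assoc_alg_axioms B.assoc_alg_axioms assms(3)
  show ?thesis
  proof (rule B.asum_eqI[symmetric])
    show "f (d n) \<in> carrier B" for n using c by (rule lin_closed[OF assms(3)])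
    show "f (asum A d) \<in> carrier B" using A.asum_closed[OF assms(4)] by (rule lin_closed[OF assms(3)])
    show "f (asum A d) \<ominus>\<^bsub>B\<^esub> psum B (\<lambda>n. f (d n)) n \<in> adic_nbhd B n" for n
      using lin_nbhd[OF A.topalg_axioms B.topalg_axioms assms(3) A.asum_approx[OF assms(4), of n]]
        c A.asum_closed[OF assms(4)]
      by (simp add: lin_diff[OF l] lin_psum[OF l])
  qed
qed

lemma (in calg) asum_smult:
  "(\<And>n. d n \<in> adic_nbhd A n) \<Longrightarrow> asum A (\<lambda>n. t \<odot> d n) = t \<odot> asum A d"
  by (rule lin_asum[symmetric, OF calg_axioms calg_axioms])
    (auto intro!: linI simp: smult_r_distr smult_comm[of _ t])

text \<open>The polynomials in \<open>c1\<close> and \<open>c2\<close> are dense in the base ring, so that linearity only has to be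
  checked for real scalars and for \<open>c1\<close> and \<open>c2\<close>.\<close>

lemma klinearI:
  assumes A: "topalg A" and B: "calg B"
    and cl: "\<And>x. x \<in> carrier A \<Longrightarrow> f x \<in> carrier B"
    and add: "\<And>x y. x \<in> carrier A \<Longrightarrow> y \<in> carrier A \<Longrightarrow> f (x \<oplus>\<^bsub>A\<^esub> y) = f x \<oplus>\<^bsub>B\<^esub> f y"
    and r: "\<And>r x. x \<in> carrier A \<Longrightarrow> f (kreal r \<odot>\<^bsub>A\<^esub> x) = kreal r \<odot>\<^bsub>B\<^esub> f x"
    and c1: "\<And>x. x \<in> carrier A \<Longrightarrow> f (c1 \<odot>\<^bsub>A\<^esub> x) = c1 \<odot>\<^bsub>B\<^esub> f x"
    and c2: "\<And>x. x \<in> carrier A \<Longrightarrow> f (c2 \<odot>\<^bsub>A\<^esub> x) = c2 \<odot>\<^bsub>B\<^esub> f x"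
  shows "lin A B f"
proof (rule linI[OF cl add])
  interpret A: topalg A by fact
  interpret B: calg B by fact
  define Q where "Q t \<longleftrightarrow> (\<forall>x\<in>carrier A. f (t \<odot>\<^bsub>A\<^esub> x) = t \<odot>\<^bsub>B\<^esub> f x)" for t
  have Qr: "Q (kreal r)" for r using r by (auto simp: Q_def)
  have Qc: "Q c1" "Q c2" using c1 c2 by (auto simp: Q_def)
  have Qa: "Q (s + t)" if "Q s" "Q t" for s t
    using that by (simp add: Q_def A.smult_l_distr B.smult_l_distr cl add)
  have Qm: "Q (s * t)" if "Q s" "Q t" for s t
    using that by (simp add: Q_def A.smult_assoc B.smult_assoc cl)
  have Q1: "Q 1" using Qr[of 1] by simp
  have Qp: "Q (x ^ i)" if "Q x" for x i
    using that by (induction i) (auto intro: Qm Q1)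
  have z: "f \<zero>\<^bsub>A\<^esub> = \<zero>\<^bsub>B\<^esub>"
    using r[of "\<zero>\<^bsub>A\<^esub>" 0] by (simp add: cl)
  \<comment> \<open>Continuity is available before full linearity, because the monomials
    \<open>c1^i c2^(n-i)\<close> already satisfy \<open>Q\<close>; this avoids a circular
    argument.\<close>
  have nb: "f x \<in> adic_nbhd B n" if "x \<in> adic_nbhd A n" for x n
    using that
  proof (induction rule: A.nbhd_induct)
    case (gen i x)
    have "Q (c1 ^ i * c2 ^ (n - i))" by (intro Qm Qp Qc)
    then show ?case using gen by (simp add: Q_def B.nbhd_gen cl)
  qed (auto simp: z add B.nbhd_add)
  fix t x assume x: "x \<in> carrier A"
  show "f (t \<odot>\<^bsub>A\<^esub> x) = t \<odot>\<^bsub>B\<^esub> f x"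
  proof (rule B.eq_if_nbhd)
    fix n
    obtain p where p: "Q p" "t - p \<in> adic_nbhd kalg n"
      using poly_dense[of Q t n] Qr Qc Qa Qm by blast
    have *: "t = (t - p) + p" by simp
    have 1: "f ((t - p) \<odot>\<^bsub>A\<^esub> x) \<in> adic_nbhd B n"
      using A.nbhd_scalar[OF p(2), of x 0] x by (intro nb) simp
    have 2: "(t - p) \<odot>\<^bsub>B\<^esub> f x \<in> adic_nbhd B n"
      using B.nbhd_scalar[OF p(2), of "f x" 0] x cl by simp
    have "f (t \<odot>\<^bsub>A\<^esub> x) \<ominus>\<^bsub>B\<^esub> t \<odot>\<^bsub>B\<^esub> f x = f ((t - p) \<odot>\<^bsub>A\<^esub> x) \<ominus>\<^bsub>B\<^esub> (t - p) \<odot>\<^bsub>B\<^esub> f x"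
      apply (subst *, subst A.smult_l_distr[OF x], subst (2) *, subst B.smult_l_distr)
      using p(1) x by (auto simp: Q_def add cl B.add_diff_add B.eq_diff_zero[THEN iffD2] B.minus_closed)
    then show "f (t \<odot>\<^bsub>A\<^esub> x) \<ominus>\<^bsub>B\<^esub> t \<odot>\<^bsub>B\<^esub> f x \<in> adic_nbhd B n"
      using B.nbhd_diff[OF 1 2] by simp
  qed (use x cl in auto)
qed


subsection \<open>Closed ideals\<close>

lemma (in ring) genideal_mono_ideal: "ideal J R \<Longrightarrow> S \<subseteq> J \<Longrightarrow> Idl S \<subseteq> J"
  by (auto simp: genideal_def)

context topalg
begin

lemma adic_closure_superset: "T \<subseteq> carrier A \<Longrightarrow> T \<subseteq> adic_closure A T"
  by (auto simp: adic_closure_def eq_diff_zero[THEN iffD2] intro!: bexI)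

lemma ideal_adic_closure:
  assumes "ideal I A" shows "ideal (adic_closure A I) A"
proof -
  interpret I: ideal I A by fact
  have sub: "y \<in> carrier A" if "y \<in> I" for y using that by simp
  show ?thesis
  proof (rule idealI[OF ring_axioms add.subgroupI])
    show "adic_closure A I \<subseteq> carrier A" by (auto simp: adic_closure_def)
    show "adic_closure A I \<noteq> {}" using adic_closure_superset[of I] I.zero_closed I.a_subset by blast
  next
    fix x assume "x \<in> adic_closure A I"
    then have x: "x \<in> carrier A" "\<And>n. \<exists>y\<in>I. x \<ominus> y \<in> adic_nbhd A n" by (auto simp: adic_closure_def)
    show "\<ominus> x \<in> adic_closure A I"
      unfolding adic_closure_def
    proof (intro CollectI conjI allI)
      fix n obtain y where y: "y \<in> I" "x \<ominus> y \<in> adic_nbhd A n" using x by blast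
      have "\<ominus> x \<ominus> (\<ominus> y) = \<ominus> (x \<ominus> y)" using x y by (simp add: minus_eq minus_add)
      then show "\<exists>y\<in>I. \<ominus> x \<ominus> y \<in> adic_nbhd A n"
        using y nbhd_minus I.a_inv_closed by (intro bexI[of _ "\<ominus> y"]) auto
    qed (use x in simp)
    fix z assume z: "z \<in> carrier A"
    show "z \<otimes> x \<in> adic_closure A I"
      unfolding adic_closure_def
    proof (intro CollectI conjI allI)
      fix n obtain y where y: "y \<in> I" "x \<ominus> y \<in> adic_nbhd A n" using x by blast
      then show "\<exists>y\<in>I. z \<otimes> x \<ominus> y \<in> adic_nbhd A n"
        using nbhd_mult_l[of "x \<ominus> y" n z] x z I.I_l_closed
        by (intro bexI[of _ "z \<otimes> y"]) (auto simp: diff_mult_r)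
    qed (use x z in simp)
    show "x \<otimes> z \<in> adic_closure A I"
      unfolding adic_closure_def
    proof (intro CollectI conjI allI)
      fix n obtain y where y: "y \<in> I" "x \<ominus> y \<in> adic_nbhd A n" using x by blast
      then show "\<exists>y\<in>I. x \<otimes> z \<ominus> y \<in> adic_nbhd A n"
        using nbhd_mult_r[of "x \<ominus> y" n z] x z I.I_r_closed
        by (intro bexI[of _ "y \<otimes> z"]) (auto simp: diff_mult_l)
    qed (use x z in simp)
  next
    fix x x' assume "x \<in> adic_closure A I" "x' \<in> adic_closure A I"
    then have x: "x \<in> carrier A" "\<And>n. \<exists>y\<in>I. x \<ominus> y \<in> adic_nbhd A n"
      and x': "x' \<in> carrier A" "\<And>n. \<exists>y\<in>I. x' \<ominus> y \<in> adic_nbhd A n" by (auto simp: adic_closure_def)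
    show "x \<oplus> x' \<in> adic_closure A I"
      unfolding adic_closure_def
    proof (intro CollectI conjI allI)
      fix n
      obtain y y' where "y \<in> I" "x \<ominus> y \<in> adic_nbhd A n" "y' \<in> I" "x' \<ominus> y' \<in> adic_nbhd A n"
        using x x' by blast
      then show "\<exists>y\<in>I. x \<oplus> x' \<ominus> y \<in> adic_nbhd A n"
        using x x' nbhd_add by (intro bexI[of _ "y \<oplus> y'"]) (auto simp: add_diff_add)
    qed (use x x' in simp)
  qed
qed

lemma adic_closure_idem:
  assumes "T \<subseteq> carrier A" shows "adic_closure A (adic_closure A T) \<subseteq> adic_closure A T"
proof
  fix x assume "x \<in> adic_closure A (adic_closure A T)"
  then have x: "x \<in> carrier A" "\<And>n. \<exists>y\<in>adic_closure A T. x \<ominus> y \<in> adic_nbhd A n"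
    by (auto simp: adic_closure_def[of A "adic_closure A T"])
  show "x \<in> adic_closure A T"
    unfolding adic_closure_def
  proof (intro CollectI conjI allI x(1))
    fix n
    obtain y where y: "y \<in> adic_closure A T" "x \<ominus> y \<in> adic_nbhd A n" using x by blast
    then obtain z where z: "z \<in> T" "y \<ominus> z \<in> adic_nbhd A n" by (auto simp: adic_closure_def)
    then show "\<exists>z\<in>T. x \<ominus> z \<in> adic_nbhd A n"
      using x(1) y assms by (intro bexI[of _ z] nbhd_trans[of x y z]) (auto simp: adic_closure_def)
  qed
qed

lemma
  assumes "R \<subseteq> carrier A"
  shows ideal_closed_ideal: "ideal (closed_ideal A R) A"
    and closed_ideal_closed: "adic_closure A (closed_ideal A R) \<subseteq> closed_ideal A R"
    and closed_ideal_superset: "R \<subseteq> closed_ideal A R"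
proof -
  interpret I: ideal "Idl R" A using assms by (rule genideal_ideal)
  show "ideal (closed_ideal A R) A"
    unfolding closed_ideal_def by (rule ideal_adic_closure[OF I.ideal_axioms])
  show "adic_closure A (closed_ideal A R) \<subseteq> closed_ideal A R"
    unfolding closed_ideal_def by (rule adic_closure_idem[OF I.a_subset])
  show "R \<subseteq> closed_ideal A R"
    unfolding closed_ideal_def
    using adic_closure_superset[OF I.a_subset] genideal_self[OF assms] by blast
qed

text \<open>Separatedness of the quotient is closedness of \<open>I\<close>: if the coset of
  \<open>x\<close> lies in every neighbourhood, then \<open>x\<close> can be approximated by
  \<open>I\<close> to every order. For completeness the terms of a series are lifted one by one,
  keeping their order, and summed upstairs.\<close>

lemma calg_closed_quot:
  assumes A: "calg A" and I: "ideal I A" and c: "adic_closure A I \<subseteq> I"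
  shows "calg (quot_alg A I)"
proof -
  interpret A: calg A by fact
  interpret I: ideal I A by fact
  let ?Q = "quot_alg A I" and ?p = "\<lambda>x. I +> x"
  interpret Q: topalg ?Q by (simp add: topalg_def assoc_alg_quot[OF I])
  have p: "lin A ?Q ?p" using alg_hom_rcos[OF I] by (rule alg_hom_lin)
  have s: "?p ` carrier A = carrier ?Q" by (simp add: quot_alg_simps(1)[OF I])
  note nb = lin_nbhd_surj[OF topalg_axioms Q.topalg_axioms p s]
  note l = assoc_alg_axioms Q.assoc_alg_axioms p
  show ?thesis
  proof (rule calg.intro[OF Q.topalg_axioms], rule calg_axioms.intro)
    fix y assume y: "y \<in> carrier ?Q" "\<And>n. y \<in> adic_nbhd ?Q n"
    then have "y \<in> ?p ` carrier A" using s by simp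
    then obtain x where x: "x \<in> carrier A" "y = ?p x" by auto
    have "x \<in> adic_closure A I"
      unfolding adic_closure_def
    proof (intro CollectI conjI allI x(1))
      fix n
      obtain x' where x': "x' \<in> adic_nbhd A n" "?p x' = y" using nb[OF y(2)[of n]] by blast
      then have "?p (x \<ominus> x') = \<zero>\<^bsub>?Q\<^esub>"
        using x y(1) by (simp add: lin_diff[OF l] Q.eq_diff_zero)
      then have "x \<ominus> x' \<in> I" using x x' by (simp add: rcos_eq_zero_iff[OF I])
      moreover have "x \<ominus> (x \<ominus> x') = x'" using x x' by (simp add: minus_eq minus_add r_neg2)
      ultimately show "\<exists>z\<in>I. x \<ominus> z \<in> adic_nbhd A n"
        using x'(1) by (intro bexI[of _ "x \<ominus> x'"]) auto
    qed
    then show "y = \<zero>\<^bsub>?Q\<^esub>" using c x by (auto simp: rcos_eq_zero_iff[OF I])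
  next
    fix d assume d: "\<And>n. d n \<in> adic_nbhd ?Q n"
    have "\<forall>n. \<exists>x\<in>adic_nbhd A n. ?p x = d n" using nb[OF d] by blast
    then obtain e where e: "\<And>n. e n \<in> adic_nbhd A n" "\<And>n. ?p (e n) = d n" by metis
    show "\<exists>s\<in>carrier ?Q. \<forall>n. s \<ominus>\<^bsub>?Q\<^esub> psum ?Q d n \<in> adic_nbhd ?Q n"
    proof (intro bexI allI)
      show "?p (asum A e) \<in> carrier ?Q" using A.asum_closed[OF e(1)] by (rule lin_closed[OF p])
      fix n
      have "?p (asum A e \<ominus> psum A e n) \<in> adic_nbhd ?Q n"
        by (rule lin_nbhd[OF topalg_axioms Q.topalg_axioms p A.asum_approx[OF e(1)]])
      then show "?p (asum A e) \<ominus>\<^bsub>?Q\<^esub> psum ?Q d n \<in> adic_nbhd ?Q n"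
        using nbhd_closed[OF e(1)] e(2) A.asum_closed[OF e(1)]
        by (simp add: lin_diff[OF l] lin_psum[OF l] psum_closed)
    qed
  qed
qed

end

lemma lin_vanishes_on_closure:
  assumes A: "topalg A" and B: "calg B" and f: "lin A B f"
    and T: "T \<subseteq> carrier A" "\<And>x. x \<in> T \<Longrightarrow> f x = \<zero>\<^bsub>B\<^esub>" and x: "x \<in> adic_closure A T"
  shows "f x = \<zero>\<^bsub>B\<^esub>"
proof -
  interpret A: topalg A by fact
  interpret B: calg B by fact
  have xA: "x \<in> carrier A" using x by (simp add: adic_closure_def)
  show ?thesis
  proof (rule B.separated)
    show fx: "f x \<in> carrier B" using xA by (rule lin_closed[OF f])
    fix n
    obtain y where y: "y \<in> T" "x \<ominus>\<^bsub>A\<^esub> y \<in> adic_nbhd A n" using x by (auto simp: adic_closure_def)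
    have "f (x \<ominus>\<^bsub>A\<^esub> y) \<in> adic_nbhd B n"
      by (rule lin_nbhd[OF A B.topalg_axioms f y(2)])
    then show "f x \<in> adic_nbhd B n"
      using y T xA fx
      by (auto simp: lin_diff[OF A.assoc_alg_axioms B.assoc_alg_axioms f] B.minus_eq subset_iff)
  qed
qed

text \<open>The kernel is an ideal containing \<open>R\<close>; separatedness of \<open>B\<close>
  extends the vanishing from the generated ideal to its closure.\<close>

lemma alg_hom_vanishes_on_closed_ideal:
  assumes A: "topalg A" and B: "calg B" and f: "alg_hom A B f"
    and R: "R \<subseteq> carrier A" "\<And>x. x \<in> R \<Longrightarrow> f x = \<zero>\<^bsub>B\<^esub>" and x: "x \<in> closed_ideal A R"
  shows "f x = \<zero>\<^bsub>B\<^esub>"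
proof -
  interpret A: topalg A by fact
  interpret B: calg B by fact
  have "Idl\<^bsub>A\<^esub> R \<subseteq> {x \<in> carrier A. f x = \<zero>\<^bsub>B\<^esub>}"
    using R by (intro A.genideal_mono_ideal kernel_ideal f A.assoc_alg_axioms B.assoc_alg_axioms) auto
  then have "Idl\<^bsub>A\<^esub> R \<subseteq> carrier A" "\<And>y. y \<in> Idl\<^bsub>A\<^esub> R \<Longrightarrow> f y = \<zero>\<^bsub>B\<^esub>" by fast+
  then show ?thesis
    using lin_vanishes_on_closure[OF A B alg_hom_lin[OF f]] x unfolding closed_ideal_def by metis
qed

lemma lin_eq_on_series:
  assumes A: "calg A" and B: "calg B" and f: "lin A B f" and g: "lin A B g"
    and d: "\<And>n. d n \<in> adic_nbhd A n" and eq: "\<And>n. f (d n) = g (d n)"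
  shows "f (asum A d) = g (asum A d)"
  using lin_asum[OF A B f d] lin_asum[OF A B g d] eq by simp


section \<open>Power series with coefficients in an algebra\<close>

context abelian_group
begin

text \<open>Both sides sum \<open>T\<close> over all index triples with total \<open>n\<close>. This
  is the combinatorial core of associativity of convolutions, for products and scalars
  alike.\<close>

lemma psum_conv_assoc:
  assumes "\<And>i j k. T i j k \<in> carrier G"
  shows "psum G (\<lambda>k. psum G (\<lambda>l. T l (k - l) (n - k)) (Suc k)) (Suc n) =
    psum G (\<lambda>l. psum G (\<lambda>m. T l m (n - l - m)) (Suc (n - l))) (Suc n)"
proof -
  have "psum G (\<lambda>k. psum G (\<lambda>l. T l (k - l) (n - k)) (Suc k)) (Suc n) =
      psum G (\<lambda>k. psum G (\<lambda>l. T l (k - l) (n - l - (k - l))) (Suc k)) (Suc n)"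
    by (intro psum_cong) simp
  also have "\<dots> = psum G (\<lambda>l. psum G (\<lambda>m. T l m (n - l - m)) (Suc n - l)) (Suc n)"
    by (rule psum_triangle) (rule assms)
  also have "\<dots> = psum G (\<lambda>l. psum G (\<lambda>m. T l m (n - l - m)) (Suc (n - l))) (Suc n)"
    by (rule psum_cong) (simp add: Suc_diff_le)
  finally show ?thesis .
qed

text \<open>The triangle \<open>k + l \<le> n\<close> is symmetric: both sides are rewritten by
  diagonals, and reversing a diagonal exchanges the indices. It is needed where a scalar series
  passes over a left factor.\<close>

lemma psum_triangle_swap:
  assumes "\<And>i j. a i j \<in> carrier G"
  shows "psum G (\<lambda>k. psum G (\<lambda>l. a k l) (Suc (n - k))) (Suc n) =
    psum G (\<lambda>l. psum G (\<lambda>k. a k l) (Suc (n - l))) (Suc n)"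
proof -
  have 1: "psum G (\<lambda>k. psum G (\<lambda>l. b k l) (Suc (n - k))) (Suc n) =
      psum G (\<lambda>k. psum G (\<lambda>l. b l (k - l)) (Suc k)) (Suc n)" if "\<And>i j. b i j \<in> carrier G" for b
    using psum_triangle[of b "Suc n"] psum_cong[of "Suc n" "\<lambda>l. psum G (b l) (Suc n - l)"
        "\<lambda>l. psum G (b l) (Suc (n - l))" G] that by (simp add: Suc_diff_le)
  have 2: "psum G (\<lambda>l. a l (k - l)) (Suc k) = psum G (\<lambda>l. a (k - l) l) (Suc k)" for k
    using psum_rev[of k "\<lambda>l. a (k - l) l"] psum_cong[of "Suc k" "\<lambda>l. a (k - (k - l)) (k - l)" "\<lambda>l. a l (k - l)" G]
      assms by (simp del: psum.simps)
  show ?thesis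
    using 1[of a] 1[of "\<lambda>l k. a k l"] assms 2 by (simp del: psum.simps)
qed

end

text \<open>Up to exchanging the two indices, \<^const>\<open>pser\<close> is the twofold iteration of this construction.\<close>

definition ser1 :: "('k::comm_ring_1, 'a) module \<Rightarrow> ('k fps, nat \<Rightarrow> 'a) module" where
  "ser1 R = \<lparr>carrier = {f. \<forall>i. f i \<in> carrier R},
     monoid.mult = (\<lambda>f g i. psum R (\<lambda>k. f k \<otimes>\<^bsub>R\<^esub> g (i - k)) (Suc i)),
     one = (\<lambda>i. if i = 0 then \<one>\<^bsub>R\<^esub> else \<zero>\<^bsub>R\<^esub>),
     zero = (\<lambda>i. \<zero>\<^bsub>R\<^esub>),
     add = (\<lambda>f g i. f i \<oplus>\<^bsub>R\<^esub> g i),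
     smult = (\<lambda>t f i. psum R (\<lambda>k. fps_nth t k \<odot>\<^bsub>R\<^esub> f (i - k)) (Suc i))\<rparr>"

lemma (in assoc_alg) assoc_alg_ser1: "assoc_alg (ser1 A)"
proof -
  note [simp del] = psum.simps
  note [simp] = psum_closed
  let ?S = "ser1 A"
  have cl: "f \<in> carrier ?S \<longleftrightarrow> (\<forall>i. f i \<in> carrier A)" for f by (simp add: ser1_def)
  have add: "(f \<oplus>\<^bsub>?S\<^esub> g) i = f i \<oplus> g i" for f g i by (simp add: ser1_def)
  have mult: "(f \<otimes>\<^bsub>?S\<^esub> g) i = psum A (\<lambda>k. f k \<otimes> g (i - k)) (Suc i)" for f g i by (simp add: ser1_def)
  have smult: "(t \<odot>\<^bsub>?S\<^esub> g) i = psum A (\<lambda>k. fps_nth t k \<odot> g (i - k)) (Suc i)" for t g i by (simp add: ser1_def)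
  have one: "\<one>\<^bsub>?S\<^esub> i = (if i = 0 then \<one> else \<zero>)" for i by (simp add: ser1_def)
  have zero: "\<zero>\<^bsub>?S\<^esub> i = \<zero>" for i by (simp add: ser1_def)
  have "abelian_group ?S"
  proof (rule abelian_groupI)
    fix f assume "f \<in> carrier ?S"
    then show "\<exists>g\<in>carrier ?S. g \<oplus>\<^bsub>?S\<^esub> f = \<zero>\<^bsub>?S\<^esub>"
      by (intro bexI[of _ "\<lambda>i. \<ominus> f i"]) (auto simp: cl add zero l_neg fun_eq_iff)
  qed (auto simp: cl add zero a_ac fun_eq_iff)
  moreover have "Group.monoid ?S"
  proof (rule monoidI)
    fix f g h assume fgh: "f \<in> carrier ?S" "g \<in> carrier ?S" "h \<in> carrier ?S"
    then have [simp]: "f i \<in> carrier A" "g i \<in> carrier A" "h i \<in> carrier A" for i by (auto simp: cl)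
    show "f \<otimes>\<^bsub>?S\<^esub> g \<otimes>\<^bsub>?S\<^esub> h = f \<otimes>\<^bsub>?S\<^esub> (g \<otimes>\<^bsub>?S\<^esub> h)"
    proof
      fix i
      show "(f \<otimes>\<^bsub>?S\<^esub> g \<otimes>\<^bsub>?S\<^esub> h) i = (f \<otimes>\<^bsub>?S\<^esub> (g \<otimes>\<^bsub>?S\<^esub> h)) i"
        using psum_conv_assoc[of "\<lambda>i j k. f i \<otimes> g j \<otimes> h k" i]
        by (simp add: mult psum_mult_l psum_mult_r m_assoc)
    qed
  next
    fix f assume f: "f \<in> carrier ?S"
    then have [simp]: "f i \<in> carrier A" for i by (auto simp: cl)
    show "\<one>\<^bsub>?S\<^esub> \<otimes>\<^bsub>?S\<^esub> f = f"
    proof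
      show "(\<one>\<^bsub>?S\<^esub> \<otimes>\<^bsub>?S\<^esub> f) i = f i" for i
        unfolding mult by (subst psum_single[of 0]) (auto simp: one)
    qed
    show "f \<otimes>\<^bsub>?S\<^esub> \<one>\<^bsub>?S\<^esub> = f"
    proof
      show "(f \<otimes>\<^bsub>?S\<^esub> \<one>\<^bsub>?S\<^esub>) i = f i" for i
        unfolding mult by (subst psum_single[of i]) (auto simp: one)
    qed
  qed (auto simp: cl mult one)
  ultimately have "ring ?S"
    by (rule ringI) (auto simp: cl fun_eq_iff add mult l_distr r_distr psum_add)
  then show ?thesis
  proof (intro assoc_alg.intro assoc_alg_axioms.intro)
    fix f s t assume f: "f \<in> carrier ?S"
    then have [simp]: "f i \<in> carrier A" for i by (auto simp: cl)
    show "t \<odot>\<^bsub>?S\<^esub> f \<in> carrier ?S" by (simp add: cl smult)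
    show "(s + t) \<odot>\<^bsub>?S\<^esub> f = s \<odot>\<^bsub>?S\<^esub> f \<oplus>\<^bsub>?S\<^esub> t \<odot>\<^bsub>?S\<^esub> f"
      by (simp add: fun_eq_iff smult add psum_add smult_l_distr)
    show "1 \<odot>\<^bsub>?S\<^esub> f = f"
    proof
      show "(1 \<odot>\<^bsub>?S\<^esub> f) i = f i" for i
        unfolding smult by (subst psum_single[of 0]) (auto simp: one)
    qed
    show "(s * t) \<odot>\<^bsub>?S\<^esub> f = s \<odot>\<^bsub>?S\<^esub> (t \<odot>\<^bsub>?S\<^esub> f)"
    proof
      fix i
      have nth: "fps_nth (s * t) k \<odot> x = psum A (\<lambda>l. fps_nth s l \<odot> (fps_nth t (k - l) \<odot> x)) (Suc k)"
        if "x \<in> carrier A" for k x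
      proof -
        have "(\<Sum>l<m. fps_nth s l * fps_nth t (k - l)) \<odot> x =
            psum A (\<lambda>l. fps_nth s l \<odot> (fps_nth t (k - l) \<odot> x)) m" for m
          using that by (induction m) (auto simp: smult_l_distr smult_assoc psum.simps)
        from this[of "Suc k"] show ?thesis
          by (simp add: fps_mult_nth atLeast0AtMost lessThan_Suc_atMost)
      qed
      show "((s * t) \<odot>\<^bsub>?S\<^esub> f) i = (s \<odot>\<^bsub>?S\<^esub> (t \<odot>\<^bsub>?S\<^esub> f)) i"
        using psum_conv_assoc[of "\<lambda>i j k. fps_nth s i \<odot> (fps_nth t j \<odot> f k)" i]
        by (simp add: smult psum_smult nth)
    qed
    fix g assume g: "g \<in> carrier ?S"
    then have [simp]: "g i \<in> carrier A" for i by (auto simp: cl)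
    show "t \<odot>\<^bsub>?S\<^esub> (f \<oplus>\<^bsub>?S\<^esub> g) = t \<odot>\<^bsub>?S\<^esub> f \<oplus>\<^bsub>?S\<^esub> t \<odot>\<^bsub>?S\<^esub> g"
      by (simp add: fun_eq_iff smult add psum_add smult_r_distr)
    show "(t \<odot>\<^bsub>?S\<^esub> f) \<otimes>\<^bsub>?S\<^esub> g = t \<odot>\<^bsub>?S\<^esub> (f \<otimes>\<^bsub>?S\<^esub> g)"
    proof
      show "((t \<odot>\<^bsub>?S\<^esub> f) \<otimes>\<^bsub>?S\<^esub> g) i = (t \<odot>\<^bsub>?S\<^esub> (f \<otimes>\<^bsub>?S\<^esub> g)) i" for i
        using psum_conv_assoc[of "\<lambda>i j k. fps_nth t i \<odot> (f j \<otimes> g k)" i]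
        by (simp add: smult mult psum_smult psum_mult_r smult_mult_l)
    qed
    show "f \<otimes>\<^bsub>?S\<^esub> (t \<odot>\<^bsub>?S\<^esub> g) = t \<odot>\<^bsub>?S\<^esub> (f \<otimes>\<^bsub>?S\<^esub> g)"
    proof
      fix i :: nat
      have *: "i - k - l = i - l - k" for k l by simp
      show "(f \<otimes>\<^bsub>?S\<^esub> (t \<odot>\<^bsub>?S\<^esub> g)) i = (t \<odot>\<^bsub>?S\<^esub> (f \<otimes>\<^bsub>?S\<^esub> g)) i"
        using psum_triangle_swap[of "\<lambda>k l. fps_nth t l \<odot> (f k \<otimes> g (i - l - k))" i]
        by (simp add: smult mult psum_smult psum_mult_l smult_mult_r * add.commute)
    qed
  qed
qed

lemma psum_ser1: "psum (ser1 R) F n i = psum R (\<lambda>k. F k i) n"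
  by (induction n) (simp_all add: ser1_def)

lemma pser_simps:
  "f \<in> carrier (pser R) \<longleftrightarrow> (\<forall>i j. f i j \<in> carrier R)"
  "(f \<oplus>\<^bsub>pser R\<^esub> g) i j = f i j \<oplus>\<^bsub>R\<^esub> g i j"
  "\<one>\<^bsub>pser R\<^esub> i j = (if i = 0 \<and> j = 0 then \<one>\<^bsub>R\<^esub> else \<zero>\<^bsub>R\<^esub>)"
  "\<zero>\<^bsub>pser R\<^esub> i j = \<zero>\<^bsub>R\<^esub>"
  by (simp_all add: pser_def)

lemma psum_pser: "psum (pser R) F n i j = psum R (\<lambda>k. F k i j) n"
  by (induction n) (simp_all add: pser_simps)

section \<open>Operations and topology of \<open>A[[c1, c2]]\<close>\<close>

locale real_alg = assoc_alg A for A :: "(real, 'a) module" (structure)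
begin

lemma pser_mult:
  assumes "f \<in> carrier (pser A)" "g \<in> carrier (pser A)"
  shows "(f \<otimes>\<^bsub>pser A\<^esub> g) i j =
    psum A (\<lambda>i'. psum A (\<lambda>j'. f i' j' \<otimes> g (i - i') (j - j')) (Suc j)) (Suc i)"
proof -
  have "(\<Oplus>j'\<in>{..j}. f i' j' \<otimes> g (i - i') (j - j')) =
      psum A (\<lambda>j'. f i' j' \<otimes> g (i - i') (j - j')) (Suc j)" for i'
    using assms by (intro finsum_atMost_psum) (auto simp: pser_simps)
  then show ?thesis
    using assms by (simp add: pser_def finsum_atMost_psum psum_closed del: psum.simps)
qed

lemma pser_smult:
  assumes "f \<in> carrier (pser A)"
  shows "(t \<odot>\<^bsub>pser A\<^esub> f) i j =
    psum A (\<lambda>i'. psum A (\<lambda>j'. kcoeff t i' j' \<odot> f (i - i') (j - j')) (Suc j)) (Suc i)"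
proof -
  have "(\<Oplus>j'\<in>{..j}. kcoeff t i' j' \<odot> f (i - i') (j - j')) =
      psum A (\<lambda>j'. kcoeff t i' j' \<odot> f (i - i') (j - j')) (Suc j)" for i'
    using assms by (intro finsum_atMost_psum) (auto simp: pser_simps)
  then show ?thesis
    using assms by (simp add: pser_def finsum_atMost_psum psum_closed del: psum.simps)
qed

text \<open>An element of \<open>kk\<close> is a series in \<open>c2\<close> whose coefficients are
  series in \<open>c1\<close>, so the outer index of the iterated \<open>ser1\<close> is the power
  of \<open>c2\<close>; hence the exchanged indices in the transfer map.\<close>

lemma topalg_pser: "topalg (pser A)"
proof -
  note [simp del] = psum.simps
  note [simp] = psum_closed
  interpret S: assoc_alg "ser1 A" by (rule assoc_alg_ser1)
  have SS: "assoc_alg (ser1 (ser1 A))" by (rule S.assoc_alg_ser1)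
  have cl: "f \<in> carrier (ser1 (ser1 A)) \<longleftrightarrow> (\<forall>j i. f j i \<in> carrier A)" for f
    by (simp add: ser1_def)
  show ?thesis
    unfolding topalg_def
  proof (rule assoc_alg_transfer[OF SS, of "\<lambda>f j i. f i j"])
    show "inj_on (\<lambda>f j i. f i j) (carrier (pser A))" by (auto simp: inj_on_def fun_eq_iff)
  next
    fix f g assume fg: "f \<in> carrier (pser A)" "g \<in> carrier (pser A)"
    then have [simp]: "f i j \<in> carrier A" "g i j \<in> carrier A" for i j by (auto simp: pser_simps)
    show "f \<otimes>\<^bsub>pser A\<^esub> g \<in> carrier (pser A)"
      unfolding pser_simps(1) pser_mult[OF fg] by simp
    show "(\<lambda>j i. (f \<otimes>\<^bsub>pser A\<^esub> g) i j) = (\<lambda>j i. f i j) \<otimes>\<^bsub>ser1 (ser1 A)\<^esub> (\<lambda>j i. g i j)"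
    proof (intro ext)
      fix j i
      have "((\<lambda>j i. f i j) \<otimes>\<^bsub>ser1 (ser1 A)\<^esub> (\<lambda>j i. g i j)) j i =
          psum A (\<lambda>j'. psum A (\<lambda>i'. f i' j' \<otimes> g (i - i') (j - j')) (Suc i)) (Suc j)"
        by (subst ser1_def) (simp add: psum_ser1, simp add: ser1_def)
      also have "\<dots> = (f \<otimes>\<^bsub>pser A\<^esub> g) i j"
        unfolding pser_mult[OF fg] by (rule psum_swap) simp
      finally show "(f \<otimes>\<^bsub>pser A\<^esub> g) i j = ((\<lambda>j i. f i j) \<otimes>\<^bsub>ser1 (ser1 A)\<^esub> (\<lambda>j i. g i j)) j i" ..
    qed
  next
    fix f t assume f: "f \<in> carrier (pser A)"
    then have [simp]: "f i j \<in> carrier A" for i j by (auto simp: pser_simps)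
    show "t \<odot>\<^bsub>pser A\<^esub> f \<in> carrier (pser A)"
      unfolding pser_simps(1) pser_smult[OF f] by simp
    show "(\<lambda>j i. (t \<odot>\<^bsub>pser A\<^esub> f) i j) = t \<odot>\<^bsub>ser1 (ser1 A)\<^esub> (\<lambda>j i. f i j)"
    proof (intro ext)
      fix j i
      have "(t \<odot>\<^bsub>ser1 (ser1 A)\<^esub> (\<lambda>j i. f i j)) j i =
          psum A (\<lambda>j'. psum A (\<lambda>i'. kcoeff t i' j' \<odot> f (i - i') (j - j')) (Suc i)) (Suc j)"
        by (subst ser1_def) (simp add: psum_ser1, simp add: ser1_def kcoeff_def)
      also have "\<dots> = (t \<odot>\<^bsub>pser A\<^esub> f) i j"
        unfolding pser_smult[OF f] by (rule psum_swap) simp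
      finally show "(t \<odot>\<^bsub>pser A\<^esub> f) i j = (t \<odot>\<^bsub>ser1 (ser1 A)\<^esub> (\<lambda>j i. f i j)) j i" ..
    qed
  qed (simp_all add: cl pser_simps, simp_all add: ser1_def fun_eq_iff pser_simps)
qed

sublocale pser: topalg "pser A" by (rule topalg_pser)

lemma pser_minus:
  assumes "f \<in> carrier (pser A)" shows "(\<ominus>\<^bsub>pser A\<^esub> f) i j = \<ominus> f i j"
proof -
  have "\<ominus>\<^bsub>pser A\<^esub> f = (\<lambda>i j. \<ominus> f i j)"
    using assms by (intro pser.minus_equality) (auto simp: pser_simps fun_eq_iff l_neg)
  then show ?thesis by simp
qed

lemma pser_diff:
  assumes "f \<in> carrier (pser A)" "g \<in> carrier (pser A)"
  shows "(f \<ominus>\<^bsub>pser A\<^esub> g) i j = f i j \<ominus> g i j"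
  using assms by (simp add: pser.minus_eq minus_eq pser_simps(2) pser_minus)

lemma pser_smult_monom:
  assumes f: "f \<in> carrier (pser A)"
  shows "((kreal r * (c1 ^ i * c2 ^ j)) \<odot>\<^bsub>pser A\<^esub> f) k l =
    (if i \<le> k \<and> j \<le> l then r \<odot> f (k - i) (l - j) else \<zero>)"
proof -
  note [simp del] = psum.simps
  have [simp]: "f i j \<in> carrier A" for i j using f by (auto simp: pser_simps)
  have in1: "psum A (\<lambda>j'. kcoeff (kreal r * (c1 ^ i * c2 ^ j)) i' j' \<odot> f (k - i') (l - j')) (Suc l) =
      (if i' = i \<and> j \<le> l then r \<odot> f (k - i) (l - j) else \<zero>)" for i'
  proof (cases "i' = i \<and> j \<le> l")
    case True
    then show ?thesis by (subst psum_single[of j]) (auto simp: kcoeff_monom)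
  next
    case False
    then show ?thesis by (subst psum_zero) (auto simp: kcoeff_monom)
  qed
  show ?thesis
  proof (cases "i \<le> k \<and> j \<le> l")
    case True
    then show ?thesis
      unfolding pser_smult[OF f] in1 by (subst psum_single[of i]) auto
  next
    case False
    then show ?thesis
      unfolding pser_smult[OF f] in1 by (subst psum_zero) auto
  qed
qed

lemma pser_monom:
  assumes "f \<in> carrier (pser A)"
  shows "((c1 ^ i * c2 ^ j) \<odot>\<^bsub>pser A\<^esub> f) k l = (if i \<le> k \<and> j \<le> l then f (k - i) (l - j) else \<zero>)"
proof -
  have "f i j \<in> carrier A" for i j using assms by (auto simp: pser_simps)
  then show ?thesis using pser_smult_monom[OF assms, of 1 i j k l] by simp
qed

lemma pser_smult_kreal: "f \<in> carrier (pser A) \<Longrightarrow> (kreal r \<odot>\<^bsub>pser A\<^esub> f) k l = r \<odot> f k l"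
  and pser_c1: "f \<in> carrier (pser A) \<Longrightarrow>
    (c1 \<odot>\<^bsub>pser A\<^esub> f) k l = (if k = 0 then \<zero> else f (k - 1) l)"
  and pser_c2: "f \<in> carrier (pser A) \<Longrightarrow>
    (c2 \<odot>\<^bsub>pser A\<^esub> f) k l = (if l = 0 then \<zero> else f k (l - 1))"
  using pser_smult_monom[of f r 0 0 k l] pser_monom[of f 1 0 k l] pser_monom[of f 0 1 k l]
  by (auto simp: Suc_le_eq)

text \<open>For the converse direction \<open>f = c1^(n+1) w + c2 v\<close>, where \<open>w\<close>
  collects the coefficients free of \<open>c2\<close> and \<open>v\<close> is covered by the
  induction hypothesis. Convergence can thus be read off coefficientwise.\<close>

lemma pser_nbhd:
  "f \<in> adic_nbhd (pser A) n \<longleftrightarrow> f \<in> carrier (pser A) \<and> (\<forall>i j. i + j < n \<longrightarrow> f i j = \<zero>)"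
proof
  assume f: "f \<in> adic_nbhd (pser A) n"
  then have "\<forall>i j. i + j < n \<longrightarrow> f i j = \<zero>"
    by (induction rule: pser.nbhd_induct) (auto simp: pser_monom pser_simps(2,4))
  with f show "f \<in> carrier (pser A) \<and> (\<forall>i j. i + j < n \<longrightarrow> f i j = \<zero>)" by simp
next
  have "f \<in> adic_nbhd (pser A) n" if "f \<in> carrier (pser A)" "\<forall>i j. i + j < n \<longrightarrow> f i j = \<zero>"
    using that
  proof (induction n arbitrary: f)
    case (Suc n)
    have c [simp]: "f i j \<in> carrier A" for i j using Suc.prems(1) by (auto simp: pser_simps)
    define v where "v i j = f i (Suc j)" for i j
    define w where "w i j = (if j = 0 then f (Suc n + i) 0 else \<zero>)" for i j :: nat
    have w: "w \<in> carrier (pser A)" by (auto simp: pser_simps w_def)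
    have v: "v \<in> carrier (pser A)" by (auto simp: pser_simps v_def)
    have "v \<in> adic_nbhd (pser A) n"
      by (rule Suc.IH[OF v]) (simp add: v_def Suc.prems(2))
    then have 1: "(c1 ^ 0 * c2 ^ 1) \<odot>\<^bsub>pser A\<^esub> v \<in> adic_nbhd (pser A) (Suc n)"
      using pser.nbhd_monom_smult[of v n 0 1] by simp
    have 2: "(c1 ^ Suc n * c2 ^ 0) \<odot>\<^bsub>pser A\<^esub> w \<in> adic_nbhd (pser A) (Suc n)"
      by (rule pser.nbhd_monom[OF w]) simp
    have "f = (c1 ^ Suc n * c2 ^ 0) \<odot>\<^bsub>pser A\<^esub> w \<oplus>\<^bsub>pser A\<^esub> (c1 ^ 0 * c2 ^ 1) \<odot>\<^bsub>pser A\<^esub> v"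
    proof (intro ext)
      fix k l
      show "f k l = ((c1 ^ Suc n * c2 ^ 0) \<odot>\<^bsub>pser A\<^esub> w \<oplus>\<^bsub>pser A\<^esub> (c1 ^ 0 * c2 ^ 1) \<odot>\<^bsub>pser A\<^esub> v) k l"
        unfolding pser_simps(2) pser_monom[OF w] pser_monom[OF v]
        using Suc.prems(2) by (cases l) (auto simp: w_def v_def not_le)
    qed
    then show ?case using pser.nbhd_add[OF 2 1] by simp
  qed simp
  then show "f \<in> carrier (pser A) \<and> (\<forall>i j. i + j < n \<longrightarrow> f i j = \<zero>) \<Longrightarrow> f \<in> adic_nbhd (pser A) n"
    by blast
qed

lemma calg_pser: "calg (pser A)"
proof (rule calg.intro[OF topalg_pser], rule calg_axioms.intro)
  fix f assume "f \<in> carrier (pser A)" "\<And>n. f \<in> adic_nbhd (pser A) n"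
  then have "f i j = \<zero>" for i j using pser_nbhd[of f "Suc (i + j)"] by auto
  then show "f = \<zero>\<^bsub>pser A\<^esub>" by (auto simp: pser_simps fun_eq_iff)
next
  fix d assume d: "\<And>n. d n \<in> adic_nbhd (pser A) n"
  have c [simp]: "d n i j \<in> carrier A" for n i j using d[of n] by (simp add: pser_nbhd pser_simps)
  \<comment> \<open>Coefficient \<open>(i, j)\<close> of \<open>d n\<close> vanishes as soon as
    \<open>n > i + j\<close>, so each coefficient of the sum is a finite sum.\<close>
  define s where "s i j = psum A (\<lambda>n. d n i j) (Suc (i + j))" for i j
  have s: "s \<in> carrier (pser A)" by (simp add: pser_simps s_def psum_closed del: psum.simps)
  have p: "psum (pser A) d n \<in> carrier (pser A)" for n by (simp add: pser_simps psum_pser psum_closed)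
  have z: "d m i j = \<zero>" if "i + j < m" for m i j
    using d[of m] that by (simp add: pser_nbhd)
  have eq: "psum A (\<lambda>n. d n i j) (Suc (i + j) + k) = s i j" for i j k
    by (induction k) (auto simp: s_def z psum_closed)
  have "s \<ominus>\<^bsub>pser A\<^esub> psum (pser A) d n \<in> adic_nbhd (pser A) n" for n
    unfolding pser_nbhd
  proof (intro conjI allI impI)
    show "s \<ominus>\<^bsub>pser A\<^esub> psum (pser A) d n \<in> carrier (pser A)" using s p by simp
    fix i j assume "i + j < n"
    then have "psum (pser A) d n i j = s i j"
      using eq[of i j "n - Suc (i + j)"] by (simp add: psum_pser del: psum.simps)
    then show "(s \<ominus>\<^bsub>pser A\<^esub> psum (pser A) d n) i j = \<zero>"
      using s by (simp add: pser_diff[OF s p] pser_simps minus_eq r_neg)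
  qed
  with s show "\<exists>s\<in>carrier (pser A). \<forall>n. s \<ominus>\<^bsub>pser A\<^esub> psum (pser A) d n \<in> adic_nbhd (pser A) n"
    by blast
qed

sublocale pser: calg "pser A" by (rule calg_pser)

section \<open>Constant series, and maps determined by their values on constants\<close>

definition pconst :: "'a \<Rightarrow> nat \<Rightarrow> nat \<Rightarrow> 'a" where
  "pconst u i j = (if i = 0 \<and> j = 0 then u else \<zero>)"

lemma pconst_closed [simp]: "u \<in> carrier A \<Longrightarrow> pconst u \<in> carrier (pser A)"
  by (simp add: pconst_def pser_simps)

lemma pconst_add: "u \<in> carrier A \<Longrightarrow> v \<in> carrier A \<Longrightarrow> pconst (u \<oplus> v) = pconst u \<oplus>\<^bsub>pser A\<^esub> pconst v"
  by (auto simp: pconst_def pser_simps fun_eq_iff)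

lemma pconst_smult: "u \<in> carrier A \<Longrightarrow> pconst (r \<odot> u) = kreal r \<odot>\<^bsub>pser A\<^esub> pconst u"
  by (auto simp: pser_smult_kreal fun_eq_iff) (auto simp: pconst_def)

lemma pconst_mult:
  assumes [simp]: "u \<in> carrier A" "v \<in> carrier A"
  shows "pconst (u \<otimes> v) = pconst u \<otimes>\<^bsub>pser A\<^esub> pconst v"
proof (intro ext)
  fix i j
  have c [simp]: "pconst u i j \<in> carrier A" "pconst v i j \<in> carrier A" for i j by (auto simp: pconst_def)
  have "(pconst u \<otimes>\<^bsub>pser A\<^esub> pconst v) i j = u \<otimes> pconst v i j"
    unfolding pser_mult[OF pconst_closed pconst_closed, OF assms]
    apply (subst psum_single[of 0])
       apply (auto simp del: psum.simps intro!: psum_closed)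
     apply (auto simp: pconst_def simp del: psum.simps intro!: psum_zero)
    apply (subst psum_single[of 0])
       apply (auto simp: pconst_def simp del: psum.simps)
    done
  then show "pconst (u \<otimes> v) i j = (pconst u \<otimes>\<^bsub>pser A\<^esub> pconst v) i j"
    by (simp add: pconst_def)
qed

lemma pconst_one: "pconst \<one> = \<one>\<^bsub>pser A\<^esub>"
  by (auto simp: pconst_def pser_simps fun_eq_iff)

text \<open>The homogeneous component of total degree \<open>n\<close>, expressed through constants;
  a series is the convergent sum of these components.\<close>

definition pterm :: "(nat \<Rightarrow> nat \<Rightarrow> 'a) \<Rightarrow> nat \<Rightarrow> (nat \<Rightarrow> nat \<Rightarrow> 'a)" where
  "pterm f n = psum (pser A) (\<lambda>i. (c1 ^ i * c2 ^ (n - i)) \<odot>\<^bsub>pser A\<^esub> pconst (f i (n - i))) (Suc n)"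

lemma
  assumes f: "f \<in> carrier (pser A)"
  shows pterm_nbhd: "pterm f n \<in> adic_nbhd (pser A) n" and asum_pterm: "asum (pser A) (pterm f) = f"
proof -
  note [simp del] = psum.simps
  have c [simp]: "f i j \<in> carrier A" for i j using f by (auto simp: pser_simps)
  show nb: "pterm f n \<in> adic_nbhd (pser A) n" for n
    unfolding pterm_def by (intro pser.nbhd_psum pser.nbhd_gen) auto
  have mon: "((c1 ^ i * c2 ^ (n - i)) \<odot>\<^bsub>pser A\<^esub> pconst (f i (n - i))) k l =
      (if k = i \<and> l = n - i then f i (n - i) else \<zero>)" for i n k l
    by (subst pser_monom) (auto simp: pconst_def)
  have val: "pterm f n k l = (if k + l = n then f k l else \<zero>)" for n k l
  proof (cases "k + l = n")
    case True
    then show ?thesis unfolding pterm_def psum_pser mon by (subst psum_single[of k]) auto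
  next
    case False
    then show ?thesis unfolding pterm_def psum_pser mon by (subst psum_zero) auto
  qed
  show "asum (pser A) (pterm f) = f"
  proof (rule pser.asum_eqI[OF pser.nbhd_closed[OF nb] f])
    fix n
    have p: "psum (pser A) (pterm f) n \<in> carrier (pser A)"
      by (intro pser.psum_closed pser.nbhd_closed[OF nb])
    show "f \<ominus>\<^bsub>pser A\<^esub> psum (pser A) (pterm f) n \<in> adic_nbhd (pser A) n"
      unfolding pser_nbhd
    proof (intro conjI allI impI)
      fix k l assume "k + l < n"
      then have "psum A (\<lambda>m. if k + l = m then f k l else \<zero>) n = f k l"
        by (subst psum_single[of "k + l"]) auto
      then show "(f \<ominus>\<^bsub>pser A\<^esub> psum (pser A) (pterm f) n) k l = \<zero>"
        by (simp add: pser_diff[OF f p] psum_pser val minus_eq r_neg)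
    qed (use f p in simp)
  qed
qed

text \<open>By continuity a linear map is determined by its values on homogeneous components, and
  these are \<open>kk\<close>-combinations of constants.\<close>

lemma pser_lin_eqI:
  assumes B: "calg B" and F: "lin (pser A) B F" and G: "lin (pser A) B G"
    and eq: "\<And>u. u \<in> carrier A \<Longrightarrow> F (pconst u) = G (pconst u)" and f: "f \<in> carrier (pser A)"
  shows "F f = G f"
proof -
  interpret B: calg B by fact
  have c [simp]: "f i j \<in> carrier A" for i j using f by (auto simp: pser_simps)
  have "F (pterm f n) = G (pterm f n)" for n
    unfolding pterm_def lin_psum[OF pser.assoc_alg_axioms B.assoc_alg_axioms F
        pser.smult_closed[OF pconst_closed[OF c]]]
      lin_psum[OF pser.assoc_alg_axioms B.assoc_alg_axioms G pser.smult_closed[OF pconst_closed[OF c]]]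
    by (intro psum_cong) (simp add: lin_smult[OF F] lin_smult[OF G] eq)
  then show ?thesis
    using lin_eq_on_series[OF pser.calg_axioms B F G pterm_nbhd[OF f]] asum_pterm[OF f] by simp
qed

end

text \<open>Linearity from real scalars to \<open>kk\<close>-scalars along \<open>kreal\<close>;
  \<open>lin\<close> requires the same scalars on both sides.\<close>

definition real_lin :: "(real, 'a) module \<Rightarrow> (kk, 'b) module \<Rightarrow> ('a \<Rightarrow> 'b) \<Rightarrow> bool" where
  "real_lin A B h \<longleftrightarrow> h \<in> carrier A \<rightarrow> carrier B \<and>
    (\<forall>x\<in>carrier A. \<forall>y\<in>carrier A. h (x \<oplus>\<^bsub>A\<^esub> y) = h x \<oplus>\<^bsub>B\<^esub> h y) \<and>
    (\<forall>r. \<forall>x\<in>carrier A. h (r \<odot>\<^bsub>A\<^esub> x) = kreal r \<odot>\<^bsub>B\<^esub> h x)"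

lemma real_linI:
  "(\<And>x. x \<in> carrier A \<Longrightarrow> h x \<in> carrier B) \<Longrightarrow>
   (\<And>x y. x \<in> carrier A \<Longrightarrow> y \<in> carrier A \<Longrightarrow> h (x \<oplus>\<^bsub>A\<^esub> y) = h x \<oplus>\<^bsub>B\<^esub> h y) \<Longrightarrow>
   (\<And>r x. x \<in> carrier A \<Longrightarrow> h (r \<odot>\<^bsub>A\<^esub> x) = kreal r \<odot>\<^bsub>B\<^esub> h x) \<Longrightarrow> real_lin A B h"
  by (auto simp: real_lin_def)

lemma real_linD:
  "real_lin A B h \<Longrightarrow> x \<in> carrier A \<Longrightarrow> h x \<in> carrier B"
  "real_lin A B h \<Longrightarrow> x \<in> carrier A \<Longrightarrow> y \<in> carrier A \<Longrightarrow> h (x \<oplus>\<^bsub>A\<^esub> y) = h x \<oplus>\<^bsub>B\<^esub> h y"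
  "real_lin A B h \<Longrightarrow> x \<in> carrier A \<Longrightarrow> h (r \<odot>\<^bsub>A\<^esub> x) = kreal r \<odot>\<^bsub>B\<^esub> h x"
  by (auto simp: real_lin_def)

context real_alg
begin

lemma real_lin_zero:
  assumes "topalg B" "real_lin A B h" shows "h \<zero> = \<zero>\<^bsub>B\<^esub>"
proof -
  interpret B: topalg B by fact
  have "h (0 \<odot> \<zero>) = kreal 0 \<odot>\<^bsub>B\<^esub> h \<zero>" by (rule real_linD[OF assms(2)]) simp
  then show ?thesis using real_linD(1)[OF assms(2), of \<zero>] by simp
qed

text \<open>The extension is \<open>f \<mapsto> \<Sum> c1^i c2^j h(f i j)\<close>, summed by total
  degree. By \<open>klinearI\<close> only additivity and the scalars in the reals, \<open>c1\<close>
  and \<open>c2\<close> have to be examined.\<close>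

theorem pser_extend_lin:
  assumes B: "calg B" and h: "real_lin A B h"
  obtains F where "lin (pser A) B F" "\<And>u. u \<in> carrier A \<Longrightarrow> F (pconst u) = h u"
proof -
  note [simp del] = psum.simps
  interpret B: calg B by fact
  define t where "t f n = psum B (\<lambda>i. (c1 ^ i * c2 ^ (n - i)) \<odot>\<^bsub>B\<^esub> h (f i (n - i))) (Suc n)" for f n
  define F where "F f = asum B (t f)" for f
  have h0 [simp]: "h \<zero> = \<zero>\<^bsub>B\<^esub>" by (rule real_lin_zero[OF B.topalg_axioms h])
  have hc: "h (f i j) \<in> carrier B" if "f \<in> carrier (pser A)" for f i j
    using that real_linD(1)[OF h] by (simp add: pser_simps)
  have nb: "t f n \<in> adic_nbhd B n" if "f \<in> carrier (pser A)" for f n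
    unfolding t_def using hc[OF that] by (intro B.nbhd_psum B.nbhd_gen) auto
  have cl: "F f \<in> carrier B" if "f \<in> carrier (pser A)" for f
    unfolding F_def by (rule B.asum_closed[OF nb[OF that]])
  have "lin (pser A) B F"
  proof (rule klinearI[OF pser.topalg_axioms B cl])
    fix f g assume fg: "f \<in> carrier (pser A)" "g \<in> carrier (pser A)"
    have "t (f \<oplus>\<^bsub>pser A\<^esub> g) n = t f n \<oplus>\<^bsub>B\<^esub> t g n" for n
    proof -
      have "t (f \<oplus>\<^bsub>pser A\<^esub> g) n = psum B (\<lambda>i. (c1 ^ i * c2 ^ (n - i)) \<odot>\<^bsub>B\<^esub> h (f i (n - i)) \<oplus>\<^bsub>B\<^esub>
          (c1 ^ i * c2 ^ (n - i)) \<odot>\<^bsub>B\<^esub> h (g i (n - i))) (Suc n)"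
        unfolding t_def using fg real_linD(2)[OF h]
        by (intro psum_cong) (simp add: pser_simps B.smult_r_distr real_linD(1)[OF h])
      then show ?thesis
        unfolding t_def using hc fg by (simp add: B.psum_add)
    qed
    then have "t (f \<oplus>\<^bsub>pser A\<^esub> g) = (\<lambda>n. t f n \<oplus>\<^bsub>B\<^esub> t g n)" by blast
    then show "F (f \<oplus>\<^bsub>pser A\<^esub> g) = F f \<oplus>\<^bsub>B\<^esub> F g"
      unfolding F_def by (simp add: B.asum_add[OF nb[OF fg(1)] nb[OF fg(2)]])
  next
    fix f r assume f: "f \<in> carrier (pser A)"
    have "t (kreal r \<odot>\<^bsub>pser A\<^esub> f) n = kreal r \<odot>\<^bsub>B\<^esub> t f n" for n
    proof -
      have "t (kreal r \<odot>\<^bsub>pser A\<^esub> f) n =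
          psum B (\<lambda>i. kreal r \<odot>\<^bsub>B\<^esub> ((c1 ^ i * c2 ^ (n - i)) \<odot>\<^bsub>B\<^esub> h (f i (n - i)))) (Suc n)"
        unfolding t_def using f
        by (intro psum_cong)
          (simp add: pser_smult_kreal real_linD(3)[OF h] pser_simps B.smult_comm[OF real_linD(1)[OF h]])
      then show ?thesis unfolding t_def using hc[OF f] by (simp add: B.psum_smult)
    qed
    then have "t (kreal r \<odot>\<^bsub>pser A\<^esub> f) = (\<lambda>n. kreal r \<odot>\<^bsub>B\<^esub> t f n)" by blast
    then show "F (kreal r \<odot>\<^bsub>pser A\<^esub> f) = kreal r \<odot>\<^bsub>B\<^esub> F f"
      unfolding F_def by (simp add: B.asum_smult[OF nb[OF f]])
  next
    fix f assume f: "f \<in> carrier (pser A)"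
    have c1f: "c1 \<odot>\<^bsub>pser A\<^esub> f \<in> carrier (pser A)" "c2 \<odot>\<^bsub>pser A\<^esub> f \<in> carrier (pser A)" using f by auto
    \<comment> \<open>Multiplication by \<open>c1\<close> or \<open>c2\<close> raises the total
      degree by one: the term of index \<open>0\<close> vanishes, and the term of index
      \<open>Suc n\<close> is the scalar times the old term of index \<open>n\<close>.\<close>
    have t0: "t (c1 \<odot>\<^bsub>pser A\<^esub> f) 0 = \<zero>\<^bsub>B\<^esub>" "t (c2 \<odot>\<^bsub>pser A\<^esub> f) 0 = \<zero>\<^bsub>B\<^esub>"
      using f by (simp_all add: t_def psum.simps pser_c1 pser_c2)
    have "t (c1 \<odot>\<^bsub>pser A\<^esub> f) (Suc n) = c1 \<odot>\<^bsub>B\<^esub> t f n" for n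
    proof -
      have "t (c1 \<odot>\<^bsub>pser A\<^esub> f) (Suc n) =
          psum B (\<lambda>i. (c1 ^ Suc i * c2 ^ (n - i)) \<odot>\<^bsub>B\<^esub> h ((c1 \<odot>\<^bsub>pser A\<^esub> f) (Suc i) (n - i))) (Suc n)"
        unfolding t_def using hc[OF c1f(1)] hc[OF f]
        by (subst B.psum_shift) (auto simp: pser_c1[OF f] intro!: B.psum_closed B.smult_closed)
      also have "\<dots> = psum B (\<lambda>i. c1 \<odot>\<^bsub>B\<^esub> ((c1 ^ i * c2 ^ (n - i)) \<odot>\<^bsub>B\<^esub> h (f i (n - i)))) (Suc n)"
        using hc[OF f] by (intro psum_cong) (simp add: pser_c1[OF f] mult.assoc flip: B.smult_assoc)
      finally show ?thesis unfolding t_def using hc[OF f] by (simp add: B.psum_smult)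
    qed
    then show "F (c1 \<odot>\<^bsub>pser A\<^esub> f) = c1 \<odot>\<^bsub>B\<^esub> F f"
      unfolding F_def
      by (simp add: B.asum_shift[OF nb[OF c1f(1)]] t0 B.asum_smult[OF nb[OF f]] B.asum_closed[OF nb[OF f]])
    \<comment> \<open>For \<open>c1\<close> the summand that disappears is the first one,
      \<open>i = 0\<close>; for \<open>c2\<close> it is the last one,
      \<open>i = Suc n\<close>.\<close>
    have "t (c2 \<odot>\<^bsub>pser A\<^esub> f) (Suc n) = c2 \<odot>\<^bsub>B\<^esub> t f n" for n
    proof -
      have "t (c2 \<odot>\<^bsub>pser A\<^esub> f) (Suc n) =
          psum B (\<lambda>i. (c1 ^ i * c2 ^ (Suc n - i)) \<odot>\<^bsub>B\<^esub> h ((c2 \<odot>\<^bsub>pser A\<^esub> f) i (Suc n - i))) (Suc n)"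
        unfolding t_def using hc[OF c1f(2)] hc[OF f]
        by (subst psum.simps(2)) (auto simp: pser_c2[OF f] intro!: B.r_zero B.psum_closed B.smult_closed)
      also have "\<dots> = psum B (\<lambda>i. c2 \<odot>\<^bsub>B\<^esub> ((c1 ^ i * c2 ^ (n - i)) \<odot>\<^bsub>B\<^esub> h (f i (n - i)))) (Suc n)"
        using hc[OF f]
        by (intro psum_cong) (simp add: pser_c2[OF f] Suc_diff_le mult_ac flip: B.smult_assoc)
      finally show ?thesis unfolding t_def using hc[OF f] by (simp add: B.psum_smult)
    qed
    then show "F (c2 \<odot>\<^bsub>pser A\<^esub> f) = c2 \<odot>\<^bsub>B\<^esub> F f"
      unfolding F_def
      by (simp add: B.asum_shift[OF nb[OF c1f(2)]] t0 B.asum_smult[OF nb[OF f]] B.asum_closed[OF nb[OF f]])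
  qed
  moreover have "F (pconst u) = h u" if u: "u \<in> carrier A" for u
  proof -
    have hu: "h u \<in> carrier B" by (rule real_linD(1)[OF h u])
    have "t (pconst u) n = \<zero>\<^bsub>B\<^esub>" if "n \<ge> 1" for n
      unfolding t_def using that by (intro B.psum_zero) (auto simp: pconst_def)
    then have "F (pconst u) = psum B (t (pconst u)) 1"
      unfolding F_def by (intro B.asum_finite nb pconst_closed u) auto
    also have "\<dots> = h u" using hu by (simp add: psum.simps t_def pconst_def)
    finally show ?thesis .
  qed
  ultimately show ?thesis using that by blast
qed

text \<open>Multiplicativity is an equality of maps linear in each argument, so applying
  \<open>pser_lin_eqI\<close> to one argument at a time reduces it to constants. The same scheme
  recurs for monoid algebras and tensor products.\<close>

theorem pser_extend_hom:
  assumes B: "calg B" and h: "real_lin A B h"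
    and mult: "\<And>u v. u \<in> carrier A \<Longrightarrow> v \<in> carrier A \<Longrightarrow> h (u \<otimes> v) = h u \<otimes>\<^bsub>B\<^esub> h v"
    and one: "h \<one> = \<one>\<^bsub>B\<^esub>"
  obtains F where "alg_hom (pser A) B F" "\<And>u. u \<in> carrier A \<Longrightarrow> F (pconst u) = h u"
proof -
  interpret B: calg B by fact
  obtain F where F: "lin (pser A) B F" "\<And>u. u \<in> carrier A \<Longrightarrow> F (pconst u) = h u"
    using pser_extend_lin[OF B h] by blast
  note Fc = lin_closed[OF F(1)]
  have linl: "lin (pser A) B (\<lambda>f. F (f \<otimes>\<^bsub>pser A\<^esub> g))" "lin (pser A) B (\<lambda>f. F f \<otimes>\<^bsub>B\<^esub> F g)"
    "lin (pser A) B (\<lambda>f. F (g \<otimes>\<^bsub>pser A\<^esub> f))" "lin (pser A) B (\<lambda>f. F g \<otimes>\<^bsub>B\<^esub> F f)"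
    if "g \<in> carrier (pser A)" for g
    using that
    by (auto intro!: linI simp: pser.l_distr pser.r_distr B.l_distr B.r_distr Fc lin_add[OF F(1)]
        lin_smult[OF F(1)] pser.smult_mult_l pser.smult_mult_r B.smult_mult_l B.smult_mult_r)
  have 1: "F (pconst u \<otimes>\<^bsub>pser A\<^esub> g) = F (pconst u) \<otimes>\<^bsub>B\<^esub> F g"
    if u: "u \<in> carrier A" and g: "g \<in> carrier (pser A)" for u g
    by (rule pser_lin_eqI[OF B linl(3) linl(4) _ g])
      (simp_all add: u F(2) mult flip: pconst_mult)
  have "F (f \<otimes>\<^bsub>pser A\<^esub> g) = F f \<otimes>\<^bsub>B\<^esub> F g"
    if f: "f \<in> carrier (pser A)" and g: "g \<in> carrier (pser A)" for f g
    by (rule pser_lin_eqI[OF B linl(1)[OF g] linl(2)[OF g] 1 f]) (use g in auto)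
  then have "alg_hom (pser A) B F"
    using F one by (intro alg_homI) (auto simp flip: pconst_one)
  with F(2) show ?thesis using that by blast
qed

end


section \<open>Monoid algebras\<close>

lemma monalg_simps:
  "p \<in> carrier (monalg G) \<longleftrightarrow> Poly_Mapping.keys p \<subseteq> carrier G"
  "p \<oplus>\<^bsub>monalg G\<^esub> q = p + q" "\<zero>\<^bsub>monalg G\<^esub> = 0" "\<one>\<^bsub>monalg G\<^esub> = Poly_Mapping.single \<one>\<^bsub>G\<^esub> 1"
  by (simp_all add: monalg_def)

lemma lookup_monalg_smult:
  "Poly_Mapping.lookup (r \<odot>\<^bsub>monalg G\<^esub> p) a = r * Poly_Mapping.lookup p a"
  by (simp add: monalg_def Poly_Mapping.map.rep_eq when_def)

lemma monalg_smult_single: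
  "r \<odot>\<^bsub>monalg G\<^esub> Poly_Mapping.single a s = Poly_Mapping.single a (r * s)"
  by (rule poly_mapping_eqI) (simp add: lookup_monalg_smult lookup_single when_def)

text \<open>Enlarging the index sets adds only zero terms. With a common superset of the keys
  distributivity becomes termwise, even where coefficients of a sum cancel.\<close>

lemma monalg_mult_superset:
  assumes "finite S" "Poly_Mapping.keys p \<subseteq> S" "finite T" "Poly_Mapping.keys q \<subseteq> T"
  shows "p \<otimes>\<^bsub>monalg G\<^esub> q = (\<Sum>a\<in>S. \<Sum>b\<in>T.
    Poly_Mapping.single (a \<otimes>\<^bsub>G\<^esub> b) (Poly_Mapping.lookup p a * Poly_Mapping.lookup q b))"
proof -
  have "(\<Sum>b\<in>Poly_Mapping.keys q. Poly_Mapping.single (a \<otimes>\<^bsub>G\<^esub> b) (Poly_Mapping.lookup p a * Poly_Mapping.lookup q b)) =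
    (\<Sum>b\<in>T. Poly_Mapping.single (a \<otimes>\<^bsub>G\<^esub> b) (Poly_Mapping.lookup p a * Poly_Mapping.lookup q b))" for a
    using assms(3,4) by (intro sum.mono_neutral_left) (auto simp: in_keys_iff)
  then have "p \<otimes>\<^bsub>monalg G\<^esub> q = (\<Sum>a\<in>Poly_Mapping.keys p. \<Sum>b\<in>T.
    Poly_Mapping.single (a \<otimes>\<^bsub>G\<^esub> b) (Poly_Mapping.lookup p a * Poly_Mapping.lookup q b))"
    by (simp add: monalg_def)
  also have "\<dots> = (\<Sum>a\<in>S. \<Sum>b\<in>T.
    Poly_Mapping.single (a \<otimes>\<^bsub>G\<^esub> b) (Poly_Mapping.lookup p a * Poly_Mapping.lookup q b))"
    using assms(1,2) by (intro sum.mono_neutral_left) (auto simp: in_keys_iff)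
  finally show ?thesis .
qed

lemma monalg_mult_add_l:
  "(p + p') \<otimes>\<^bsub>monalg G\<^esub> q = p \<otimes>\<^bsub>monalg G\<^esub> q + p' \<otimes>\<^bsub>monalg G\<^esub> q"
proof -
  let ?S = "Poly_Mapping.keys p \<union> Poly_Mapping.keys p'" and ?T = "Poly_Mapping.keys q"
  have S: "finite ?S" "finite ?T" by simp_all
  show ?thesis
    using keys_add[of p p']
    by (simp add: monalg_mult_superset[OF S(1) _ S(2)] lookup_add distrib_right single_add sum.distrib)
qed

lemma monalg_mult_add_r:
  "q \<otimes>\<^bsub>monalg G\<^esub> (p + p') = q \<otimes>\<^bsub>monalg G\<^esub> p + q \<otimes>\<^bsub>monalg G\<^esub> p'"
proof -
  let ?S = "Poly_Mapping.keys p \<union> Poly_Mapping.keys p'" and ?T = "Poly_Mapping.keys q"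
  have S: "finite ?S" "finite ?T" by simp_all
  show ?thesis
    using keys_add[of p p']
    by (simp add: monalg_mult_superset[OF S(2) _ S(1)] lookup_add distrib_left single_add sum.distrib)
qed

lemma monalg_mult_single:
  "Poly_Mapping.single a r \<otimes>\<^bsub>monalg G\<^esub> Poly_Mapping.single b s = Poly_Mapping.single (a \<otimes>\<^bsub>G\<^esub> b) (r * s)"
  by (subst monalg_mult_superset[of "{a}" _ "{b}"]) auto

lemma monalg_mult_zero [simp]: "0 \<otimes>\<^bsub>monalg G\<^esub> q = 0" "q \<otimes>\<^bsub>monalg G\<^esub> 0 = 0"
  using monalg_mult_add_l[of G 0 0 q] monalg_mult_add_r[of G q 0 0] by auto

lemma monalg_induct [consumes 1, case_names zero single add]:
  assumes "p \<in> carrier (monalg G)"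
    and "P 0" "\<And>a r. a \<in> carrier G \<Longrightarrow> P (Poly_Mapping.single a r)"
    and "\<And>p q. p \<in> carrier (monalg G) \<Longrightarrow> q \<in> carrier (monalg G) \<Longrightarrow> P p \<Longrightarrow> P q \<Longrightarrow> P (p + q)"
  shows "P p"
proof -
  let ?s = "\<lambda>S. \<Sum>a\<in>S. Poly_Mapping.single a (Poly_Mapping.lookup p a)"
  have 1: "P (?s S) \<and> ?s S \<in> carrier (monalg G)" if "finite S" "S \<subseteq> Poly_Mapping.keys p" for S
    using that
  proof (induction S)
    case empty
    then show ?case using assms(2) by (simp add: monalg_simps)
  next
    case (insert a S)
    have a: "a \<in> carrier G" using insert assms(1) by (auto simp: monalg_simps)
    then have "Poly_Mapping.single a (Poly_Mapping.lookup p a) \<in> carrier (monalg G)"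
      by (auto simp: monalg_simps split: if_splits)
    then show ?case
      using insert a assms(3,4) keys_add[of "Poly_Mapping.single a (Poly_Mapping.lookup p a)" "?s S"]
      by (auto simp: monalg_simps)
  qed
  have "?s (Poly_Mapping.keys p) = p"
  proof (rule poly_mapping_eqI)
    fix b
    have "Poly_Mapping.lookup (?s (Poly_Mapping.keys p)) b =
        (\<Sum>a\<in>Poly_Mapping.keys p. if a = b then Poly_Mapping.lookup p b else 0)"
      by (simp add: lookup_sum lookup_single when_def)
    also have "\<dots> = Poly_Mapping.lookup p b" by (simp add: in_keys_iff)
    finally show "Poly_Mapping.lookup (?s (Poly_Mapping.keys p)) b = Poly_Mapping.lookup p b" .
  qed
  with 1[of "Poly_Mapping.keys p"] show ?thesis by simp
qed

lemma real_alg_monalg: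
  assumes "Group.monoid G" shows "real_alg (monalg G)"
proof -
  interpret G: Group.monoid G by fact
  let ?R = "monalg G"
  have single: "Poly_Mapping.single a r \<in> carrier ?R" if "a \<in> carrier G" for a r
    using that by (simp add: monalg_simps)
  have add: "p + q \<in> carrier ?R" if "p \<in> carrier ?R" "q \<in> carrier ?R" for p q
    using that keys_add[of p q] by (auto simp: monalg_simps)
  have mult: "p \<otimes>\<^bsub>?R\<^esub> q \<in> carrier ?R" if "p \<in> carrier ?R" "q \<in> carrier ?R" for p q
    using that(1)
  proof (induction rule: monalg_induct)
    case (single a r)
    show ?case using that(2)
      by (induction rule: monalg_induct)
        (use \<open>a \<in> carrier G\<close> in \<open>auto simp: monalg_mult_single monalg_mult_add_r add intro!: \<open>\<And>a r. a \<in> carrier G \<Longrightarrow> Poly_Mapping.single a r \<in> carrier ?R\<close>, auto simp: monalg_simps\<close>)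
  qed (auto simp: monalg_mult_add_l add, simp add: monalg_simps)
  have smult: "r \<odot>\<^bsub>?R\<^esub> p \<in> carrier ?R" if "p \<in> carrier ?R" for r p
    using that by (auto simp: monalg_simps in_keys_iff lookup_monalg_smult)
  have one: "\<one>\<^bsub>?R\<^esub> \<in> carrier ?R" by (simp add: monalg_simps(4) single)
  have assoc: "p \<otimes>\<^bsub>?R\<^esub> q \<otimes>\<^bsub>?R\<^esub> s = p \<otimes>\<^bsub>?R\<^esub> (q \<otimes>\<^bsub>?R\<^esub> s)"
    if "p \<in> carrier ?R" "q \<in> carrier ?R" "s \<in> carrier ?R" for p q s
    using that(1)
  proof (induction rule: monalg_induct)
    case (single a r)
    note a = single
    show ?case using that(2)
    proof (induction rule: monalg_induct)
      case (single b r')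
      note b = single
      show ?case using that(3)
        by (induction rule: monalg_induct)
          (simp_all add: monalg_mult_single monalg_mult_add_r G.m_assoc a b mult.assoc)
    qed (simp_all add: monalg_mult_add_l monalg_mult_add_r)
  qed (simp_all add: monalg_mult_add_l)
  have one_l: "\<one>\<^bsub>?R\<^esub> \<otimes>\<^bsub>?R\<^esub> p = p" and one_r: "p \<otimes>\<^bsub>?R\<^esub> \<one>\<^bsub>?R\<^esub> = p" if "p \<in> carrier ?R" for p
    using that by (induction rule: monalg_induct)
      (simp_all add: monalg_simps(4) monalg_mult_single monalg_mult_add_r monalg_mult_add_l)
  have smult_add: "r \<odot>\<^bsub>?R\<^esub> (p + q) = r \<odot>\<^bsub>?R\<^esub> p + r \<odot>\<^bsub>?R\<^esub> q" for r p q
    by (rule poly_mapping_eqI) (simp add: lookup_monalg_smult lookup_add distrib_left)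
  have smult_0: "r \<odot>\<^bsub>?R\<^esub> 0 = 0" for r
    by (rule poly_mapping_eqI) (simp add: lookup_monalg_smult)
  have sml: "(r \<odot>\<^bsub>?R\<^esub> p) \<otimes>\<^bsub>?R\<^esub> q = r \<odot>\<^bsub>?R\<^esub> (p \<otimes>\<^bsub>?R\<^esub> q)" and smr: "p \<otimes>\<^bsub>?R\<^esub> (r \<odot>\<^bsub>?R\<^esub> q) = r \<odot>\<^bsub>?R\<^esub> (p \<otimes>\<^bsub>?R\<^esub> q)"
    if "p \<in> carrier ?R" "q \<in> carrier ?R" for p q r
    using that(1)
  proof (induction rule: monalg_induct)
    case (single a s)
    case 1
    show ?case using that(2)
      by (induction rule: monalg_induct)
        (simp_all add: monalg_mult_single monalg_mult_add_r monalg_smult_single smult_add smult_0 mult.assoc)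
    case 2
    show ?case using that(2)
      by (induction rule: monalg_induct)
        (simp_all add: monalg_mult_single monalg_mult_add_r monalg_smult_single smult_add smult_0 mult_ac)
  qed (simp_all add: monalg_mult_add_l smult_add smult_0)
  have "abelian_group ?R"
  proof (rule abelian_groupI)
    fix p assume "p \<in> carrier ?R"
    then show "\<exists>q\<in>carrier ?R. q \<oplus>\<^bsub>?R\<^esub> p = \<zero>\<^bsub>?R\<^esub>"
      by (intro bexI[of _ "- p"]) (auto simp: monalg_simps)
  qed (auto simp: monalg_simps(2,3) add add_ac, simp add: monalg_simps)
  moreover have "Group.monoid ?R"
    by (rule monoidI) (simp_all add: mult one assoc one_l one_r)
  ultimately have "ring ?R"
    by (rule ringI) (simp_all add: monalg_simps(2) monalg_mult_add_l monalg_mult_add_r)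
  then show ?thesis
    unfolding real_alg_def
    by (intro assoc_alg.intro assoc_alg_axioms.intro)
      (simp_all add: smult smult_add monalg_simps(2) sml smr,
        (rule poly_mapping_eqI, simp add: lookup_monalg_smult lookup_add algebra_simps)+)
qed

lemma monalg_extend:
  assumes G: "Group.monoid G" and B: "topalg B" and h: "\<And>g. g \<in> carrier G \<Longrightarrow> h g \<in> carrier B"
  obtains H where "real_lin (monalg G) B H"
    "\<And>g r. g \<in> carrier G \<Longrightarrow> H (Poly_Mapping.single g r) = kreal r \<odot>\<^bsub>B\<^esub> h g"
proof -
  interpret B: topalg B by fact
  interpret G: Group.monoid G by fact
  define H where "H p = (\<Oplus>\<^bsub>B\<^esub>a\<in>Poly_Mapping.keys p. kreal (Poly_Mapping.lookup p a) \<odot>\<^bsub>B\<^esub> h a)" for p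
  have sup: "H p = (\<Oplus>\<^bsub>B\<^esub>a\<in>S. kreal (Poly_Mapping.lookup p a) \<odot>\<^bsub>B\<^esub> h a)"
    if "finite S" "Poly_Mapping.keys p \<subseteq> S" "S \<subseteq> carrier G" for p S
    unfolding H_def using that h
    by (intro B.add.finprod_mono_neutral_cong_left) (auto simp: in_keys_iff subset_iff)
  have "real_lin (monalg G) B H"
  proof (rule real_linI)
    fix p assume p: "p \<in> carrier (monalg G)"
    show Hp: "H p \<in> carrier B" unfolding H_def using p h
      by (intro B.finsum_closed) (auto simp: monalg_simps)
    show "H (r \<odot>\<^bsub>monalg G\<^esub> p) = kreal r \<odot>\<^bsub>B\<^esub> H p" for r
    proof -
      have sub: "Poly_Mapping.keys (r \<odot>\<^bsub>monalg G\<^esub> p) \<subseteq> Poly_Mapping.keys p"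
        by (auto simp: in_keys_iff lookup_monalg_smult)
      have *: "(\<Oplus>\<^bsub>B\<^esub>a\<in>S. kreal (r * Poly_Mapping.lookup p a) \<odot>\<^bsub>B\<^esub> h a) =
          kreal r \<odot>\<^bsub>B\<^esub> (\<Oplus>\<^bsub>B\<^esub>a\<in>S. kreal (Poly_Mapping.lookup p a) \<odot>\<^bsub>B\<^esub> h a)"
        if "finite S" "S \<subseteq> carrier G" for S
        using that
      proof (induction S)
        case (insert a S)
        then show ?case using h
          by (simp add: B.finsum_insert subset_iff Pi_iff B.smult_r_distr B.smult_assoc B.finsum_closed)
      qed simp
      show ?thesis
        using p sub sup[OF finite_keys sub] *[OF finite_keys] unfolding H_def[of p]
        by (simp add: monalg_simps lookup_monalg_smult del: kreal_simps)
    qed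
    fix q assume q: "q \<in> carrier (monalg G)"
    let ?S = "Poly_Mapping.keys p \<union> Poly_Mapping.keys q"
    have S: "finite ?S" "?S \<subseteq> carrier G" using p q by (auto simp: monalg_simps)
    have "H (p + q) = (\<Oplus>\<^bsub>B\<^esub>a\<in>?S. kreal (Poly_Mapping.lookup p a) \<odot>\<^bsub>B\<^esub> h a \<oplus>\<^bsub>B\<^esub>
        kreal (Poly_Mapping.lookup q a) \<odot>\<^bsub>B\<^esub> h a)"
      unfolding sup[OF S(1) keys_add S(2)]
      using S h by (intro B.finsum_cong') (auto simp: lookup_add subset_iff B.smult_l_distr)
    also have "\<dots> = H p \<oplus>\<^bsub>B\<^esub> H q"
      using S h sup[OF S(1) _ S(2), of p] sup[OF S(1) _ S(2), of q]
      by (subst B.finsum_addf) (auto simp: subset_iff)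
    finally show "H (p \<oplus>\<^bsub>monalg G\<^esub> q) = H p \<oplus>\<^bsub>B\<^esub> H q" by (simp add: monalg_simps)
  qed
  moreover have "H (Poly_Mapping.single g r) = kreal r \<odot>\<^bsub>B\<^esub> h g" if "g \<in> carrier G" for g r
    using that h by (subst sup[of "{g}"]) (auto simp: B.finsum_singleton)
  ultimately show ?thesis using that by blast
qed

lemma cmon_eq_pconst: "real_alg (monalg G) \<Longrightarrow> cmon g = real_alg.pconst (monalg G) (Poly_Mapping.single g 1)"
  by (intro ext) (simp add: cmon_def real_alg.pconst_def monalg_simps)

section \<open>Completed monoid algebras: maps determined by and extended from the monoid\<close>

context
  fixes G :: "('g, 'm) monoid_scheme"
  assumes G: "Group.monoid G"
begin

interpretation G: Group.monoid G by (rule G)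

interpretation R: real_alg "monalg G" by (rule real_alg_monalg[OF G])

lemmas cmon_pc = cmon_eq_pconst[OF R.real_alg_axioms]

lemma calg_cmonalg: "calg (cmonalg G)"
  by (rule R.calg_pser)

lemma cmon_closed: "g \<in> carrier G \<Longrightarrow> cmon g \<in> carrier (cmonalg G)"
  by (simp add: cmon_pc R.pconst_closed monalg_simps)

lemma cmon_mult:
  "g \<in> carrier G \<Longrightarrow> g' \<in> carrier G \<Longrightarrow> cmon g \<otimes>\<^bsub>cmonalg G\<^esub> cmon g' = cmon (g \<otimes>\<^bsub>G\<^esub> g')"
  by (simp add: cmon_pc monalg_simps monalg_mult_single flip: R.pconst_mult)

lemma cmon_one: "cmon \<one>\<^bsub>G\<^esub> = \<one>\<^bsub>cmonalg G\<^esub>"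
  by (simp add: cmon_pc monalg_simps flip: R.pconst_one)

lemma cmonalg_lin_eqI:
  assumes B: "calg B" and F: "lin (cmonalg G) B F" and F': "lin (cmonalg G) B F'"
    and eq: "\<And>g. g \<in> carrier G \<Longrightarrow> F (cmon g) = F' (cmon g)" and f: "f \<in> carrier (cmonalg G)"
  shows "F f = F' f"
proof (rule R.pser_lin_eqI[OF B F F' _ f])
  fix u assume "u \<in> carrier (monalg G)"
  then show "F (R.pconst u) = F' (R.pconst u)"
  proof (induction rule: monalg_induct)
    case zero
    interpret B: calg B by (rule B)
    have "R.pconst 0 = \<zero>\<^bsub>cmonalg G\<^esub>"
      by (intro ext) (simp add: R.pconst_def pser_simps monalg_simps)
    then show ?case
      using lin_zero[OF R.pser.assoc_alg_axioms B.assoc_alg_axioms F]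
        lin_zero[OF R.pser.assoc_alg_axioms B.assoc_alg_axioms F'] by simp
  next
    case (single a r)
    have a: "Poly_Mapping.single a 1 \<in> carrier (monalg G)" using single by (simp add: monalg_simps)
    have "R.pconst (Poly_Mapping.single a r) = kreal r \<odot>\<^bsub>cmonalg G\<^esub> R.pconst (Poly_Mapping.single a 1)"
      using R.pconst_smult[OF a, of r] by (simp add: monalg_smult_single)
    then show ?case using eq[OF single] a unfolding cmon_pc
      by (simp add: lin_smult[OF F] lin_smult[OF F'] R.pconst_closed)
  next
    case (add p q)
    then show ?case
      using R.pconst_add[of p q] by (simp add: monalg_simps(2) lin_add[OF F] lin_add[OF F'] R.pconst_closed)
  qed
qed

lemma cmonalg_extend_lin:
  assumes B: "calg B" and h: "\<And>g. g \<in> carrier G \<Longrightarrow> h g \<in> carrier B"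
  obtains F where "lin (cmonalg G) B F" "\<And>g. g \<in> carrier G \<Longrightarrow> F (cmon g) = h g"
proof -
  interpret B: calg B by (rule B)
  obtain H where H: "real_lin (monalg G) B H"
    "\<And>g r. g \<in> carrier G \<Longrightarrow> H (Poly_Mapping.single g r) = kreal r \<odot>\<^bsub>B\<^esub> h g"
    by (rule monalg_extend[OF G B.topalg_axioms, of h, OF h]) (assumption | rule that)+
  obtain F where F: "lin (cmonalg G) B F" "\<And>u. u \<in> carrier (monalg G) \<Longrightarrow> F (R.pconst u) = H u"
    using R.pser_extend_lin[OF B H(1)] by blast
  show ?thesis
    by (rule that[OF F(1)]) (simp add: cmon_pc F(2) H(2) monalg_simps h)
qed

lemma cmonalg_extend_hom:
  assumes B: "calg B" and h: "\<And>g. g \<in> carrier G \<Longrightarrow> h g \<in> carrier B"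
    and mult: "\<And>g g'. g \<in> carrier G \<Longrightarrow> g' \<in> carrier G \<Longrightarrow> h (g \<otimes>\<^bsub>G\<^esub> g') = h g \<otimes>\<^bsub>B\<^esub> h g'"
    and one: "h \<one>\<^bsub>G\<^esub> = \<one>\<^bsub>B\<^esub>"
  obtains F where "alg_hom (cmonalg G) B F" "\<And>g. g \<in> carrier G \<Longrightarrow> F (cmon g) = h g"
proof -
  interpret B: calg B by (rule B)
  obtain F where F: "lin (cmonalg G) B F" "\<And>g. g \<in> carrier G \<Longrightarrow> F (cmon g) = h g"
    by (rule cmonalg_extend_lin[OF B, of h, OF h]) (assumption | rule that)+
  note Fc = lin_closed[OF F(1)]
  have linl: "lin (cmonalg G) B (\<lambda>f. F (f \<otimes>\<^bsub>cmonalg G\<^esub> g))" "lin (cmonalg G) B (\<lambda>f. F f \<otimes>\<^bsub>B\<^esub> F g)"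
    "lin (cmonalg G) B (\<lambda>f. F (g \<otimes>\<^bsub>cmonalg G\<^esub> f))" "lin (cmonalg G) B (\<lambda>f. F g \<otimes>\<^bsub>B\<^esub> F f)"
    if "g \<in> carrier (cmonalg G)" for g
    using that
    by (auto intro!: linI simp: R.pser.l_distr R.pser.r_distr B.l_distr B.r_distr Fc lin_add[OF F(1)]
        lin_smult[OF F(1)] R.pser.smult_mult_l R.pser.smult_mult_r B.smult_mult_l B.smult_mult_r)
  have 1: "F (cmon u \<otimes>\<^bsub>cmonalg G\<^esub> g) = F (cmon u) \<otimes>\<^bsub>B\<^esub> F g"
    if u: "u \<in> carrier G" and g: "g \<in> carrier (cmonalg G)" for u g
    by (rule cmonalg_lin_eqI[OF B linl(3) linl(4) _ g])
      (simp_all add: u F(2) mult cmon_mult cmon_closed)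
  have "F (f \<otimes>\<^bsub>cmonalg G\<^esub> g) = F f \<otimes>\<^bsub>B\<^esub> F g"
    if f: "f \<in> carrier (cmonalg G)" and g: "g \<in> carrier (cmonalg G)" for f g
    by (rule cmonalg_lin_eqI[OF B linl(1)[OF g] linl(2)[OF g] 1 f]) (use g in auto)
  then have "alg_hom (cmonalg G) B F"
    using F one by (intro alg_homI) (auto simp flip: cmon_one)
  with F(2) show ?thesis using that by blast
qed

end



section \<open>The completed tensor product\<close>

definition bilin :: "(kk, 'a) module \<Rightarrow> (kk, 'b) module \<Rightarrow> (kk, 'c) module \<Rightarrow> ('a \<Rightarrow> 'b \<Rightarrow> 'c) \<Rightarrow> bool" where
  "bilin A B N \<beta> \<longleftrightarrow> (\<forall>b\<in>carrier B. lin A N (\<lambda>a. \<beta> a b)) \<and> (\<forall>a\<in>carrier A. lin B N (\<beta> a))"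

lemma bilinD:
  "bilin A B N \<beta> \<Longrightarrow> b \<in> carrier B \<Longrightarrow> lin A N (\<lambda>a. \<beta> a b)"
  "bilin A B N \<beta> \<Longrightarrow> a \<in> carrier A \<Longrightarrow> lin B N (\<beta> a)"
  by (auto simp: bilin_def)

locale alg_pair = A: topalg A + B: topalg B
  for A :: "(kk, 'a) module" and B :: "(kk, 'b) module"
begin

abbreviation "F \<equiv> cmonalg (A \<times>\<times> B)"
abbreviation "T \<equiv> ctensor A B"
abbreviation "I \<equiv> tensor_ideal A B"

lemma monoid_pair: "Group.monoid (A \<times>\<times> B)"
  by (rule DirProd_monoid[OF A.monoid_axioms B.monoid_axioms])

sublocale F: calg F by (rule calg_cmonalg[OF monoid_pair])

lemma cmon_pair_closed: "a \<in> carrier A \<Longrightarrow> b \<in> carrier B \<Longrightarrow> cmon (a, b) \<in> carrier F"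
  by (rule cmon_closed[OF monoid_pair]) simp

lemma bilin_rels_closed: "bilin_rels A B \<subseteq> carrier F"
  by (auto simp: bilin_rels_def Let_def intro!: F.minus_closed F.smult_closed F.a_closed cmon_pair_closed)

lemma ideal_I: "ideal I F"
  unfolding tensor_ideal_def by (rule F.ideal_closed_ideal[OF bilin_rels_closed])

lemma calg_ctensor: "calg T"
  unfolding ctensor_def tensor_ideal_def
  by (intro F.calg_closed_quot F.calg_axioms F.ideal_closed_ideal F.closed_ideal_closed bilin_rels_closed)

sublocale T: calg T by (rule calg_ctensor)

definition pr :: "(nat \<Rightarrow> nat \<Rightarrow> ('a \<times> 'b \<Rightarrow>\<^sub>0 real)) \<Rightarrow> (nat \<Rightarrow> nat \<Rightarrow> ('a \<times> 'b \<Rightarrow>\<^sub>0 real)) set" where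
  "pr x = I +>\<^bsub>F\<^esub> x"

lemma alg_hom_pr: "alg_hom F T pr"
  unfolding pr_def[abs_def] ctensor_def by (rule F.alg_hom_rcos[OF ideal_I])

lemmas lin_pr = alg_hom_lin[OF alg_hom_pr]

lemma pr_surj: "pr ` carrier F = carrier T"
  unfolding pr_def[abs_def] ctensor_def by (simp add: F.quot_alg_simps(1)[OF ideal_I])

lemma pr_eq_zero_iff: "x \<in> carrier F \<Longrightarrow> pr x = \<zero>\<^bsub>T\<^esub> \<longleftrightarrow> x \<in> I"
  unfolding pr_def ctensor_def by (rule F.rcos_eq_zero_iff[OF ideal_I])

lemma tens_pr: "tens A B a b = pr (cmon (a, b))"
  by (simp add: tens_def pr_def)

lemma tens_closed [simp]: "a \<in> carrier A \<Longrightarrow> b \<in> carrier B \<Longrightarrow> tens A B a b \<in> carrier T"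
  unfolding tens_pr by (intro lin_closed[OF lin_pr] cmon_pair_closed)

lemma tens_mult:
  assumes "a \<in> carrier A" "b \<in> carrier B" "a' \<in> carrier A" "b' \<in> carrier B"
  shows "tens A B a b \<otimes>\<^bsub>T\<^esub> tens A B a' b' = tens A B (a \<otimes>\<^bsub>A\<^esub> a') (b \<otimes>\<^bsub>B\<^esub> b')"
proof -
  have "tens A B a b \<otimes>\<^bsub>T\<^esub> tens A B a' b' = pr (cmon (a, b) \<otimes>\<^bsub>F\<^esub> cmon (a', b'))"
    unfolding tens_pr using assms by (simp add: alg_hom_mult[OF alg_hom_pr] cmon_pair_closed)
  then show ?thesis
    using assms by (simp add: cmon_mult[OF monoid_pair] tens_pr)
qed

lemma tens_one: "tens A B \<one>\<^bsub>A\<^esub> \<one>\<^bsub>B\<^esub> = \<one>\<^bsub>T\<^esub>"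
  using cmon_one[OF monoid_pair] alg_hom_one[OF alg_hom_pr] by (simp add: tens_pr)

lemma bilin_tens: "bilin A B T (tens A B)"
proof -
  have rel: "pr x = pr y" if "x \<in> carrier F" "y \<in> carrier F" "x \<ominus>\<^bsub>F\<^esub> y \<in> bilin_rels A B" for x y
  proof -
    have "x \<ominus>\<^bsub>F\<^esub> y \<in> I"
      using that F.closed_ideal_superset[OF bilin_rels_closed] by (auto simp: tensor_ideal_def)
    then have "pr (x \<ominus>\<^bsub>F\<^esub> y) = \<zero>\<^bsub>T\<^esub>" using that by (simp add: pr_eq_zero_iff)
    then show ?thesis
      using that
      by (simp add: lin_diff[OF F.assoc_alg_axioms T.assoc_alg_axioms lin_pr] T.eq_diff_zero lin_closed[OF lin_pr])
  qed
  have "tens A B (a \<oplus>\<^bsub>A\<^esub> a') b = tens A B a b \<oplus>\<^bsub>T\<^esub> tens A B a' b"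
    if "a \<in> carrier A" "a' \<in> carrier A" "b \<in> carrier B" for a a' b
    unfolding tens_pr using that
    by (simp add: cmon_pair_closed flip: lin_add[OF lin_pr])
      (rule rel; (auto simp: cmon_pair_closed bilin_rels_def Let_def)?)
  moreover have "tens A B a (b \<oplus>\<^bsub>B\<^esub> b') = tens A B a b \<oplus>\<^bsub>T\<^esub> tens A B a b'"
    if "a \<in> carrier A" "b' \<in> carrier B" "b \<in> carrier B" for a b b'
    unfolding tens_pr using that
    by (simp add: cmon_pair_closed flip: lin_add[OF lin_pr])
      (rule rel; (auto simp: cmon_pair_closed bilin_rels_def Let_def)?)
  moreover have "tens A B (t \<odot>\<^bsub>A\<^esub> a) b = t \<odot>\<^bsub>T\<^esub> tens A B a b"
    if "a \<in> carrier A" "b \<in> carrier B" for a b t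
    unfolding tens_pr using that
    by (simp add: cmon_pair_closed flip: lin_smult[OF lin_pr])
      (rule rel; (auto simp: cmon_pair_closed bilin_rels_def Let_def)?)
  moreover have "tens A B a (t \<odot>\<^bsub>B\<^esub> b) = t \<odot>\<^bsub>T\<^esub> tens A B a b"
    if "a \<in> carrier A" "b \<in> carrier B" for a b t
    unfolding tens_pr using that
    by (simp add: cmon_pair_closed flip: lin_smult[OF lin_pr])
      (rule rel; (auto simp: cmon_pair_closed bilin_rels_def Let_def)?)
  ultimately show ?thesis
    unfolding bilin_def by (auto intro!: linI)
qed

section \<open>Universal property of the completed tensor product\<close>

lemmas lin_tens = bilinD[OF bilin_tens]

text \<open>Formulated for an arbitrary pair of \<open>\<psi>\<close> and \<open>\<beta>\<close>,
  because it is applied to a linear map composed with multiplications on both sides.\<close>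

lemma lin_kills_bilin_rels:
  assumes N: "assoc_alg N" and \<psi>: "lin F N \<psi>" and \<beta>: "bilin A B N \<beta>"
    and eq: "\<And>a b. a \<in> carrier A \<Longrightarrow> b \<in> carrier B \<Longrightarrow> \<psi> (cmon (a, b)) = \<beta> a b"
    and r: "r \<in> bilin_rels A B"
  shows "\<psi> r = \<zero>\<^bsub>N\<^esub>"
proof -
  interpret N: assoc_alg N by (rule N)
  note l = lin_diff[OF F.assoc_alg_axioms N \<psi>] lin_add[OF \<psi>] lin_smult[OF \<psi>]
  have cl: "\<beta> a b \<in> carrier N" if "a \<in> carrier A" "b \<in> carrier B" for a b
    using lin_closed[OF bilinD(2)[OF \<beta> that(1)] that(2)] .
  have b: "\<beta> (a \<oplus>\<^bsub>A\<^esub> a') b = \<beta> a b \<oplus>\<^bsub>N\<^esub> \<beta> a' b" "\<beta> a (b \<oplus>\<^bsub>B\<^esub> b') = \<beta> a b \<oplus>\<^bsub>N\<^esub> \<beta> a b'"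
    "\<beta> (t \<odot>\<^bsub>A\<^esub> a) b = t \<odot>\<^bsub>N\<^esub> \<beta> a b" "\<beta> a (t \<odot>\<^bsub>B\<^esub> b) = t \<odot>\<^bsub>N\<^esub> \<beta> a b"
    if "a \<in> carrier A" "a' \<in> carrier A" "b \<in> carrier B" "b' \<in> carrier B" for a a' b b' t
    using that by (simp_all add: lin_add[OF bilinD(1)[OF \<beta>]] lin_add[OF bilinD(2)[OF \<beta>]]
        lin_smult[OF bilinD(1)[OF \<beta>]] lin_smult[OF bilinD(2)[OF \<beta>]])
  consider (1) a a' b where "r = cmon (a \<oplus>\<^bsub>A\<^esub> a', b) \<ominus>\<^bsub>F\<^esub> (cmon (a, b) \<oplus>\<^bsub>F\<^esub> cmon (a', b))"
        "a \<in> carrier A" "a' \<in> carrier A" "b \<in> carrier B"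
    | (2) a b b' where "r = cmon (a, b \<oplus>\<^bsub>B\<^esub> b') \<ominus>\<^bsub>F\<^esub> (cmon (a, b) \<oplus>\<^bsub>F\<^esub> cmon (a, b'))"
        "a \<in> carrier A" "b \<in> carrier B" "b' \<in> carrier B"
    | (3) t a b where "r = cmon (t \<odot>\<^bsub>A\<^esub> a, b) \<ominus>\<^bsub>F\<^esub> t \<odot>\<^bsub>F\<^esub> cmon (a, b)" "a \<in> carrier A" "b \<in> carrier B"
    | (4) t a b where "r = cmon (a, t \<odot>\<^bsub>B\<^esub> b) \<ominus>\<^bsub>F\<^esub> t \<odot>\<^bsub>F\<^esub> cmon (a, b)" "a \<in> carrier A" "b \<in> carrier B"
    using r unfolding bilin_rels_def Let_def by blast
  then show ?thesis
  proof cases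
    case 1
    then show ?thesis by (simp add: l cmon_pair_closed eq b cl N.eq_diff_zero)
  next
    case 2
    then show ?thesis by (simp add: l cmon_pair_closed eq b cl N.eq_diff_zero)
  next
    case 3
    then show ?thesis by (simp add: l cmon_pair_closed eq b(3)[OF _ 3(2) _ 3(3)] cl N.eq_diff_zero)
  next
    case 4
    then show ?thesis by (simp add: l cmon_pair_closed eq b(4)[OF _ 4(2) _ 4(3)] cl N.eq_diff_zero)
  qed
qed

lemma lin_mult_both:
  assumes "lin F N \<psi>" "x \<in> carrier F" "y \<in> carrier F"
  shows "lin F N (\<lambda>z. \<psi> (x \<otimes>\<^bsub>F\<^esub> z \<otimes>\<^bsub>F\<^esub> y))" "lin F N (\<lambda>z. \<psi> (z \<otimes>\<^bsub>F\<^esub> x \<otimes>\<^bsub>F\<^esub> y))"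
    "lin F N (\<lambda>z. \<psi> (x \<otimes>\<^bsub>F\<^esub> y \<otimes>\<^bsub>F\<^esub> z))"
  using assms(2,3)
  by (auto intro!: linI simp: F.l_distr F.r_distr F.smult_mult_l F.smult_mult_r
      lin_add[OF assms(1)] lin_smult[OF assms(1)] lin_closed[OF assms(1)])

text \<open>The tensor product divides by an ideal, but the map \<open>\<psi>\<close> induced by
  \<open>\<beta>\<close> is only linear. It must therefore vanish on all \<open>x r y\<close> with
  \<open>r\<close> a bilinearity relation. This is shown for pairs \<open>x\<close> and
  \<open>y\<close>, then for all elements by density, and finally on the closure by
  continuity.\<close>

lemma tensor_extend:
  assumes N: "calg N" and \<beta>: "bilin A B N \<beta>"
  obtains \<phi> where "lin T N \<phi>"
    "\<And>a b. a \<in> carrier A \<Longrightarrow> b \<in> carrier B \<Longrightarrow> \<phi> (tens A B a b) = \<beta> a b"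
proof -
  interpret N: calg N by (rule N)
  have cl: "\<beta> a b \<in> carrier N" if "a \<in> carrier A" "b \<in> carrier B" for a b
    using lin_closed[OF bilinD(2)[OF \<beta> that(1)] that(2)] .
  obtain \<psi> where \<psi>: "lin F N \<psi>" "\<And>g. g \<in> carrier (A \<times>\<times> B) \<Longrightarrow> \<psi> (cmon g) = \<beta> (fst g) (snd g)"
    by (rule cmonalg_extend_lin[OF monoid_pair N, of "\<lambda>g. \<beta> (fst g) (snd g)"]) (auto simp: cl)
  have kill: "\<psi> (cmon g \<otimes>\<^bsub>F\<^esub> r \<otimes>\<^bsub>F\<^esub> cmon h) = \<zero>\<^bsub>N\<^esub>"
    if r: "r \<in> bilin_rels A B" and g: "g \<in> carrier (A \<times>\<times> B)" and h: "h \<in> carrier (A \<times>\<times> B)" for r g h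
  proof -
    obtain a1 b1 a2 b2 where gh: "g = (a1, b1)" "h = (a2, b2)" "a1 \<in> carrier A" "a2 \<in> carrier A"
      "b1 \<in> carrier B" "b2 \<in> carrier B" using g h by auto
    have gh':  "cmon g \<in> carrier F" "cmon h \<in> carrier F" using g h by (auto simp: cmon_closed[OF monoid_pair])
    \<comment> \<open>Pairs multiply componentwise, so multiplying by pairs on both sides turns
      \<open>\<beta>\<close> into another bilinear map, and the relations are killed again.\<close>
    have bil: "bilin A B N (\<lambda>a b. \<beta> (a1 \<otimes>\<^bsub>A\<^esub> a \<otimes>\<^bsub>A\<^esub> a2) (b1 \<otimes>\<^bsub>B\<^esub> b \<otimes>\<^bsub>B\<^esub> b2))"
      unfolding bilin_def using gh
      by (auto intro!: linI cl simp: A.l_distr A.r_distr A.smult_mult_l A.smult_mult_r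
          B.l_distr B.r_distr B.smult_mult_l B.smult_mult_r
          lin_add[OF bilinD(1)[OF \<beta>]] lin_add[OF bilinD(2)[OF \<beta>]]
          lin_smult[OF bilinD(1)[OF \<beta>]] lin_smult[OF bilinD(2)[OF \<beta>]])
    have val: "\<psi> (cmon g \<otimes>\<^bsub>F\<^esub> cmon (a, b) \<otimes>\<^bsub>F\<^esub> cmon h) = \<beta> (a1 \<otimes>\<^bsub>A\<^esub> a \<otimes>\<^bsub>A\<^esub> a2) (b1 \<otimes>\<^bsub>B\<^esub> b \<otimes>\<^bsub>B\<^esub> b2)"
      if "a \<in> carrier A" "b \<in> carrier B" for a b
      using gh that by (simp add: cmon_mult[OF monoid_pair] \<psi>(2))
    show ?thesis
      by (rule lin_kills_bilin_rels[OF N.assoc_alg_axioms lin_mult_both(1)[OF \<psi>(1) gh'] bil val r])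
  qed
  have zlin: "lin F N (\<lambda>x. \<zero>\<^bsub>N\<^esub>)" by (rule linI) auto
  have kill2: "\<psi> (x \<otimes>\<^bsub>F\<^esub> r \<otimes>\<^bsub>F\<^esub> y) = \<zero>\<^bsub>N\<^esub>"
    if r: "r \<in> bilin_rels A B" and x: "x \<in> carrier F" and y: "y \<in> carrier F" for r x y
  proof -
    have r': "r \<in> carrier F" using r bilin_rels_closed by auto
    have "\<psi> (cmon g \<otimes>\<^bsub>F\<^esub> r \<otimes>\<^bsub>F\<^esub> y) = \<zero>\<^bsub>N\<^esub>" if g: "g \<in> carrier (A \<times>\<times> B)" for g
      by (rule cmonalg_lin_eqI[OF monoid_pair N lin_mult_both(3)[OF \<psi>(1) cmon_closed[OF monoid_pair g] r'] zlin _ y])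
        (rule kill[OF r g])
    then show ?thesis
      by (rule cmonalg_lin_eqI[OF monoid_pair N lin_mult_both(2)[OF \<psi>(1) r' y] zlin _ x])
  qed
  \<comment> \<open>The largest two-sided ideal on which \<open>\<psi>\<close> vanishes.\<close>
  define K where "K = {r \<in> carrier F. \<forall>x\<in>carrier F. \<forall>y\<in>carrier F. \<psi> (x \<otimes>\<^bsub>F\<^esub> r \<otimes>\<^bsub>F\<^esub> y) = \<zero>\<^bsub>N\<^esub>}"
  have "ideal K F"
  proof (rule idealI[OF F.ring_axioms F.add.subgroupI])
    show "K \<subseteq> carrier F" by (auto simp: K_def)
    have "\<zero>\<^bsub>F\<^esub> \<in> K" by (auto simp: K_def lin_zero[OF F.assoc_alg_axioms N.assoc_alg_axioms \<psi>(1)])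
    then show "K \<noteq> {}" by blast
    show "\<ominus>\<^bsub>F\<^esub> r \<in> K" if "r \<in> K" for r
      using that by (auto simp: K_def F.l_minus F.r_minus lin_minus[OF F.assoc_alg_axioms N.assoc_alg_axioms \<psi>(1)])
    show "r \<oplus>\<^bsub>F\<^esub> r' \<in> K" if "r \<in> K" "r' \<in> K" for r r'
      using that by (auto simp: K_def F.l_distr F.r_distr lin_add[OF \<psi>(1)])
    show "z \<otimes>\<^bsub>F\<^esub> r \<in> K" if "r \<in> K" "z \<in> carrier F" for r z
      using that by (auto simp: K_def simp flip: F.m_assoc)
    show "r \<otimes>\<^bsub>F\<^esub> z \<in> K" if "r \<in> K" "z \<in> carrier F" for r z
    proof -
      have "x \<otimes>\<^bsub>F\<^esub> (r \<otimes>\<^bsub>F\<^esub> z) \<otimes>\<^bsub>F\<^esub> y = x \<otimes>\<^bsub>F\<^esub> r \<otimes>\<^bsub>F\<^esub> (z \<otimes>\<^bsub>F\<^esub> y)"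
        if "x \<in> carrier F" "y \<in> carrier F" "r \<in> carrier F" for x y
        using that \<open>z \<in> carrier F\<close> by (simp add: F.m_assoc)
      then show ?thesis using that by (auto simp: K_def)
    qed
  qed
  then have IK: "Idl\<^bsub>F\<^esub> bilin_rels A B \<subseteq> K"
    using kill2 bilin_rels_closed by (intro F.genideal_mono_ideal) (auto simp: K_def)
  have KF: "K \<subseteq> carrier F" by (auto simp: K_def)
  have K0: "\<psi> r = \<zero>\<^bsub>N\<^esub>" if "r \<in> K" for r
  proof -
    have "\<psi> (\<one>\<^bsub>F\<^esub> \<otimes>\<^bsub>F\<^esub> r \<otimes>\<^bsub>F\<^esub> \<one>\<^bsub>F\<^esub>) = \<zero>\<^bsub>N\<^esub>" "r \<in> carrier F" using that unfolding K_def by blast+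
    then show ?thesis by simp
  qed
  have k: "\<psi> x = \<zero>\<^bsub>N\<^esub>" if "x \<in> carrier F" "pr x = \<zero>\<^bsub>T\<^esub>" for x
  proof (rule lin_vanishes_on_closure[OF F.topalg_axioms N \<psi>(1)])
    show "Idl\<^bsub>F\<^esub> bilin_rels A B \<subseteq> carrier F" using IK KF by simp
    show "\<psi> r = \<zero>\<^bsub>N\<^esub>" if "r \<in> Idl\<^bsub>F\<^esub> bilin_rels A B" for r using IK K0 that by blast
    show "x \<in> adic_closure F (Idl\<^bsub>F\<^esub> bilin_rels A B)"
      using that by (simp add: pr_eq_zero_iff tensor_ideal_def closed_ideal_def)
  qed
  obtain \<phi> where \<phi>: "lin T N \<phi>" "\<And>x. x \<in> carrier F \<Longrightarrow> \<phi> (pr x) = \<psi> x"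
    using lin_factor[OF lin_pr pr_surj \<psi>(1) k F.assoc_alg_axioms T.assoc_alg_axioms N.assoc_alg_axioms] by blast
  show ?thesis
    by (rule that[OF \<phi>(1)]) (simp add: tens_pr \<phi>(2) cmon_pair_closed \<psi>(2))
qed

lemma tensor_lin_eqI:
  assumes N: "calg N" and \<phi>: "lin T N \<phi>" and \<phi>': "lin T N \<phi>'"
    and eq: "\<And>a b. a \<in> carrier A \<Longrightarrow> b \<in> carrier B \<Longrightarrow> \<phi> (tens A B a b) = \<phi>' (tens A B a b)"
    and u: "u \<in> carrier T"
  shows "\<phi> u = \<phi>' u"
proof -
  have "u \<in> pr ` carrier F" using u pr_surj by simp
  then obtain x where x: "x \<in> carrier F" "u = pr x" by auto
  have "\<phi> (pr x) = \<phi>' (pr x)"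
    by (rule cmonalg_lin_eqI[OF monoid_pair N lin_comp[OF lin_pr \<phi>] lin_comp[OF lin_pr \<phi>'] _ x(1)])
      (auto simp: eq simp flip: tens_pr)
  with x show ?thesis by simp
qed

lemma
  assumes N: "calg N" and \<beta>: "bilin A B N \<beta>"
  shows lin_tensor_lift: "lin T N (tensor_lift A B N \<beta>)"
    and tensor_lift_tens: "a \<in> carrier A \<Longrightarrow> b \<in> carrier B \<Longrightarrow> tensor_lift A B N \<beta> (tens A B a b) = \<beta> a b"
proof -
  obtain \<phi> where \<phi>: "lin T N \<phi>"
    "\<And>a b. a \<in> carrier A \<Longrightarrow> b \<in> carrier B \<Longrightarrow> \<phi> (tens A B a b) = \<beta> a b"
    by (rule tensor_extend[OF N \<beta>]) (rule that)
  \<comment> \<open>The description in \<open>tensor_lift\<close> asks for an extensional map;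
    restriction to the carrier makes the solution unique as a function.\<close>
  define \<phi>' where "\<phi>' = restrict \<phi> (carrier T)"
  have \<phi>': "lin T N \<phi>'" "\<phi>' \<in> extensional (carrier T)"
    "\<And>a b. a \<in> carrier A \<Longrightarrow> b \<in> carrier B \<Longrightarrow> \<phi>' (tens A B a b) = \<beta> a b"
    using \<phi> by (auto simp: \<phi>'_def lin_def)
  have "tensor_lift A B N \<beta> = \<phi>'"
    unfolding tensor_lift_def klinear_eq_lin
  proof (rule the_equality)
    fix \<chi> assume \<chi>: "lin T N \<chi> \<and> \<chi> \<in> extensional (carrier T) \<and>
      (\<forall>a\<in>carrier A. \<forall>b\<in>carrier B. \<chi> (tens A B a b) = \<beta> a b)"
    show "\<chi> = \<phi>'"
    proof (rule extensionalityI[of _ "carrier T"])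
      fix u assume "u \<in> carrier T"
      then show "\<chi> u = \<phi>' u"
        by (rule tensor_lin_eqI[OF N conjunct1[OF \<chi>] \<phi>'(1), rotated]) (simp add: \<chi> \<phi>'(3))
    qed (simp_all add: \<chi> \<phi>'(2))
  qed (simp add: \<phi>')
  with \<phi>' show "lin T N (tensor_lift A B N \<beta>)"
    "a \<in> carrier A \<Longrightarrow> b \<in> carrier B \<Longrightarrow> tensor_lift A B N \<beta> (tens A B a b) = \<beta> a b"
    by auto
qed

lemma lin_mult_T:
  assumes "lin T N \<phi>" "u \<in> carrier T"
  shows "lin T N (\<lambda>z. \<phi> (z \<otimes>\<^bsub>T\<^esub> u))" "lin T N (\<lambda>z. \<phi> (u \<otimes>\<^bsub>T\<^esub> z))"
  using assms(2)
  by (auto intro!: linI simp: T.l_distr T.r_distr T.smult_mult_l T.smult_mult_r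
      lin_add[OF assms(1)] lin_smult[OF assms(1)] lin_closed[OF assms(1)])

lemma alg_hom_tensor_lift:
  assumes N: "calg N" and \<beta>: "bilin A B N \<beta>"
    and mult: "\<And>a a' b b'. a \<in> carrier A \<Longrightarrow> a' \<in> carrier A \<Longrightarrow> b \<in> carrier B \<Longrightarrow> b' \<in> carrier B \<Longrightarrow>
      \<beta> (a \<otimes>\<^bsub>A\<^esub> a') (b \<otimes>\<^bsub>B\<^esub> b') = \<beta> a b \<otimes>\<^bsub>N\<^esub> \<beta> a' b'"
    and one: "\<beta> \<one>\<^bsub>A\<^esub> \<one>\<^bsub>B\<^esub> = \<one>\<^bsub>N\<^esub>"
  shows "alg_hom T N (tensor_lift A B N \<beta>)"
proof -
  interpret N: calg N by (rule N)
  let ?\<phi> = "tensor_lift A B N \<beta>"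
  note \<phi> = lin_tensor_lift[OF N \<beta>] and t = tensor_lift_tens[OF N \<beta>]
  have linN: "lin T N (\<lambda>z. ?\<phi> z \<otimes>\<^bsub>N\<^esub> ?\<phi> u)" "lin T N (\<lambda>z. ?\<phi> u \<otimes>\<^bsub>N\<^esub> ?\<phi> z)" if "u \<in> carrier T" for u
    using that by (auto intro!: linI simp: N.l_distr N.r_distr N.smult_mult_l N.smult_mult_r
      lin_add[OF \<phi>] lin_smult[OF \<phi>] lin_closed[OF \<phi>])
  have 1: "?\<phi> (tens A B a b \<otimes>\<^bsub>T\<^esub> v) = ?\<phi> (tens A B a b) \<otimes>\<^bsub>N\<^esub> ?\<phi> v"
    if a: "a \<in> carrier A" "b \<in> carrier B" and v: "v \<in> carrier T" for a b v
    by (rule tensor_lin_eqI[OF N lin_mult_T(2)[OF \<phi>] linN(2) _ v])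
      (use a in \<open>auto simp: tens_mult t mult\<close>)
  have "?\<phi> (u \<otimes>\<^bsub>T\<^esub> v) = ?\<phi> u \<otimes>\<^bsub>N\<^esub> ?\<phi> v" if u: "u \<in> carrier T" and v: "v \<in> carrier T" for u v
    by (rule tensor_lin_eqI[OF N lin_mult_T(1)[OF \<phi> v] linN(1)[OF v] _ u]) (simp add: 1 v)
  then show ?thesis
    by (intro alg_homI[OF \<phi>]) (simp_all add: t one flip: tens_one)
qed

end


section \<open>Evaluation of power series\<close>

text \<open>Otherwise the simplifier rewrites \<open>adic_nbhd A 1\<close> to a form which the rules below do not match.\<close>

declare One_nat_def [simp del]

lemma kcoeff_uminus [simp]: "kcoeff (- s) i j = - kcoeff s i j"
  by (simp add: kcoeff_def)

text \<open>For \<open>z\<close> in the first neighbourhood the power \<open>z^n\<close> has order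
  \<open>n\<close>, so every real series converges at \<open>z\<close>, whatever its
  coefficients.\<close>

definition fps_eval :: "(kk, 'a) module \<Rightarrow> real fps \<Rightarrow> 'a \<Rightarrow> 'a" where
  "fps_eval A p z = asum A (\<lambda>n. kreal (fps_nth p n) \<odot>\<^bsub>A\<^esub> (z [^]\<^bsub>A\<^esub> n))"

lemma (in abelian_group) psum_1 [simp]: "d 0 \<in> carrier G \<Longrightarrow> psum G d 1 = d 0"
  by (simp add: One_nat_def)

lemma (in topalg) psum_scalar:
  "x \<in> carrier A \<Longrightarrow> psum A (\<lambda>k. f k \<odot> x) n = (\<Sum>k<n. f k) \<odot> x"
  by (induction n) (auto simp: smult_l_distr)

lemma kreal_sum: "kreal (sum f S) = (\<Sum>x\<in>S. kreal (f x))"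
  by (induction S rule: infinite_finite_induct) auto

lemma kreal_2: "kreal 2 = 2"
  using kreal_simps(3)[of 1 1] by simp

lemma (in topalg) smult_pow:
  "x \<in> carrier A \<Longrightarrow> (t \<odot> x) [^] (n::nat) = t ^ n \<odot> (x [^] n)"
  by (induction n) (simp_all add: smult_mult_l smult_mult_r smult_assoc mult.commute)

lemma (in topalg) pow_commute:
  "x \<in> carrier A \<Longrightarrow> y \<in> carrier A \<Longrightarrow> x \<otimes> y = y \<otimes> x \<Longrightarrow> x \<otimes> y [^] (n::nat) = y [^] n \<otimes> x"
  by (induction n) (simp_all, metis m_assoc nat_pow_closed)

lemma (in topalg) smult_nbhd_1: "kcoeff t 0 0 = 0 \<Longrightarrow> x \<in> carrier A \<Longrightarrow> t \<odot> x \<in> adic_nbhd A 1"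
  using nbhd_scalar[of t 1 x 0] kalg_nbhd_1_iff[of t] by simp

context calg
begin

lemma fps_term_nbhd: "z \<in> adic_nbhd A 1 \<Longrightarrow> t \<odot> (z [^] n) \<in> adic_nbhd A n"
  by (intro nbhd_smult nbhd_pow)

lemma fps_eval_closed [simp]: "z \<in> adic_nbhd A 1 \<Longrightarrow> fps_eval A p z \<in> carrier A"
  unfolding fps_eval_def by (intro asum_closed fps_term_nbhd)

lemma fps_eval_mult:
  assumes z: "z \<in> adic_nbhd A 1"
  shows "fps_eval A (p * q) z = fps_eval A p z \<otimes> fps_eval A q z"
proof -
  have zc [simp]: "z \<in> carrier A" using z by simp
  have "psum A (\<lambda>k. (kreal (fps_nth p k) \<odot> (z [^] k)) \<otimes> (kreal (fps_nth q (n - k)) \<odot> (z [^] (n - k)))) (Suc n) =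
      kreal (fps_nth (p * q) n) \<odot> (z [^] n)" for n
  proof -
    have "psum A (\<lambda>k. (kreal (fps_nth p k) \<odot> (z [^] k)) \<otimes> (kreal (fps_nth q (n - k)) \<odot> (z [^] (n - k)))) (Suc n) =
        psum A (\<lambda>k. kreal (fps_nth p k * fps_nth q (n - k)) \<odot> (z [^] n)) (Suc n)"
      by (intro psum_cong)
        (simp add: smult_mult_l smult_mult_r nat_pow_mult smult_assoc[symmetric] mult.commute)
    also have "\<dots> = kreal (fps_nth (p * q) n) \<odot> (z [^] n)"
      by (simp add: psum_scalar fps_mult_nth atLeast0AtMost lessThan_Suc_atMost kreal_sum del: psum.simps)
    finally show ?thesis .
  qed
  then show ?thesis
    unfolding fps_eval_def by (subst asum_mult[OF fps_term_nbhd[OF z] fps_term_nbhd[OF z]]) (simp del: psum.simps)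
qed

lemma fps_eval_const_mult:
  assumes z: "z \<in> adic_nbhd A 1"
  shows "fps_eval A (fps_const r * p) z = kreal r \<odot> fps_eval A p z"
proof -
  have zc [simp]: "z \<in> carrier A" using z by simp
  show ?thesis
    unfolding fps_eval_def
    by (simp add: smult_assoc asum_smult[OF fps_term_nbhd[OF z]])
qed

lemma fps_eval_add:
  assumes z: "z \<in> adic_nbhd A 1"
  shows "fps_eval A (p + q) z = fps_eval A p z \<oplus> fps_eval A q z"
proof -
  have zc [simp]: "z \<in> carrier A" using z by simp
  show ?thesis
    unfolding fps_eval_def
    by (simp add: smult_l_distr asum_add[OF fps_term_nbhd[OF z] fps_term_nbhd[OF z]])
qed

lemma fps_eval_diff:
  assumes z: "z \<in> adic_nbhd A 1"
  shows "fps_eval A (p - q) z = fps_eval A p z \<ominus> fps_eval A q z"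
proof -
  have "p - q = p + fps_const (-1) * q" by (simp flip: fps_const_neg)
  then show ?thesis
    using z by (simp only: fps_eval_add fps_eval_const_mult) (simp add: smult_minus_l minus_eq)
qed

lemma fps_eval_one [simp]:
  assumes z: "z \<in> adic_nbhd A 1" shows "fps_eval A 1 z = \<one>"
proof -
  have zc [simp]: "z \<in> carrier A" using z by simp
  show ?thesis
    unfolding fps_eval_def
    by (subst asum_finite[where m = 1, OF fps_term_nbhd[OF z]]) auto
qed

lemma fps_eval_X:
  assumes z: "z \<in> adic_nbhd A 1" shows "fps_eval A fps_X z = z"
proof -
  have zc [simp]: "z \<in> carrier A" using z by simp
  show ?thesis
    unfolding fps_eval_def
    by (subst asum_finite[where m = 2, OF fps_term_nbhd[OF z]]) (auto simp: numeral_2_eq_2)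
qed

lemma fps_eval_scale:
  assumes z: "z \<in> adic_nbhd A 1"
  shows "fps_eval A p (kreal r \<odot> z) = fps_eval A (Abs_fps (\<lambda>n. fps_nth p n * r ^ n)) z"
proof -
  have zc [simp]: "z \<in> carrier A" using z by simp
  show ?thesis
    unfolding fps_eval_def by (simp add: smult_pow smult_assoc)
qed

lemma fps_eval_cong_mod:
  assumes z: "z \<in> adic_nbhd A 1"
  shows "fps_eval A p z \<ominus> psum A (\<lambda>n. kreal (fps_nth p n) \<odot> (z [^] n)) m \<in> adic_nbhd A m"
  unfolding fps_eval_def by (rule asum_approx[OF fps_term_nbhd[OF z]])

text \<open>Left and right multiplication by \<open>y\<close> are linear, hence pass through the
  series to the powers of \<open>z\<close>.\<close>

lemma fps_eval_commute:
  assumes z: "z \<in> adic_nbhd A 1" and y: "y \<in> carrier A" and c: "y \<otimes> z = z \<otimes> y"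
  shows "y \<otimes> fps_eval A p z = fps_eval A p z \<otimes> y"
proof -
  have zc [simp]: "z \<in> carrier A" using z by simp
  have l: "lin A A (\<lambda>x. y \<otimes> x)" "lin A A (\<lambda>x. x \<otimes> y)"
    using y by (auto intro!: linI simp: l_distr r_distr smult_mult_l smult_mult_r)
  show ?thesis
    unfolding fps_eval_def lin_asum[OF calg_axioms calg_axioms l(1) fps_term_nbhd[OF z]]
      lin_asum[OF calg_axioms calg_axioms l(2) fps_term_nbhd[OF z]]
    using y by (simp add: smult_mult_l smult_mult_r pow_commute[OF y zc c])
qed

end

lemma alg_hom_fps_eval:
  assumes A: "calg A" and B: "calg B" and f: "alg_hom A B f" and z: "z \<in> adic_nbhd A 1"
  shows "f (fps_eval A p z) = fps_eval B p (f z)"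
proof -
  interpret A: calg A by (rule A)
  interpret B: calg B by (rule B)
  have zc [simp]: "z \<in> carrier A" using z by simp
  show ?thesis
    unfolding fps_eval_def lin_asum[OF A B alg_hom_lin[OF f] A.fps_term_nbhd[OF z]]
    by (simp add: alg_hom_smult[OF f] alg_hom_pow[OF A.assoc_alg_axioms B.assoc_alg_axioms f])
qed


subsection \<open>Exponentials\<close>

text \<open>Divided powers \<open>z^n / n!\<close>; with them the binomial theorem becomes a plain
  convolution.\<close>

definition divpow :: "(kk, 'a) module \<Rightarrow> 'a \<Rightarrow> nat \<Rightarrow> 'a" where
  "divpow A z n = kreal (1 / fact n) \<odot>\<^bsub>A\<^esub> (z [^]\<^bsub>A\<^esub> n)"

context topalg
begin

lemma divpow_closed [simp]: "z \<in> carrier A \<Longrightarrow> divpow A z n \<in> carrier A"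
  by (simp add: divpow_def)

lemma divpow_0 [simp]: "z \<in> carrier A \<Longrightarrow> divpow A z 0 = \<one>"
  by (simp add: divpow_def)

text \<open>Nonzero reals act invertibly on every algebra, whereas \<open>c2\<close> may fail to be
  cancellable.\<close>

lemma kreal_cancel:
  assumes "x \<in> carrier A" "y \<in> carrier A" "r \<noteq> 0" "kreal r \<odot> x = kreal r \<odot> y" shows "x = y"
proof -
  have "kreal (1 / r * r) \<odot> x = kreal (1 / r * r) \<odot> y"
    using assms(1,2,4) by (simp only: kreal_simps smult_assoc)
  then show ?thesis using assms(1-3) by simp
qed

lemma divpow_Suc: "z \<in> carrier A \<Longrightarrow> kreal (real (Suc n)) \<odot> divpow A z (Suc n) = divpow A z n \<otimes> z"
proof -
  assume z: "z \<in> carrier A"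
  have "kreal (real (Suc n)) \<odot> divpow A z (Suc n) = kreal (real (Suc n) * (1 / fact (Suc n))) \<odot> (z [^] Suc n)"
    unfolding divpow_def using z by (simp only: kreal_simps smult_assoc nat_pow_closed)
  also have "real (Suc n) * (1 / fact (Suc n)) = 1 / fact n"
    by (simp del: of_nat_Suc)
  finally show ?thesis unfolding divpow_def using z by (simp add: smult_mult_l)
qed

text \<open>Binomial theorem for commuting elements. The recursion for \<open>n + 1\<close> times
  the next divided power gives each product two contributions, with factors \<open>k\<close> and
  \<open>n + 1 - k\<close>; they add up to \<open>n + 1\<close>, which is then cancelled.\<close>

lemma divpow_add:
  assumes y: "y \<in> carrier A" and z: "z \<in> carrier A" and c: "y \<otimes> z = z \<otimes> y"
  shows "divpow A (y \<oplus> z) n = psum A (\<lambda>k. divpow A y k \<otimes> divpow A z (n - k)) (Suc n)"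
proof (induction n)
  case 0
  then show ?case using y z by simp
next
  case (Suc n)
  note [simp] = y z
  let ?t = "\<lambda>k. divpow A y k \<otimes> divpow A z (Suc n - k)"
  have comm: "divpow A z j \<otimes> y = y \<otimes> divpow A z j" for j
    using pow_commute[OF y z c] by (simp add: divpow_def smult_mult_l smult_mult_r)
  have "kreal (real (Suc n)) \<odot> divpow A (y \<oplus> z) (Suc n) =
      psum A (\<lambda>k. divpow A y k \<otimes> divpow A z (n - k) \<otimes> (y \<oplus> z)) (Suc n)"
    by (subst divpow_Suc) (simp_all add: Suc psum_mult_r psum_closed del: psum.simps)
  also have "\<dots> = psum A (\<lambda>k. kreal (real (Suc k)) \<odot> ?t (Suc k) \<oplus> kreal (real (Suc n - k)) \<odot> ?t k) (Suc n)"
  proof (rule psum_cong)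
    fix k assume "k < Suc n"
    then have k: "Suc n - k = Suc (n - k)" by simp
    have "divpow A y k \<otimes> divpow A z (n - k) \<otimes> (y \<oplus> z) =
        (divpow A y k \<otimes> y) \<otimes> divpow A z (n - k) \<oplus> divpow A y k \<otimes> (divpow A z (n - k) \<otimes> z)"
      by (simp add: r_distr m_assoc comm)
    also have "\<dots> = (kreal (real (Suc k)) \<odot> divpow A y (Suc k)) \<otimes> divpow A z (n - k) \<oplus>
        divpow A y k \<otimes> (kreal (real (Suc (n - k))) \<odot> divpow A z (Suc (n - k)))"
      by (simp only: divpow_Suc y z)
    also have "\<dots> = kreal (real (Suc k)) \<odot> ?t (Suc k) \<oplus> kreal (real (Suc n - k)) \<odot> ?t k"
      unfolding k by (simp only: smult_mult_l smult_mult_r divpow_closed y z diff_Suc_Suc)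
    finally show "divpow A y k \<otimes> divpow A z (n - k) \<otimes> (y \<oplus> z) =
        kreal (real (Suc k)) \<odot> ?t (Suc k) \<oplus> kreal (real (Suc n - k)) \<odot> ?t k" .
  qed
  also have "\<dots> = psum A (\<lambda>k. kreal (real (Suc k)) \<odot> ?t (Suc k)) (Suc n) \<oplus>
      psum A (\<lambda>k. kreal (real (Suc n - k)) \<odot> ?t k) (Suc n)"
    by (rule psum_add) simp_all
  \<comment> \<open>Both sums are brought to the range \<open>k \<le> Suc n\<close>; the terms that
    are added, \<open>k = 0\<close> in one and \<open>k = Suc n\<close> in the other, carry the
    factor zero.\<close>
  also have "psum A (\<lambda>k. kreal (real (Suc k)) \<odot> ?t (Suc k)) (Suc n) =
      psum A (\<lambda>k. kreal (real k) \<odot> ?t k) (Suc (Suc n))"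
    by (subst (2) psum_shift) (simp_all add: psum_closed del: psum.simps)
  also have "psum A (\<lambda>k. kreal (real (Suc n - k)) \<odot> ?t k) (Suc n) =
      psum A (\<lambda>k. kreal (real (Suc n - k)) \<odot> ?t k) (Suc (Suc n))"
    by (subst (2) psum.simps(2)) (simp add: psum_closed del: psum.simps)
  also have "psum A (\<lambda>k. kreal (real k) \<odot> ?t k) (Suc (Suc n)) \<oplus>
      psum A (\<lambda>k. kreal (real (Suc n - k)) \<odot> ?t k) (Suc (Suc n)) =
      psum A (\<lambda>k. kreal (real k) \<odot> ?t k \<oplus> kreal (real (Suc n - k)) \<odot> ?t k) (Suc (Suc n))"
    by (rule psum_add[symmetric]) simp_all
  also have "\<dots> = psum A (\<lambda>k. kreal (real (Suc n)) \<odot> ?t k) (Suc (Suc n))"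
  proof (rule psum_cong)
    fix k assume "k < Suc (Suc n)"
    then have "real (Suc n) = real k + real (Suc n - k)" by simp
    then show "kreal (real k) \<odot> ?t k \<oplus> kreal (real (Suc n - k)) \<odot> ?t k = kreal (real (Suc n)) \<odot> ?t k"
      by (simp only: kreal_simps smult_l_distr divpow_closed m_closed y z)
  qed
  also have "\<dots> = kreal (real (Suc n)) \<odot> psum A ?t (Suc (Suc n))"
    by (rule psum_smult[symmetric]) simp
  finally have "kreal (real (Suc n)) \<odot> divpow A (y \<oplus> z) (Suc n) = kreal (real (Suc n)) \<odot> psum A ?t (Suc (Suc n))" .
  then show ?case
  proof (rule kreal_cancel[rotated 3])
    show "divpow A (y \<oplus> z) (Suc n) \<in> carrier A" by simp
    show "psum A ?t (Suc (Suc n)) \<in> carrier A" by (intro psum_closed) simp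
    show "real (Suc n) \<noteq> 0" by simp
  qed
qed

end

context calg
begin

abbreviation "ex \<equiv> fps_eval A (fps_exp 1)"

lemma ex_divpow: "ex z = asum A (divpow A z)"
  by (simp add: fps_eval_def divpow_def[abs_def])

lemma divpow_nbhd: "z \<in> adic_nbhd A 1 \<Longrightarrow> divpow A z n \<in> adic_nbhd A n"
  unfolding divpow_def by (rule fps_term_nbhd)

lemma ex_add:
  assumes y: "y \<in> adic_nbhd A 1" and z: "z \<in> adic_nbhd A 1" and c: "y \<otimes> z = z \<otimes> y"
  shows "ex (y \<oplus> z) = ex y \<otimes> ex z"
  unfolding ex_divpow asum_mult[OF divpow_nbhd[OF y] divpow_nbhd[OF z]]
  using divpow_add[OF nbhd_closed[OF y] nbhd_closed[OF z] c] by presburger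

lemma ex_zero [simp]: "ex \<zero> = \<one>"
proof -
  have "ex \<zero> = psum A (divpow A \<zero>) 1"
    unfolding ex_divpow by (intro asum_finite divpow_nbhd) (auto simp: divpow_def nat_pow_zero)
  then show ?thesis by simp
qed

lemma ex_scale: "z \<in> adic_nbhd A 1 \<Longrightarrow> ex (kreal r \<odot> z) = fps_eval A (fps_exp r) z"
  by (subst fps_eval_scale) (simp_all add: fps_exp_def)

text \<open>A scalar without constant term moves \<open>x\<close> into the first neighbourhood, so
  the limit in the definition of the exponential exists and is unique.\<close>

lemma adic_exp_eq:
  assumes t: "kcoeff t 0 0 = 0" and x: "x \<in> carrier A"
  shows "adic_exp A t x = ex (t \<odot> x)"
proof -
  have nb: "t \<odot> x \<in> adic_nbhd A 1" using t x by (rule smult_nbhd_1)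
  have "(kreal (1 / fact i) * t ^ i) \<odot> (x [^] i) = divpow A (t \<odot> x) i" for i
    using x by (simp add: divpow_def smult_pow smult_assoc del: kreal_simps)
  then have "adic_exp A t x = (THE s. adic_limit A (\<lambda>m. \<Oplus>i\<in>{..<m}. divpow A (t \<odot> x) i) s)"
    by (simp add: adic_exp_def)
  also have "\<dots> = asum A (divpow A (t \<odot> x))"
    by (rule the_equality) (simp_all only: adic_limit_asum[OF divpow_nbhd[OF nb]])
  finally show ?thesis by (simp only: ex_divpow)
qed

lemma ex_mod_1:
  assumes z: "z \<in> adic_nbhd A 1" shows "ex z \<ominus> \<one> \<in> adic_nbhd A 1"
  using fps_eval_cong_mod[OF z, of "fps_exp 1" 1] z by simp

lemma ex_mod_2:
  assumes z: "z \<in> adic_nbhd A 1" shows "ex z \<ominus> (\<one> \<oplus> z) \<in> adic_nbhd A 2"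
  using fps_eval_cong_mod[OF z, of "fps_exp 1" 2] z by (simp add: numeral_2_eq_2)

end


subsection \<open>The deformed central element\<close>

text \<open>The series \<open>(1 - exp (-2 x)) / (2 x)\<close>, with constant term
  \<open>1\<close>.\<close>

definition mfps :: "real fps" where "mfps = Abs_fps (\<lambda>n. (-2) ^ n / fact (Suc n))"

lemma mfps_eq: "fps_const 2 * (fps_X * mfps) = 1 - fps_exp (-2)"
proof (rule fps_ext)
  fix n show "fps_nth (fps_const 2 * (fps_X * mfps)) n = fps_nth (1 - fps_exp (-2)) n"
    by (cases n) (simp_all add: mfps_def field_simps)
qed

text \<open>Both sides become \<open>exp (2 x) - 1\<close> after multiplication by
  \<open>2 x\<close>, which cancels among real series. It is the source of the behaviour of
  \<open>mser\<close> under negation.\<close>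

lemma mfps_reflect: "Abs_fps (\<lambda>n. fps_nth mfps n * (-1) ^ n) = mfps * fps_exp 2" (is "?g = _")
proof -
  have "fps_const 2 * (fps_X * ?g) = fps_exp 2 - 1"
  proof (rule fps_ext)
    fix n show "fps_nth (fps_const 2 * (fps_X * ?g)) n = fps_nth (fps_exp 2 - 1) n"
      by (cases n) (simp_all add: mfps_def field_simps flip: power_mult_distrib)
  qed
  also have "\<dots> = (1 - fps_exp (-2)) * fps_exp 2"
    by (simp add: left_diff_distrib flip: fps_exp_add_mult)
  also have "\<dots> = fps_const 2 * (fps_X * (mfps * fps_exp 2))"
    by (simp add: mult.assoc flip: mfps_eq)
  finally show ?thesis by (simp add: mult_left_cancel)
qed

text \<open>The series \<open>(1 - exp (-2 c2 x)) / (2 c2)\<close>, written without a division because \<open>c2\<close> may be a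
  zero divisor on \<open>A\<close>.\<close>

definition mser :: "(kk, 'a) module \<Rightarrow> 'a \<Rightarrow> 'a" where
  "mser A x = x \<otimes>\<^bsub>A\<^esub> fps_eval A mfps (c2 \<odot>\<^bsub>A\<^esub> x)"

lemma kcoeff_c [simp]: "kcoeff c1 0 0 = 0" "kcoeff c2 0 0 = 0"
  by (simp_all add: kcoeff_def c1_def c2_def)

lemma alg_hom_mser:
  assumes A: "calg A" and B: "calg B" and f: "alg_hom A B f" and x: "x \<in> carrier A"
  shows "f (mser A x) = mser B (f x)"
proof -
  interpret A: calg A by (rule A)
  interpret B: calg B by (rule B)
  have nb: "c2 \<odot>\<^bsub>A\<^esub> x \<in> adic_nbhd A 1" using x by (intro A.smult_nbhd_1) auto
  show ?thesis
    unfolding mser_def using x nb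
    by (simp add: alg_hom_mult[OF f] alg_hom_fps_eval[OF A B f] alg_hom_smult[OF f])
qed

context calg
begin

lemma c2_nbhd [simp]: "x \<in> carrier A \<Longrightarrow> c2 \<odot> x \<in> adic_nbhd A 1"
  by (rule smult_nbhd_1) auto

lemma mser_closed [simp]: "x \<in> carrier A \<Longrightarrow> mser A x \<in> carrier A"
  by (simp add: mser_def)

text \<open>Evaluation of \<open>mfps_eq\<close> at \<open>c2 x\<close>. Where \<open>c2\<close> is
  cancellable, as in the free algebra, this equation characterises the element.\<close>

lemma mser_eq:
  assumes x: "x \<in> carrier A"
  shows "(2 * c2) \<odot> mser A x = \<one> \<ominus> adic_exp A (- 2 * c2) x"
proof -
  have k: "kcoeff (- 2 * c2) 0 0 = 0" by (simp add: kcoeff_mult_00)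
  have "(2 * c2) \<odot> mser A x = kreal 2 \<odot> ((c2 \<odot> x) \<otimes> fps_eval A mfps (c2 \<odot> x))"
    using x by (simp add: mser_def kreal_2 smult_assoc smult_mult_l)
  also have "\<dots> = fps_eval A (fps_const 2 * (fps_X * mfps)) (c2 \<odot> x)"
    by (subst fps_eval_const_mult[OF c2_nbhd[OF x]])
      (simp only: fps_eval_mult[OF c2_nbhd[OF x]] fps_eval_X[OF c2_nbhd[OF x]])
  also have "\<dots> = \<one> \<ominus> ex (kreal (-2) \<odot> (c2 \<odot> x))"
    using x unfolding mfps_eq by (simp add: fps_eval_diff ex_scale del: kreal_simps)
  also have "kreal (-2) \<odot> (c2 \<odot> x) = (- 2 * c2) \<odot> x"
    using x by (simp add: kreal_2 flip: smult_assoc)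
  finally show ?thesis using x k by (simp add: adic_exp_eq)
qed

text \<open>In this form no division by \<open>c2\<close> is left, and the summands are of the kind
  that a Cauchy product with an exponential produces.\<close>

lemma mser_divpow:
  assumes x: "x \<in> carrier A"
  shows "mser A x = asum A (\<lambda>n. (- 2 * c2) ^ n \<odot> divpow A x (Suc n))"
proof -
  have l: "lin A A (\<lambda>y. x \<otimes> y)"
    using x by (auto intro!: linI simp: r_distr smult_mult_r)
  have "mser A x = asum A (\<lambda>n. x \<otimes> (kreal (fps_nth mfps n) \<odot> ((c2 \<odot> x) [^] n)))"
    unfolding mser_def fps_eval_def
    by (rule lin_asum[OF calg_axioms calg_axioms l fps_term_nbhd[OF c2_nbhd[OF x]]])
  also have "(\<lambda>n. x \<otimes> (kreal (fps_nth mfps n) \<odot> ((c2 \<odot> x) [^] n))) =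
      (\<lambda>n. (- 2 * c2) ^ n \<odot> divpow A x (Suc n))"
  proof
    fix n
    have m: "fps_nth mfps n = (-2) ^ n * (1 / fact (Suc n))" by (simp add: mfps_def)
    have "- 2 * c2 = kreal (-2) * c2" by (simp add: kreal_2)
    then have p: "(- 2 * c2) ^ n = kreal ((-2) ^ n) * c2 ^ n" by (simp only: power_mult_distrib kreal_simps(7))
    have "x \<otimes> (kreal (fps_nth mfps n) \<odot> ((c2 \<odot> x) [^] n)) =
        (kreal ((-2) ^ n) * kreal (1 / fact (Suc n)) * c2 ^ n) \<odot> (x \<otimes> x [^] n)"
      unfolding m using x by (simp only: kreal_simps(4) smult_pow smult_mult_r smult_assoc nat_pow_closed smult_closed m_closed)
    also have "\<dots> = ((- 2 * c2) ^ n * kreal (1 / fact (Suc n))) \<odot> (x [^] Suc n)"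
      unfolding p using x by (simp add: mult_ac pow_commute del: kreal_simps)
    also have "\<dots> = (- 2 * c2) ^ n \<odot> divpow A x (Suc n)"
      using x by (simp only: divpow_def smult_assoc nat_pow_closed)
    finally show "x \<otimes> (kreal (fps_nth mfps n) \<odot> ((c2 \<odot> x) [^] n)) = (- 2 * c2) ^ n \<odot> divpow A x (Suc n)" .
  qed
  finally show ?thesis .
qed

text \<open>Put \<open>s = -2 c2\<close> and expand each divided power of \<open>x + y\<close>. The
  summand without \<open>y\<close> contributes \<open>mser\<close> of \<open>x\<close>; all others
  contain some \<open>y\<close>, and together they form the Cauchy product of \<open>mser\<close> of
  \<open>y\<close> with \<open>exp (s x)\<close>.\<close>

lemma mser_add:
  assumes x: "x \<in> carrier A" and y: "y \<in> carrier A" and c: "y \<otimes> x = x \<otimes> y"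
  shows "mser A (x \<oplus> y) = mser A x \<oplus> mser A y \<otimes> ex ((- 2 * c2) \<odot> x)"
proof -
  define s where "s = - 2 * c2"
  note [simp] = x y
  have k: "kcoeff s 0 0 = 0" by (simp add: s_def kcoeff_mult_00)
  then have s: "s \<in> adic_nbhd kalg 1" by (simp add: kalg_nbhd_1_iff)
  have sn: "s ^ n \<odot> v \<in> adic_nbhd A n" if "v \<in> carrier A" for n v
  proof (induction n)
    case (Suc n)
    show ?case using nbhd_scalar[OF s Suc, unfolded plus_1_eq_Suc] that by (simp add: smult_assoc)
  qed (use that in simp)
  have nbx: "s \<odot> x \<in> adic_nbhd A 1" using k by (rule smult_nbhd_1) simp
  have dps: "divpow A (s \<odot> x) n = s ^ n \<odot> divpow A x n" for n
    by (simp add: divpow_def smult_pow smult_comm[of _ "kreal (1 / fact n)"] del: kreal_simps)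
  have m: "mser A y \<otimes> ex (s \<odot> x) = asum A (\<lambda>n. psum A (\<lambda>k. (s ^ k \<odot> divpow A y (Suc k)) \<otimes>
      (s ^ (n - k) \<odot> divpow A x (n - k))) (Suc n))"
    unfolding mser_divpow[OF y, folded s_def] ex_divpow dps by (intro asum_mult sn divpow_closed x y)
  have t: "psum A (\<lambda>k. (s ^ k \<odot> divpow A y (Suc k)) \<otimes> (s ^ (n - k) \<odot> divpow A x (n - k))) (Suc n) =
      s ^ n \<odot> psum A (\<lambda>k. divpow A y (Suc k) \<otimes> divpow A x (n - k)) (Suc n)" for n
  proof -
    have "psum A (\<lambda>k. (s ^ k \<odot> divpow A y (Suc k)) \<otimes> (s ^ (n - k) \<odot> divpow A x (n - k))) (Suc n) =
        psum A (\<lambda>k. s ^ n \<odot> (divpow A y (Suc k) \<otimes> divpow A x (n - k))) (Suc n)"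
    proof (rule psum_cong)
      fix k assume "k < Suc n"
      then have "s ^ k * s ^ (n - k) = s ^ n" by (simp flip: power_add)
      then have "s ^ (n - k) * s ^ k = s ^ n" by (simp add: mult.commute)
      then show "(s ^ k \<odot> divpow A y (Suc k)) \<otimes> (s ^ (n - k) \<odot> divpow A x (n - k)) =
          s ^ n \<odot> (divpow A y (Suc k) \<otimes> divpow A x (n - k))"
        by (simp add: smult_mult_l smult_mult_r flip: smult_assoc)
    qed
    also have "\<dots> = s ^ n \<odot> psum A (\<lambda>k. divpow A y (Suc k) \<otimes> divpow A x (n - k)) (Suc n)"
      by (rule psum_smult[symmetric]) simp
    finally show ?thesis .
  qed
  have d: "divpow A (x \<oplus> y) (Suc n) =
      divpow A x (Suc n) \<oplus> psum A (\<lambda>k. divpow A y (Suc k) \<otimes> divpow A x (n - k)) (Suc n)" for n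
  proof -
    have "divpow A (x \<oplus> y) (Suc n) = psum A (\<lambda>k. divpow A y k \<otimes> divpow A x (Suc n - k)) (Suc (Suc n))"
      using divpow_add[OF y x c, of "Suc n"] by (simp add: a_comm del: psum.simps)
    then show ?thesis by (subst (asm) psum_shift) (simp_all del: psum.simps)
  qed
  have "mser A (x \<oplus> y) = asum A (\<lambda>n. s ^ n \<odot> divpow A x (Suc n) \<oplus>
      s ^ n \<odot> psum A (\<lambda>k. divpow A y (Suc k) \<otimes> divpow A x (n - k)) (Suc n))"
    unfolding mser_divpow[OF a_closed[OF x y], folded s_def] d
    by (simp add: smult_r_distr psum_closed del: psum.simps)
  also have "\<dots> = mser A x \<oplus> mser A y \<otimes> ex (s \<odot> x)"
    unfolding m t mser_divpow[OF x, folded s_def]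
    by (intro asum_add sn psum_closed) simp_all
  finally show ?thesis unfolding s_def .
qed

lemma mser_minus:
  assumes x: "x \<in> carrier A"
  shows "mser A (\<ominus> x) = \<ominus> (mser A x \<otimes> ex ((2 * c2) \<odot> x))"
proof -
  have 1: "c2 \<odot> (\<ominus> x) = kreal (-1) \<odot> (c2 \<odot> x)"
    using x by (simp add: smult_minus_l smult_minus_r)
  have 2: "(2 * c2) \<odot> x = kreal 2 \<odot> (c2 \<odot> x)" using x by (simp add: kreal_2 smult_assoc)
  have 3: "fps_eval A mfps (c2 \<odot> (\<ominus> x)) = fps_eval A mfps (c2 \<odot> x) \<otimes> ex ((2 * c2) \<odot> x)"
    unfolding 1 2 ex_scale[OF c2_nbhd[OF x]]
    by (simp only: fps_eval_scale[OF c2_nbhd[OF x]] mfps_reflect fps_eval_mult[OF c2_nbhd[OF x]])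
  have 4: "(2 * c2) \<odot> x \<in> adic_nbhd A 1"
    using x by (intro smult_nbhd_1) (simp_all add: kcoeff_mult_00)
  show ?thesis
    unfolding mser_def 3 using x 4 by (simp add: l_minus m_assoc)
qed

end


subsection \<open>The square root of the deformation\<close>

text \<open>A root exists among real series because the constant term of \<open>mfps\<close> is
  \<open>1\<close>. It is extracted in one variable, and only later evaluated at
  \<open>c2 M\<close>.\<close>

definition sqrt_mfps :: "real fps" where "sqrt_mfps = fps_radical (\<lambda>k. root k) 2 mfps"

lemma sqrt_mfps: "sqrt_mfps * sqrt_mfps = mfps" "fps_nth sqrt_mfps 0 = 1"
  "sqrt_mfps * inverse sqrt_mfps = 1"
proof -
  have 0: "fps_nth mfps 0 = 1" by (simp add: mfps_def)
  have "sqrt_mfps ^ Suc 1 = mfps"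
    unfolding sqrt_mfps_def
    using power_radical[of mfps "\<lambda>k. root k" 1] 0 by (simp add: numeral_2_eq_2)
  then show "sqrt_mfps * sqrt_mfps = mfps" by (simp add: power2_eq_square)
  show 1: "fps_nth sqrt_mfps 0 = 1"
    unfolding sqrt_mfps_def by (simp add: 0 numeral_2_eq_2)
  show "sqrt_mfps * inverse sqrt_mfps = 1"
    using inverse_mult_eq_1[of sqrt_mfps] 1 by (simp add: mult.commute)
qed


section \<open>The base ring, opposite algebras and maps between tensor products\<close>

lemma psum_kalg: "psum kalg d n = (\<Sum>i<n. d i)"
  by (induction n) simp_all

lemma kcoeff_monom_mult:
  "kcoeff (c1 ^ i * c2 ^ j * t) k l = (if i \<le> k \<and> j \<le> l then kcoeff t (k - i) (l - j) else 0)"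
proof -
  have "kcoeff (c1 ^ i * (c2 ^ j * t)) k l = fps_nth (fps_X ^ i * fps_nth (c2 ^ j * t) l) k"
    by (simp add: kcoeff_def c1_def fps_const_power)
  then show ?thesis
    by (simp add: kcoeff_def c2_def fps_X_power_mult_nth mult.assoc not_le)
qed

lemma kalg_nbhd_iff: "t \<in> adic_nbhd kalg n \<longleftrightarrow> (\<forall>i j. i + j < n \<longrightarrow> kcoeff t i j = 0)"
proof
  interpret K: topalg kalg by (rule topalg_kalg)
  assume "t \<in> adic_nbhd kalg n"
  then show "\<forall>i j. i + j < n \<longrightarrow> kcoeff t i j = 0"
    by (induction rule: K.nbhd_induct) (auto simp: kcoeff_monom_mult)
qed (auto intro: kalg_nbhdI)

lemma kcoeff_eqI: "(\<And>i j. kcoeff s i j = kcoeff t i j) \<Longrightarrow> s = t"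
  by (auto simp: kcoeff_def intro!: fps_ext)

lemma calg_kalg: "calg kalg"
proof (rule calg.intro[OF topalg_kalg], rule calg_axioms.intro)
  interpret K: topalg kalg by (rule topalg_kalg)
  have minus: "x \<ominus>\<^bsub>kalg\<^esub> y = x - y" for x y
    using K.diff_add_cancel[of x y] by (simp add: algebra_simps)
  fix t assume t: "\<And>n. t \<in> adic_nbhd kalg n"
  show "t = \<zero>\<^bsub>kalg\<^esub>"
  proof (simp, rule kcoeff_eqI)
    show "kcoeff t i j = kcoeff 0 i j" for i j
      using t[of "Suc (i + j)"] by (simp add: kalg_nbhd_iff)
  qed
next
  interpret K: topalg kalg by (rule topalg_kalg)
  have minus: "x \<ominus>\<^bsub>kalg\<^esub> y = x - y" for x y
    using K.diff_add_cancel[of x y] by (simp add: algebra_simps)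
  fix d assume "\<And>n. d n \<in> adic_nbhd kalg n"
  then have d: "kcoeff (d n) i j = 0" if "i + j < n" for n i j
    using that by (simp add: kalg_nbhd_iff)
  define s where "s = Abs_fps (\<lambda>j. Abs_fps (\<lambda>i. \<Sum>n\<le>i + j. kcoeff (d n) i j))"
  have "s \<ominus>\<^bsub>kalg\<^esub> psum kalg d n \<in> adic_nbhd kalg n" for n
    unfolding kalg_nbhd_iff
  proof (intro allI impI)
    fix i j assume ij: "i + j < n"
    have "(\<Sum>m<n. kcoeff (d m) i j) = (\<Sum>m\<le>i + j. kcoeff (d m) i j)"
      using ij d by (intro sum.mono_neutral_right) auto
    moreover have "kcoeff s i j = (\<Sum>m\<le>i + j. kcoeff (d m) i j)"
      by (simp add: s_def kcoeff_def)
    ultimately show "kcoeff (s \<ominus>\<^bsub>kalg\<^esub> psum kalg d n) i j = 0"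
      by (simp add: minus psum_kalg kcoeff_sum)
  qed
  then show "\<exists>s\<in>carrier kalg. \<forall>n. s \<ominus>\<^bsub>kalg\<^esub> psum kalg d n \<in> adic_nbhd kalg n"
    by auto
qed

section \<open>Opposite algebras\<close>

definition opp :: "(kk, 'a) module \<Rightarrow> (kk, 'a) module" where
  "opp A = \<lparr>carrier = carrier A, monoid.mult = (\<lambda>x y. y \<otimes>\<^bsub>A\<^esub> x), one = \<one>\<^bsub>A\<^esub>, zero = \<zero>\<^bsub>A\<^esub>,
     add = add A, smult = module.smult A\<rparr>"

lemma opp_simps [simp]:
  "carrier (opp A) = carrier A" "x \<otimes>\<^bsub>opp A\<^esub> y = y \<otimes>\<^bsub>A\<^esub> x" "\<one>\<^bsub>opp A\<^esub> = \<one>\<^bsub>A\<^esub>"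
  "\<zero>\<^bsub>opp A\<^esub> = \<zero>\<^bsub>A\<^esub>" "x \<oplus>\<^bsub>opp A\<^esub> y = x \<oplus>\<^bsub>A\<^esub> y" "t \<odot>\<^bsub>opp A\<^esub> x = t \<odot>\<^bsub>A\<^esub> x"
  by (simp_all add: opp_def)

lemma psum_opp [simp]: "psum (opp A) d n = psum A d n"
  by (induction n) simp_all

context calg
begin

lemma topalg_opp: "topalg (opp A)"
proof -
  have "abelian_group (opp A)"
  proof (rule abelian_groupI)
    show "\<exists>y\<in>carrier (opp A). y \<oplus>\<^bsub>opp A\<^esub> x = \<zero>\<^bsub>opp A\<^esub>" if "x \<in> carrier (opp A)" for x
      using that by (intro bexI[of _ "\<ominus> x"]) (simp_all add: l_neg)
  qed (simp_all add: a_ac)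
  moreover have "Group.monoid (opp A)"
    by (rule monoidI) (simp_all add: m_assoc)
  ultimately have "ring (opp A)"
    by (rule ringI) (simp_all add: l_distr r_distr)
  then show ?thesis
    unfolding topalg_def
    by (intro assoc_alg.intro assoc_alg_axioms.intro)
      (simp_all add: smult_l_distr smult_r_distr smult_assoc smult_mult_l smult_mult_r)
qed

interpretation opp: topalg "opp A" by (rule topalg_opp)

lemma opp_minus: "x \<in> carrier A \<Longrightarrow> \<ominus>\<^bsub>opp A\<^esub> x = \<ominus> x"
  by (rule opp.minus_equality) (simp_all add: l_neg)

lemma opp_diff: "x \<in> carrier A \<Longrightarrow> y \<in> carrier A \<Longrightarrow> x \<ominus>\<^bsub>opp A\<^esub> y = x \<ominus> y"
  by (simp add: opp.minus_eq minus_eq opp_minus)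

lemma nbhd_opp: "adic_nbhd (opp A) n = adic_nbhd A n"
  unfolding adic_nbhd_psum opp.adic_nbhd_psum by (simp del: psum.simps)

lemma calg_opp: "calg (opp A)"
proof (rule calg.intro[OF topalg_opp], rule calg_axioms.intro)
  show "\<exists>s\<in>carrier (opp A). \<forall>n. s \<ominus>\<^bsub>opp A\<^esub> psum (opp A) d n \<in> adic_nbhd (opp A) n"
    if d: "\<And>n. d n \<in> adic_nbhd (opp A) n" for d
  proof -
    have d': "d n \<in> adic_nbhd A n" for n using d by (simp add: nbhd_opp)
    then obtain s where "s \<in> carrier A" "\<forall>n. s \<ominus> psum A d n \<in> adic_nbhd A n"
      using series_convergent by blast
    then show ?thesis
      using nbhd_closed[OF d'] by (intro bexI[of _ s]) (auto simp: nbhd_opp opp_diff psum_closed)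
  qed
qed (auto simp: nbhd_opp intro: separated)

lemma asum_opp:
  assumes d: "\<And>n. d n \<in> adic_nbhd A n" shows "asum (opp A) d = asum A d"
proof (rule calg.asum_eqI[OF calg_opp])
  show "d n \<in> carrier (opp A)" for n using nbhd_closed[OF d] by simp
  show "asum A d \<in> carrier (opp A)" using asum_closed[OF d] by simp
  show "asum A d \<ominus>\<^bsub>opp A\<^esub> psum (opp A) d n \<in> adic_nbhd (opp A) n" for n
    using asum_approx[OF d, of n] nbhd_closed[OF d] asum_closed[OF d]
    by (simp add: nbhd_opp opp_diff psum_closed)
qed

lemma pow_opp: "x \<in> carrier A \<Longrightarrow> x [^]\<^bsub>opp A\<^esub> (n::nat) = x [^] n"
  by (induction n) (simp_all add: pow_commute)

text \<open>The powers of a single element are the same for both orders of multiplication.\<close>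

lemma fps_eval_opp: "z \<in> adic_nbhd A 1 \<Longrightarrow> fps_eval (opp A) p z = fps_eval A p z"
  unfolding fps_eval_def by (simp add: pow_opp asum_opp[OF fps_term_nbhd])

lemma mser_opp:
  assumes x: "x \<in> carrier A" shows "mser (opp A) x = mser A x"
proof -
  have "x \<otimes> fps_eval A mfps (c2 \<odot> x) = fps_eval A mfps (c2 \<odot> x) \<otimes> x"
    using x by (intro fps_eval_commute) (auto simp: smult_mult_l smult_mult_r)
  then show ?thesis using x by (simp add: mser_def fps_eval_opp)
qed

end

section \<open>Homomorphisms into and between tensor products\<close>

context alg_pair
begin

lemma bilin_comp:
  assumes "alg_pair A' B'" "lin A A' f" "lin B B' g"
  shows "bilin A B (ctensor A' B') (\<lambda>a b. tens A' B' (f a) (g b))"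
proof -
  interpret T': alg_pair A' B' by fact
  show ?thesis
    unfolding bilin_def
    using lin_comp[OF assms(2) T'.lin_tens(1)] lin_comp[OF assms(3) T'.lin_tens(2)]
      lin_closed[OF assms(2)] lin_closed[OF assms(3)] by blast
qed

lemma tensor_map_tens:
  assumes "alg_pair A' B'" "lin A A' f" "lin B B' g" "a \<in> carrier A" "b \<in> carrier B"
  shows "tensor_map A B A' B' f g (tens A B a b) = tens A' B' (f a) (g b)"
  unfolding tensor_map_def
  by (rule tensor_lift_tens[OF alg_pair.calg_ctensor[OF assms(1)] bilin_comp[OF assms(1-3)] assms(4,5)])

lemma alg_hom_tensor_map:
  assumes p: "alg_pair A' B'" and f: "alg_hom A A' f" and g: "alg_hom B B' g"
  shows "alg_hom T (ctensor A' B') (tensor_map A B A' B' f g)"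
proof -
  interpret T': alg_pair A' B' by fact
  show ?thesis
    unfolding tensor_map_def
    by (rule alg_hom_tensor_lift[OF T'.calg_ctensor bilin_comp[OF p alg_hom_lin[OF f] alg_hom_lin[OF g]]])
      (auto simp: alg_hom_mult[OF f] alg_hom_mult[OF g] alg_hom_one[OF f] alg_hom_one[OF g]
        alg_hom_closed[OF f] alg_hom_closed[OF g] T'.tens_mult T'.tens_one)
qed

lemma alg_hom_left: "alg_hom A T (\<lambda>a. tens A B a \<one>\<^bsub>B\<^esub>)"
  by (rule alg_homI[OF lin_tens(1)]) (simp_all add: tens_mult tens_one)

lemma alg_hom_right: "alg_hom B T (\<lambda>b. tens A B \<one>\<^bsub>A\<^esub> b)"
  by (rule alg_homI[OF lin_tens(2)]) (simp_all add: tens_mult tens_one)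

lemma tens_left_right:
  "a \<in> carrier A \<Longrightarrow> b \<in> carrier B \<Longrightarrow> tens A B a \<one>\<^bsub>B\<^esub> \<otimes>\<^bsub>T\<^esub> tens A B \<one>\<^bsub>A\<^esub> b = tens A B a b"
  "a \<in> carrier A \<Longrightarrow> b \<in> carrier B \<Longrightarrow> tens A B \<one>\<^bsub>A\<^esub> b \<otimes>\<^bsub>T\<^esub> tens A B a \<one>\<^bsub>B\<^esub> = tens A B a b"
  by (simp_all add: tens_mult)

lemma tens_nbhd_r: "a \<in> carrier A \<Longrightarrow> b \<in> adic_nbhd B n \<Longrightarrow> tens A B a b \<in> adic_nbhd T n"
  by (rule lin_nbhd[OF B.topalg_axioms T.topalg_axioms lin_tens(2)])

lemma tens_nbhd_l: "a \<in> adic_nbhd A n \<Longrightarrow> b \<in> carrier B \<Longrightarrow> tens A B a b \<in> adic_nbhd T n"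
  by (rule lin_nbhd[OF A.topalg_axioms T.topalg_axioms lin_tens(1)])

lemma tensor_flip:
  assumes "alg_pair B A"
  shows "lin T (ctensor B A) (tensor_flip A B)"
    "a \<in> carrier A \<Longrightarrow> b \<in> carrier B \<Longrightarrow> tensor_flip A B (tens A B a b) = tens B A b a"
proof -
  interpret T': alg_pair B A by fact
  have b: "bilin A B (ctensor B A) (\<lambda>a b. tens B A b a)"
    unfolding bilin_def using T'.lin_tens by blast
  show "lin T (ctensor B A) (tensor_flip A B)"
    "a \<in> carrier A \<Longrightarrow> b \<in> carrier B \<Longrightarrow> tensor_flip A B (tens A B a b) = tens B A b a"
    unfolding tensor_flip_def
    using lin_tensor_lift[OF T'.calg_ctensor b] tensor_lift_tens[OF T'.calg_ctensor b] by auto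
qed

end

section \<open>The associativity map of threefold tensor products\<close>

locale alg_triple = AB: alg_pair A B + BC: alg_pair B C
  for A :: "(kk, 'a) module" and B :: "(kk, 'b) module" and C :: "(kk, 'c) module"
begin

sublocale L: alg_pair "ctensor A B" C ..
sublocale R: alg_pair A "ctensor B C" ..

lemma bilin_assoc_inner:
  assumes "c \<in> carrier C"
  shows "bilin A B R.T (\<lambda>a b. tens A BC.T a (tens B C b c))"
  unfolding bilin_def using assms
  by (auto intro!: R.lin_tens(1) lin_comp[OF BC.lin_tens(1) R.lin_tens(2)])

abbreviation "inner c \<equiv> tensor_lift A B R.T (\<lambda>a b. tens A BC.T a (tens B C b c))"

lemma lin_inner: "c \<in> carrier C \<Longrightarrow> lin AB.T R.T (inner c)"
  by (rule AB.lin_tensor_lift[OF R.calg_ctensor bilin_assoc_inner])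

lemma inner_tens:
  "a \<in> carrier A \<Longrightarrow> b \<in> carrier B \<Longrightarrow> c \<in> carrier C \<Longrightarrow>
    inner c (tens A B a b) = tens A BC.T a (tens B C b c)"
  by (rule AB.tensor_lift_tens[OF R.calg_ctensor bilin_assoc_inner])

text \<open>Linearity in \<open>u\<close> is built into the lift. Linearity in \<open>c\<close> is
  an identity between maps that are linear in \<open>u\<close>, so it suffices to check it on pure
  tensors.\<close>

lemma bilin_inner: "bilin AB.T C R.T (\<lambda>u c. inner c u)"
  unfolding bilin_def
proof (intro conjI ballI)
  show "lin AB.T R.T (inner c)" if "c \<in> carrier C" for c
    using that by (rule lin_inner)
  fix u assume u: "u \<in> carrier AB.T"
  show "lin C R.T (\<lambda>c. inner c u)"
  proof (rule linI)
    show "inner c u \<in> carrier R.T" if "c \<in> carrier C" for c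
      using lin_closed[OF lin_inner[OF that] u] .
    show "inner (c \<oplus>\<^bsub>C\<^esub> c') u = inner c u \<oplus>\<^bsub>R.T\<^esub> inner c' u"
      if c: "c \<in> carrier C" and c': "c' \<in> carrier C" for c c'
    proof (rule AB.tensor_lin_eqI[OF R.calg_ctensor lin_inner _ _ u])
      show "lin AB.T R.T (\<lambda>u. inner c u \<oplus>\<^bsub>R.T\<^esub> inner c' u)"
        using lin_inner[OF c] lin_inner[OF c']
        by (auto intro!: linI simp: lin_add[OF lin_inner[OF c]] lin_add[OF lin_inner[OF c']]
            lin_smult[OF lin_inner[OF c]] lin_smult[OF lin_inner[OF c']]
            lin_closed[OF lin_inner[OF c]] lin_closed[OF lin_inner[OF c']] R.T.a_ac R.T.smult_r_distr)
    qed (use c c' in \<open>auto simp: inner_tens lin_add[OF BC.lin_tens(2)] lin_add[OF R.lin_tens(2)]\<close>)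
    show "inner (t \<odot>\<^bsub>C\<^esub> c) u = t \<odot>\<^bsub>R.T\<^esub> inner c u" if c: "c \<in> carrier C" for c t
    proof (rule AB.tensor_lin_eqI[OF R.calg_ctensor lin_inner _ _ u])
      show "lin AB.T R.T (\<lambda>u. t \<odot>\<^bsub>R.T\<^esub> inner c u)"
        by (auto intro!: linI simp: lin_add[OF lin_inner[OF c]] lin_smult[OF lin_inner[OF c]]
            lin_closed[OF lin_inner[OF c]] R.T.smult_r_distr R.T.smult_comm[of _ t])
    qed (use c in \<open>auto simp: inner_tens lin_smult[OF BC.lin_tens(2)] lin_smult[OF R.lin_tens(2)]\<close>)
  qed
qed

lemma inner_mult:
  assumes c: "c \<in> carrier C" and c': "c' \<in> carrier C" and u: "u \<in> carrier AB.T" and v: "v \<in> carrier AB.T"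
  shows "inner (c \<otimes>\<^bsub>C\<^esub> c') (u \<otimes>\<^bsub>AB.T\<^esub> v) = inner c u \<otimes>\<^bsub>R.T\<^esub> inner c' v"
proof -
  note l = lin_inner[OF c] and l' = lin_inner[OF c']
  have cc: "c \<otimes>\<^bsub>C\<^esub> c' \<in> carrier C" using c c' by simp
  have r1: "lin AB.T R.T (\<lambda>u. inner c u \<otimes>\<^bsub>R.T\<^esub> inner c' v)"
    if "v \<in> carrier AB.T" for v
    using that by (auto intro!: linI simp: lin_add[OF l] lin_smult[OF l] lin_closed[OF l] lin_closed[OF l']
        R.T.l_distr R.T.smult_mult_l)
  have r2: "lin AB.T R.T (\<lambda>v. inner c u \<otimes>\<^bsub>R.T\<^esub> inner c' v)"
    if "u \<in> carrier AB.T" for u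
    using that by (auto intro!: linI simp: lin_add[OF l'] lin_smult[OF l'] lin_closed[OF l] lin_closed[OF l']
        R.T.r_distr R.T.smult_mult_r)
  have 1: "inner (c \<otimes>\<^bsub>C\<^esub> c') (tens A B a b \<otimes>\<^bsub>AB.T\<^esub> v) = inner c (tens A B a b) \<otimes>\<^bsub>R.T\<^esub> inner c' v"
    if "a \<in> carrier A" "b \<in> carrier B" for a b
    by (rule AB.tensor_lin_eqI[OF R.calg_ctensor AB.lin_mult_T(2)[OF lin_inner[OF cc]] r2 _ v])
      (use that c c' in \<open>auto simp: AB.tens_mult BC.tens_mult R.tens_mult inner_tens\<close>)
  show ?thesis
    by (rule AB.tensor_lin_eqI[OF R.calg_ctensor AB.lin_mult_T(1)[OF lin_inner[OF cc] v] r1[OF v] 1 u])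
qed

lemma alg_hom_tensor_assoc: "alg_hom L.T R.T (tensor_assoc A B C)"
  unfolding tensor_assoc_def
  by (rule L.alg_hom_tensor_lift[OF R.calg_ctensor bilin_inner])
    (simp_all add: inner_mult inner_tens BC.tens_one R.tens_one flip: AB.tens_one)

lemma tensor_assoc_tens:
  "a \<in> carrier A \<Longrightarrow> b \<in> carrier B \<Longrightarrow> c \<in> carrier C \<Longrightarrow>
    tensor_assoc A B C (tens AB.T C (tens A B a b) c) = tens A BC.T a (tens B C b c)"
  unfolding tensor_assoc_def
  by (simp add: L.tensor_lift_tens[OF R.calg_ctensor bilin_inner] inner_tens)

end


section \<open>The quantum Schroedinger algebra\<close>

lemma monoid_words: "Group.monoid words"
  by (rule monoidI) auto

interpretation W: real_alg "monalg words"
  by (rule real_alg_monalg[OF monoid_words])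

lemma letter_closed [simp]: "letter x \<in> carrier qfree"
  unfolding letter_def by (rule cmon_closed[OF monoid_words]) simp

lemma cmon_Cons: "cmon (x # xs) = letter x \<otimes>\<^bsub>qfree\<^esub> cmon xs"
  unfolding letter_def using cmon_mult[OF monoid_words, of "[x]" xs] by simp

text \<open>On power series \<open>c2\<close> merely shifts the second index, and \<open>2\<close>
  is invertible. This makes the description in \<open>qM\<close> unique.\<close>

lemma qfree_2c2_cancel:
  assumes q: "q \<in> carrier qfree" "q' \<in> carrier qfree"
    and eq: "(2 * c2) \<odot>\<^bsub>qfree\<^esub> q = (2 * c2) \<odot>\<^bsub>qfree\<^esub> q'"
  shows "q = q'"
proof -
  have "c2 \<odot>\<^bsub>qfree\<^esub> q = c2 \<odot>\<^bsub>qfree\<^esub> q'"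
  proof (rule W.pser.kreal_cancel[of _ _ 2])
    show "kreal 2 \<odot>\<^bsub>qfree\<^esub> (c2 \<odot>\<^bsub>qfree\<^esub> q) = kreal 2 \<odot>\<^bsub>qfree\<^esub> (c2 \<odot>\<^bsub>qfree\<^esub> q')"
      using q eq by (simp add: kreal_2 W.pser.smult_assoc)
  qed (use q in auto)
  then have "(c2 \<odot>\<^bsub>qfree\<^esub> q) i (Suc j) = (c2 \<odot>\<^bsub>qfree\<^esub> q') i (Suc j)" for i j by simp
  then show ?thesis
    unfolding W.pser_c2[OF q(1)] W.pser_c2[OF q(2)] by (intro ext) simp
qed

lemma qM_eq: "qM = mser qfree (letter bM)"
  unfolding qM_def
proof (rule the_equality)
  have eq: "(2 * c2) \<odot>\<^bsub>qfree\<^esub> mser qfree (letter bM) =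
      \<one>\<^bsub>qfree\<^esub> \<ominus>\<^bsub>qfree\<^esub> adic_exp qfree (- 2 * c2) (letter bM)"
    by (rule W.pser.mser_eq[OF letter_closed])
  show "mser qfree (letter bM) \<in> carrier qfree \<and>
    (2 * c2) \<odot>\<^bsub>qfree\<^esub> mser qfree (letter bM) =
      \<one>\<^bsub>qfree\<^esub> \<ominus>\<^bsub>qfree\<^esub> adic_exp qfree (- 2 * c2) (letter bM)"
    by (rule conjI[OF _ eq]) simp
  fix q assume q: "q \<in> carrier qfree \<and> (2 * c2) \<odot>\<^bsub>qfree\<^esub> q =
      \<one>\<^bsub>qfree\<^esub> \<ominus>\<^bsub>qfree\<^esub> adic_exp qfree (- 2 * c2) (letter bM)"
  show "q = mser qfree (letter bM)"
    by (rule qfree_2c2_cancel[OF conjunct1[OF q] _ trans[OF conjunct2[OF q] eq[symmetric]]]) simp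
qed

definition comm :: "('k, 'a) module \<Rightarrow> 'a \<Rightarrow> 'a \<Rightarrow> 'a" where
  "comm A x y = x \<otimes>\<^bsub>A\<^esub> y \<ominus>\<^bsub>A\<^esub> y \<otimes>\<^bsub>A\<^esub> x"

lemma alg_hom_comm:
  assumes "assoc_alg A" "assoc_alg B" "alg_hom A B f" "x \<in> carrier A" "y \<in> carrier A"
  shows "f (comm A x y) = comm B (f x) (f y)"
proof -
  interpret A: assoc_alg A by fact
  show ?thesis
    using assms(4,5)
    by (simp add: comm_def lin_diff[OF assms(1,2) alg_hom_lin[OF assms(3)]] alg_hom_mult[OF assms(3)])
qed

text \<open>The element \<open>(x, y, r, z)\<close> stands for the relation \<open>[x, y] = r z\<close>; for vanishing brackets
  \<open>z\<close> is arbitrary. Only the relation for \<open>[K, P]\<close> is not of this form.\<close>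

definition lin_rels :: "(schr \<times> schr \<times> real \<times> schr) set" where
  "lin_rels = {(bD, bP, -1, bP), (bD, bK, 1, bK), (bD, bH, -2, bH), (bD, bC, 2, bC), (bH, bC, 1, bD),
     (bK, bH, 1, bP), (bK, bC, 0, bM), (bP, bC, -1, bK), (bP, bH, 0, bM)} \<union> {(bM, x, 0, bM) | x. True}"

text \<open>The data of a homomorphism from \<open>schr_q\<close> to a complete algebra
  \<open>B\<close>. The bracket of \<open>K\<close> and \<open>P\<close> is expressed by
  \<open>mser\<close>, since a quotient by \<open>2 c2\<close> need not be determined in
  \<open>B\<close>.\<close>

definition schr_rep :: "(kk, 'a) module \<Rightarrow> (schr \<Rightarrow> 'a) \<Rightarrow> bool" where
  "schr_rep B X \<longleftrightarrow> (\<forall>x. X x \<in> carrier B) \<and>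
     (\<forall>(x, y, r, z)\<in>lin_rels. comm B (X x) (X y) = kreal r \<odot>\<^bsub>B\<^esub> X z) \<and>
     comm B (X bK) (X bP) = mser B (X bM)"

lemma schr_repD:
  "schr_rep B X \<Longrightarrow> X x \<in> carrier B"
  "schr_rep B X \<Longrightarrow> (x, y, r, z) \<in> lin_rels \<Longrightarrow> comm B (X x) (X y) = kreal r \<odot>\<^bsub>B\<^esub> X z"
  "schr_rep B X \<Longrightarrow> comm B (X bK) (X bP) = mser B (X bM)"
  by (auto simp: schr_rep_def)

definition q_rels :: "(nat \<Rightarrow> nat \<Rightarrow> (schr list \<Rightarrow>\<^sub>0 real)) set" where
  "q_rels = {comm_rel x y (kreal r \<odot>\<^bsub>qfree\<^esub> letter z) | x y r z. (x, y, r, z) \<in> lin_rels} \<union>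
     {comm_rel bK bP qM}"

lemma comm_rel_eq: "comm_rel x y z = comm qfree (letter x) (letter y) \<ominus>\<^bsub>qfree\<^esub> z"
  by (simp add: comm_rel_def comm_def)

lemma q_ideal_eq: "q_ideal = closed_ideal qfree q_rels"
proof -
  have 0: "kreal 0 \<odot>\<^bsub>qfree\<^esub> letter x = \<zero>\<^bsub>qfree\<^esub>" and 1: "kreal 1 \<odot>\<^bsub>qfree\<^esub> letter x = letter x" for x
    by simp_all
  let ?f = "\<lambda>(x, y, r, z). comm_rel x y (kreal r \<odot>\<^bsub>qfree\<^esub> letter z)"
  have "{comm_rel x y (kreal r \<odot>\<^bsub>qfree\<^esub> letter z) | x y r z. (x, y, r, z) \<in> lin_rels} = ?f ` lin_rels"
    by force
  moreover have "?f ` {(bM, x, 0, bM) | x. True} = {comm_rel bM x (kreal 0 \<odot>\<^bsub>qfree\<^esub> letter bM) | x. True}"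
    by force
  ultimately show ?thesis
    unfolding q_ideal_def q_rels_def lin_rels_def image_Un image_insert image_empty prod.case 0 1
    by (intro arg_cong[of _ _ "closed_ideal qfree"]) (simp only: insert_commute Un_insert_left Un_insert_right Un_empty_right Un_empty_left)
qed

lemma qM_closed: "qM \<in> carrier qfree"
  unfolding qM_eq by simp

lemma comm_rel_closed: "z \<in> carrier qfree \<Longrightarrow> comm_rel x y z \<in> carrier qfree"
  by (simp add: comm_rel_def)

lemma q_rels_closed: "q_rels \<subseteq> carrier qfree"
  by (auto simp: q_rels_def intro!: comm_rel_closed qM_closed)

lemma ideal_q: "ideal q_ideal qfree"
  unfolding q_ideal_eq by (rule W.pser.ideal_closed_ideal[OF q_rels_closed])

section \<open>The quotient and its universal property\<close>

interpretation Q: calg schr_q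
  unfolding schr_q_def q_ideal_eq
  by (intro W.pser.calg_closed_quot W.pser.calg_axioms W.pser.ideal_closed_ideal
      W.pser.closed_ideal_closed q_rels_closed)

definition qpr :: "(nat \<Rightarrow> nat \<Rightarrow> (schr list \<Rightarrow>\<^sub>0 real)) \<Rightarrow> (nat \<Rightarrow> nat \<Rightarrow> (schr list \<Rightarrow>\<^sub>0 real)) set" where
  "qpr x = q_ideal +>\<^bsub>qfree\<^esub> x"

lemma alg_hom_qpr: "alg_hom qfree schr_q qpr"
  unfolding qpr_def[abs_def] schr_q_def by (rule W.pser.alg_hom_rcos[OF ideal_q])

lemma qpr_surj: "qpr ` carrier qfree = carrier schr_q"
  unfolding qpr_def[abs_def] schr_q_def by (simp add: W.pser.quot_alg_simps(1)[OF ideal_q])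

lemma qpr_eq_zero_iff: "x \<in> carrier qfree \<Longrightarrow> qpr x = \<zero>\<^bsub>schr_q\<^esub> \<longleftrightarrow> x \<in> q_ideal"
  unfolding qpr_def schr_q_def by (rule W.pser.rcos_eq_zero_iff[OF ideal_q])

lemma qgen_qpr: "qgen x = qpr (letter x)"
  by (simp add: qgen_def qpr_def)

lemma qgen_closed [simp]: "qgen x \<in> carrier schr_q"
  unfolding qgen_qpr by (intro alg_hom_closed[OF alg_hom_qpr] letter_closed)

lemma alg_hom_comm_rel:
  assumes B: "assoc_alg B" and f: "alg_hom qfree B f" and z: "z \<in> carrier qfree"
  shows "f (comm_rel x y z) = \<zero>\<^bsub>B\<^esub> \<longleftrightarrow> comm B (f (letter x)) (f (letter y)) = f z"
proof -
  interpret B: assoc_alg B by fact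
  have c: "comm qfree (letter x) (letter y) \<in> carrier qfree" by (simp add: comm_def)
  show ?thesis
    using z c unfolding comm_rel_eq
    by (simp add: lin_diff[OF W.pser.assoc_alg_axioms B alg_hom_lin[OF f]]
        alg_hom_closed[OF f] B.eq_diff_zero flip: alg_hom_comm[OF W.pser.assoc_alg_axioms B f])
qed

text \<open>Homomorphisms commute with \<open>mser\<close>, so the image of \<open>qM\<close> is
  \<open>mser\<close> of the image of \<open>M\<close>; this carries the relators over to
  \<open>B\<close>.\<close>

lemma schr_rep_iff:
  assumes B: "calg B" and f: "alg_hom qfree B f"
  shows "schr_rep B (\<lambda>x. f (letter x)) \<longleftrightarrow> (\<forall>r\<in>q_rels. f r = \<zero>\<^bsub>B\<^esub>)"
proof -
  interpret B: calg B by fact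
  have "(\<forall>r\<in>q_rels. f r = \<zero>\<^bsub>B\<^esub>) \<longleftrightarrow>
      (\<forall>(x, y, r, z)\<in>lin_rels. f (comm_rel x y (kreal r \<odot>\<^bsub>qfree\<^esub> letter z)) = \<zero>\<^bsub>B\<^esub>) \<and>
      f (comm_rel bK bP qM) = \<zero>\<^bsub>B\<^esub>"
    unfolding q_rels_def by blast
  then show ?thesis
    by (simp add: schr_rep_def alg_hom_comm_rel[OF B.assoc_alg_axioms f] qM_closed
        alg_hom_smult[OF f] alg_hom_closed[OF f] qM_eq alg_hom_mser[OF W.pser.calg_axioms B f])
qed

lemma schr_rep_q: "schr_rep schr_q qgen"
proof -
  have "schr_rep schr_q (\<lambda>x. qpr (letter x))"
    unfolding schr_rep_iff[OF Q.calg_axioms alg_hom_qpr]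
  proof
    fix r assume r: "r \<in> q_rels"
    then have "r \<in> q_ideal" "r \<in> carrier qfree"
      using W.pser.closed_ideal_superset[OF q_rels_closed] q_rels_closed by (auto simp: q_ideal_eq)
    then show "qpr r = \<zero>\<^bsub>schr_q\<^esub>" by (simp add: qpr_eq_zero_iff)
  qed
  then show ?thesis by (simp add: qgen_qpr[abs_def])
qed

lemma qfree_extend:
  assumes B: "calg B" and X: "\<And>x. X x \<in> carrier B"
  obtains f where "alg_hom qfree B f" "\<And>x. f (letter x) = X x"
proof -
  interpret B: calg B by fact
  define h where "h = foldr (\<lambda>x u. X x \<otimes>\<^bsub>B\<^esub> u)"
  have h: "h xs \<one>\<^bsub>B\<^esub> \<in> carrier B" for xs by (induction xs) (simp_all add: h_def X)
  have app: "h (xs @ ys) \<one>\<^bsub>B\<^esub> = h xs \<one>\<^bsub>B\<^esub> \<otimes>\<^bsub>B\<^esub> h ys \<one>\<^bsub>B\<^esub>" for xs ys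
  proof (induction xs)
    case Nil
    then show ?case using h[of ys] by (simp add: h_def)
  next
    case (Cons x xs)
    then show ?case using h[of xs] h[of ys] X by (simp add: h_def B.m_assoc)
  qed
  obtain f where f: "alg_hom qfree B f" "\<And>w. w \<in> carrier words \<Longrightarrow> f (cmon w) = h w \<one>\<^bsub>B\<^esub>"
    by (rule cmonalg_extend_hom[OF monoid_words B, of "\<lambda>w. h w \<one>\<^bsub>B\<^esub>"]) (simp_all add: h app, simp add: h_def)
  show ?thesis
    by (rule that[OF f(1)]) (simp add: letter_def f(2) h_def X)
qed

theorem schr_q_extend:
  assumes B: "calg B" and X: "schr_rep B X"
  obtains F where "alg_hom schr_q B F" "\<And>x. F (qgen x) = X x"
proof -
  interpret B: calg B by fact
  obtain f where f: "alg_hom qfree B f" "\<And>x. f (letter x) = X x"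
    by (rule qfree_extend[OF B, of X, OF schr_repD(1)[OF X]]) (rule that)
  have "schr_rep B (\<lambda>x. f (letter x))" using X by (simp add: f(2))
  then have r: "\<And>r. r \<in> q_rels \<Longrightarrow> f r = \<zero>\<^bsub>B\<^esub>" using schr_rep_iff[OF B f(1)] by simp
  have k: "f x = \<zero>\<^bsub>B\<^esub>" if "x \<in> carrier qfree" "qpr x = \<zero>\<^bsub>schr_q\<^esub>" for x
    by (rule alg_hom_vanishes_on_closed_ideal[OF W.pser.topalg_axioms B f(1) q_rels_closed r])
      (use that in \<open>simp_all add: qpr_eq_zero_iff q_ideal_eq\<close>)
  obtain F where F: "alg_hom schr_q B F" "\<And>x. x \<in> carrier qfree \<Longrightarrow> F (qpr x) = f x"
    by (rule alg_hom_factor[OF alg_hom_qpr qpr_surj f(1) k W.pser.assoc_alg_axioms Q.assoc_alg_axioms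
          B.assoc_alg_axioms]) auto
  show ?thesis
    by (rule that[OF F(1)]) (simp add: qgen_qpr F(2) f(2))
qed

text \<open>Words span a dense subspace, so an induction along left multiplication by generators
  suffices. It is kept at the level of linear maps because centrality of \<open>M\<close> and the
  antipode axioms involve maps that are not multiplicative.\<close>

lemma schr_q_lin_eqI:
  assumes B: "calg B" and F: "lin schr_q B F" and G: "lin schr_q B G"
    and one: "F \<one>q = G \<one>q"
    and step: "\<And>x u. u \<in> carrier schr_q \<Longrightarrow> F u = G u \<Longrightarrow> F (qgen x \<otimes>\<^bsub>schr_q\<^esub> u) = G (qgen x \<otimes>\<^bsub>schr_q\<^esub> u)"
    and u: "u \<in> carrier schr_q"
  shows "F u = G u"
proof -
  have cw: "cmon w \<in> carrier qfree" for w by (rule cmon_closed[OF monoid_words]) simp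
  have w: "F (qpr (cmon w)) = G (qpr (cmon w))" for w
  proof (induction w)
    case Nil
    have "qpr (cmon []) = \<one>q"
      using cmon_one[OF monoid_words] alg_hom_one[OF alg_hom_qpr] by simp
    then show ?case using one by simp
  next
    case (Cons x w)
    have "qpr (cmon (x # w)) = qgen x \<otimes>\<^bsub>schr_q\<^esub> qpr (cmon w)"
      unfolding cmon_Cons qgen_qpr by (rule alg_hom_mult[OF alg_hom_qpr letter_closed cw])
    then show ?case
      using step[OF alg_hom_closed[OF alg_hom_qpr cw] Cons] by simp
  qed
  have "u \<in> qpr ` carrier qfree" using u qpr_surj by simp
  then obtain x where x: "x \<in> carrier qfree" "u = qpr x" by auto
  have l: "lin qfree schr_q qpr" by (rule alg_hom_lin[OF alg_hom_qpr])
  have "F (qpr x) = G (qpr x)"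
    by (rule cmonalg_lin_eqI[OF monoid_words B lin_comp[OF l F] lin_comp[OF l G] w x(1)])
  with x show ?thesis by simp
qed

lemma schr_q_hom_eqI:
  assumes B: "calg B" and F: "alg_hom schr_q B F" and G: "alg_hom schr_q B G"
    and eq: "\<And>x. F (qgen x) = G (qgen x)" and u: "u \<in> carrier schr_q"
  shows "F u = G u"
  by (rule schr_q_lin_eqI[OF B alg_hom_lin[OF F] alg_hom_lin[OF G] _ _ u])
    (simp_all add: alg_hom_one[OF F] alg_hom_one[OF G] alg_hom_mult[OF F] alg_hom_mult[OF G] eq)


subsection \<open>The structure maps\<close>

text \<open>The exponents in the coproduct, and at the same time the eigenvalues in
  \<open>\<delta>(X) = w X \<wedge> M\<close>.\<close>

fun qweight :: "schr \<Rightarrow> kk" where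
  "qweight bP = c1 - c2"
| "qweight bK = - (c1 + c2)"
| "qweight bH = 2 * c1"
| "qweight bC = - 2 * c1"
| "qweight _ = 0"

lemma qweight_00: "kcoeff (qweight x) 0 0 = 0"
  by (cases x) (simp_all add: kcoeff_mult_00)

text \<open>This is what makes the linear relations compatible with the coproduct and the antipode.
  The first alternative covers vanishing brackets, where \<open>z\<close> has no meaning.
  \<open>[K, P]\<close> is outside \<open>lin_rels\<close>: its weights add up to
  \<open>- 2 * c2\<close>, but \<open>M\<close> has weight zero.\<close>

lemma qweight_rel: "(x, y, r, z) \<in> lin_rels \<Longrightarrow> r = 0 \<or> qweight z = qweight x + qweight y"
  by (auto simp: lin_rels_def)

abbreviation "M \<equiv> qgen bM"

definition qe :: "kk \<Rightarrow> (nat \<Rightarrow> nat \<Rightarrow> (schr list \<Rightarrow>\<^sub>0 real)) set" where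
  "qe t = Q.ex (t \<odot>\<^bsub>schr_q\<^esub> M)"

text \<open>The relations give commutation with the generators; induction over words and continuity
  extend it to the completed algebra.\<close>

lemma M_central: "u \<in> carrier schr_q \<Longrightarrow> M \<otimes>\<^bsub>schr_q\<^esub> u = u \<otimes>\<^bsub>schr_q\<^esub> M"
proof (rule schr_q_lin_eqI[OF Q.calg_axioms, where F = "\<lambda>u. M \<otimes>\<^bsub>schr_q\<^esub> u" and G = "\<lambda>u. u \<otimes>\<^bsub>schr_q\<^esub> M"])
  show "lin schr_q schr_q (\<lambda>u. M \<otimes>\<^bsub>schr_q\<^esub> u)" "lin schr_q schr_q (\<lambda>u. u \<otimes>\<^bsub>schr_q\<^esub> M)"
    by (auto intro!: linI simp: Q.l_distr Q.r_distr Q.smult_mult_l Q.smult_mult_r)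
  fix x u assume u: "u \<in> carrier schr_q" "M \<otimes>\<^bsub>schr_q\<^esub> u = u \<otimes>\<^bsub>schr_q\<^esub> M"
  have "comm schr_q M (qgen x) = kreal 0 \<odot>\<^bsub>schr_q\<^esub> M"
    by (rule schr_repD(2)[OF schr_rep_q]) (auto simp: lin_rels_def)
  then have c: "M \<otimes>\<^bsub>schr_q\<^esub> qgen x = qgen x \<otimes>\<^bsub>schr_q\<^esub> M"
    by (simp add: comm_def Q.eq_diff_zero)
  have "M \<otimes>\<^bsub>schr_q\<^esub> (qgen x \<otimes>\<^bsub>schr_q\<^esub> u) = (qgen x \<otimes>\<^bsub>schr_q\<^esub> M) \<otimes>\<^bsub>schr_q\<^esub> u"
    using u by (simp add: c flip: Q.m_assoc)
  then show "M \<otimes>\<^bsub>schr_q\<^esub> (qgen x \<otimes>\<^bsub>schr_q\<^esub> u) = qgen x \<otimes>\<^bsub>schr_q\<^esub> u \<otimes>\<^bsub>schr_q\<^esub> M"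
    using u by (simp add: Q.m_assoc)
qed simp_all

lemma tM_nbhd: "kcoeff t 0 0 = 0 \<Longrightarrow> t \<odot>\<^bsub>schr_q\<^esub> M \<in> adic_nbhd schr_q 1"
  by (rule Q.smult_nbhd_1) simp_all

lemma fps_eval_central:
  assumes "kcoeff t 0 0 = 0" "u \<in> carrier schr_q"
  shows "u \<otimes>\<^bsub>schr_q\<^esub> fps_eval schr_q p (t \<odot>\<^bsub>schr_q\<^esub> M) = fps_eval schr_q p (t \<odot>\<^bsub>schr_q\<^esub> M) \<otimes>\<^bsub>schr_q\<^esub> u"
  using assms M_central[OF assms(2)]
  by (intro Q.fps_eval_commute tM_nbhd) (simp_all add: Q.smult_mult_l Q.smult_mult_r)

lemma qexp_eq: "kcoeff t 0 0 = 0 \<Longrightarrow> qexp t = qe t"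
  unfolding qe_def by (rule Q.adic_exp_eq) simp_all

lemma
  assumes "kcoeff t 0 0 = 0"
  shows qe_closed: "qe t \<in> carrier schr_q"
    and qe_central: "u \<in> carrier schr_q \<Longrightarrow> u \<otimes>\<^bsub>schr_q\<^esub> qe t = qe t \<otimes>\<^bsub>schr_q\<^esub> u"
  unfolding qe_def using tM_nbhd[OF assms] fps_eval_central[OF assms] by auto

lemma qe_0: "qe 0 = \<one>q"
  by (simp add: qe_def)

lemma qe_add:
  assumes "kcoeff s 0 0 = 0" "kcoeff t 0 0 = 0" shows "qe s \<otimes>\<^bsub>schr_q\<^esub> qe t = qe (s + t)"
  unfolding qe_def using assms tM_nbhd
  by (simp add: Q.smult_l_distr Q.ex_add Q.smult_mult_l Q.smult_mult_r Q.smult_comm)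

section \<open>Images of the generators under coproduct, counit and antipode\<close>

interpretation QQ: alg_pair schr_q schr_q ..

abbreviation "TT \<equiv> ctensor schr_q schr_q"

definition Delta_gen where
  "Delta_gen x = \<one>q \<otimes>q qgen x \<oplus>q qgen x \<otimes>q qe (qweight x)"

text \<open>As the exponentials are central, both products contain the same mixed terms
  \<open>y \<otimes> x exp (t M) + x \<otimes> y exp (s M)\<close>, which cancel in the commutator.
  The remaining second part carries the sum of the exponents.\<close>

lemma comm_primitive:
  assumes [simp]: "x \<in> carrier schr_q" "y \<in> carrier schr_q" and s: "kcoeff s 0 0 = 0" and t: "kcoeff t 0 0 = 0"
  shows "comm TT (\<one>q \<otimes>q x \<oplus>q x \<otimes>q qe s) (\<one>q \<otimes>q y \<oplus>q y \<otimes>q qe t) =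
    \<one>q \<otimes>q comm schr_q x y \<oplus>q comm schr_q x y \<otimes>q qe (s + t)"
proof -
  note [simp] = qe_closed[OF s] qe_closed[OF t]
  have st: "kcoeff (s + t) 0 0 = 0" using s t by simp
  note [simp] = qe_closed[OF st]
  have p: "(\<one>q \<otimes>q x \<oplus>q x \<otimes>q qe s) \<otimes>\<^bsub>TT\<^esub> (\<one>q \<otimes>q y \<oplus>q y \<otimes>q qe t) =
      (\<one>q \<otimes>q (x \<otimes>\<^bsub>schr_q\<^esub> y) \<oplus>q (x \<otimes>\<^bsub>schr_q\<^esub> y) \<otimes>q qe (s + t)) \<oplus>q
      (y \<otimes>q (x \<otimes>\<^bsub>schr_q\<^esub> qe t) \<oplus>q x \<otimes>q (y \<otimes>\<^bsub>schr_q\<^esub> qe s))"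
    if [simp]: "x \<in> carrier schr_q" "y \<in> carrier schr_q" and s: "kcoeff s 0 0 = 0" and t: "kcoeff t 0 0 = 0"
    for x y s t
  proof -
    have st: "kcoeff (s + t) 0 0 = 0" using s t by simp
    note [simp] = qe_closed[OF s] qe_closed[OF t] qe_closed[OF st]
    show ?thesis
      by (simp add: QQ.T.l_distr QQ.T.r_distr QQ.tens_mult qe_add[OF s t] QQ.T.a_ac
          flip: qe_central[OF s])
  qed
  let ?d = "x \<otimes>\<^bsub>schr_q\<^esub> y" and ?d' = "y \<otimes>\<^bsub>schr_q\<^esub> x"
  let ?r = "y \<otimes>q (x \<otimes>\<^bsub>schr_q\<^esub> qe t) \<oplus>q x \<otimes>q (y \<otimes>\<^bsub>schr_q\<^esub> qe s)"
  have "comm TT (\<one>q \<otimes>q x \<oplus>q x \<otimes>q qe s) (\<one>q \<otimes>q y \<oplus>q y \<otimes>q qe t) =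
      ((\<one>q \<otimes>q ?d \<oplus>q ?d \<otimes>q qe (s + t)) \<oplus>q ?r) \<ominus>\<^bsub>TT\<^esub> ((\<one>q \<otimes>q ?d' \<oplus>q ?d' \<otimes>q qe (s + t)) \<oplus>q ?r)"
    unfolding comm_def p[OF assms(1,2) s t] p[OF assms(2,1) t s]
    by (simp add: add.commute[of t s] QQ.T.a_comm[of "x \<otimes>q (y \<otimes>\<^bsub>schr_q\<^esub> qe s)"])
  also have "\<dots> = (\<one>q \<otimes>q ?d \<ominus>\<^bsub>TT\<^esub> \<one>q \<otimes>q ?d') \<oplus>q (?d \<otimes>q qe (s + t) \<ominus>\<^bsub>TT\<^esub> ?d' \<otimes>q qe (s + t))"
    by (simp add: QQ.T.add_diff_add QQ.T.eq_diff_zero[THEN iffD2])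
  also have "\<dots> = \<one>q \<otimes>q comm schr_q x y \<oplus>q comm schr_q x y \<otimes>q qe (s + t)"
    unfolding comm_def
    by (simp add: lin_diff[OF Q.assoc_alg_axioms QQ.T.assoc_alg_axioms QQ.lin_tens(1)]
        lin_diff[OF Q.assoc_alg_axioms QQ.T.assoc_alg_axioms QQ.lin_tens(2)])
  finally show ?thesis .
qed

lemma schr_rep_Delta: "schr_rep TT Delta_gen"
  unfolding schr_rep_def
proof (intro conjI allI ballI)
  note [simp] = qe_closed[OF qweight_00]
  show cl: "Delta_gen x \<in> carrier TT" for x by (simp add: Delta_gen_def)
  have cc: "comm TT (Delta_gen x) (Delta_gen y) =
      \<one>q \<otimes>q comm schr_q (qgen x) (qgen y) \<oplus>q comm schr_q (qgen x) (qgen y) \<otimes>q qe (qweight x + qweight y)" for x y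
    unfolding Delta_gen_def by (intro comm_primitive qweight_00) simp_all
  have "comm TT (Delta_gen x) (Delta_gen y) = kreal r \<odot>\<^bsub>TT\<^esub> Delta_gen z" if "(x, y, r, z) \<in> lin_rels" for x y r z
  proof -
    have k: "kcoeff (qweight x + qweight y) 0 0 = 0" by (simp add: qweight_00)
    have E: "comm TT (Delta_gen x) (Delta_gen y) =
        kreal r \<odot>\<^bsub>TT\<^esub> (\<one>q \<otimes>q qgen z \<oplus>q qgen z \<otimes>q qe (qweight x + qweight y))"
      unfolding cc schr_repD(2)[OF schr_rep_q that] using qe_closed[OF k]
      by (simp add: lin_smult[OF QQ.lin_tens(1)] lin_smult[OF QQ.lin_tens(2)] QQ.T.smult_r_distr)
    from qweight_rel[OF that] show ?thesis
    proof
      assume "r = 0"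
      then show ?thesis unfolding E using qe_closed[OF k] cl by simp
    next
      assume w: "qweight z = qweight x + qweight y"
      show ?thesis unfolding E unfolding Delta_gen_def[of z] w by (rule refl)
    qed
  qed
  then show "case p of (x, y, r, z) \<Rightarrow> comm TT (Delta_gen x) (Delta_gen y) = kreal r \<odot>\<^bsub>TT\<^esub> Delta_gen z"
    if "p \<in> lin_rels" for p
    using that by auto
  show "comm TT (Delta_gen bK) (Delta_gen bP) = mser TT (Delta_gen bM)"
  proof -
    have k: "kcoeff (- 2 * c2) 0 0 = 0" by (simp add: kcoeff_mult_00)
    have w: "qweight bK + qweight bP = - 2 * c2" by simp
    have e: "QQ.T.ex ((- 2 * c2) \<odot>\<^bsub>TT\<^esub> (\<one>q \<otimes>q M)) = \<one>q \<otimes>q qe (- 2 * c2)"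
      unfolding qe_def using tM_nbhd[OF k]
      by (simp only: alg_hom_fps_eval[OF Q.calg_axioms QQ.T.calg_axioms QQ.alg_hom_right]
          alg_hom_smult[OF QQ.alg_hom_right] qgen_closed)
    \<comment> \<open>The addition rule for \<open>mser\<close>, applied to the commuting elements
      \<open>x = 1 \<otimes> M\<close> and \<open>y = M \<otimes> 1\<close>, yields exactly the
      factor \<open>exp (-2 c2 M)\<close> demanded by the weights of \<open>K\<close> and
      \<open>P\<close>.\<close>
    have "mser TT (Delta_gen bM) = mser TT (\<one>q \<otimes>q M \<oplus>q M \<otimes>q \<one>q)"
      by (simp add: Delta_gen_def qe_0)
    also have "\<dots> = mser TT (\<one>q \<otimes>q M) \<oplus>q mser TT (M \<otimes>q \<one>q) \<otimes>\<^bsub>TT\<^esub> (\<one>q \<otimes>q qe (- 2 * c2))"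
      unfolding e[symmetric] by (rule QQ.T.mser_add) (simp_all add: QQ.tens_mult)
    also have "mser TT (\<one>q \<otimes>q M) = \<one>q \<otimes>q mser schr_q M"
      by (rule alg_hom_mser[OF Q.calg_axioms QQ.T.calg_axioms QQ.alg_hom_right, symmetric]) simp
    also have "mser TT (M \<otimes>q \<one>q) = mser schr_q M \<otimes>q \<one>q"
      by (rule alg_hom_mser[OF Q.calg_axioms QQ.T.calg_axioms QQ.alg_hom_left, symmetric]) simp
    also have "(mser schr_q M \<otimes>q \<one>q) \<otimes>\<^bsub>TT\<^esub> (\<one>q \<otimes>q qe (- 2 * c2)) = mser schr_q M \<otimes>q qe (- 2 * c2)"
      using qe_closed[OF k] by (simp add: QQ.tens_left_right)
    finally show ?thesis
      unfolding cc w schr_repD(3)[OF schr_rep_q] by (rule sym)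
  qed
qed

lemma schr_rep_eps: "schr_rep kalg (\<lambda>_. 0)"
proof -
  interpret K: calg kalg by (rule calg_kalg)
  have "comm kalg 0 0 = 0" using K.r_neg[of 0] by (simp add: comm_def K.minus_eq)
  then show ?thesis by (simp add: schr_rep_def mser_def)
qed

text \<open>Forced by the antipode axiom on a generator, which reads
  \<open>X + S(X) exp (w M) = 0\<close>.\<close>

definition S_gen where
  "S_gen x = \<ominus>\<^bsub>schr_q\<^esub> (qgen x \<otimes>\<^bsub>schr_q\<^esub> qe (- qweight x))"

text \<open>The two signs cancel in a product, and the reversed multiplication restores one sign in
  the commutator; the central exponentials multiply to the negative sum of the weights. For
  \<open>[K, P]\<close> the resulting factor \<open>exp (2 c2 M)\<close> is the one in
  \<open>mser_minus\<close>.\<close>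

lemma schr_rep_S: "schr_rep (opp schr_q) S_gen"
  unfolding schr_rep_def
proof (intro conjI allI ballI)
  have k: "kcoeff (- qweight x) 0 0 = 0" for x by (simp add: qweight_00)
  note [simp] = qe_closed[OF k]
  show cl: "S_gen x \<in> carrier (opp schr_q)" for x by (simp add: S_gen_def)
  have cc: "comm (opp schr_q) (S_gen x) (S_gen y) =
      \<ominus>\<^bsub>schr_q\<^esub> (comm schr_q (qgen x) (qgen y) \<otimes>\<^bsub>schr_q\<^esub> qe (- qweight x + - qweight y))" for x y
  proof -
    have kxy: "kcoeff (- qweight x + - qweight y) 0 0 = 0" by (simp add: qweight_00)
    have p: "S_gen y \<otimes>\<^bsub>schr_q\<^esub> S_gen x =
        (qgen y \<otimes>\<^bsub>schr_q\<^esub> qgen x) \<otimes>\<^bsub>schr_q\<^esub> qe (- qweight x + - qweight y)" for x y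
    proof -
      have "S_gen y \<otimes>\<^bsub>schr_q\<^esub> S_gen x =
          (qgen y \<otimes>\<^bsub>schr_q\<^esub> qe (- qweight y)) \<otimes>\<^bsub>schr_q\<^esub> (qgen x \<otimes>\<^bsub>schr_q\<^esub> qe (- qweight x))"
        by (simp add: S_gen_def Q.l_minus Q.r_minus)
      also have "\<dots> = qgen y \<otimes>\<^bsub>schr_q\<^esub> (qe (- qweight y) \<otimes>\<^bsub>schr_q\<^esub> qgen x) \<otimes>\<^bsub>schr_q\<^esub> qe (- qweight x)"
        by (simp add: Q.m_assoc)
      also have "\<dots> = (qgen y \<otimes>\<^bsub>schr_q\<^esub> qgen x) \<otimes>\<^bsub>schr_q\<^esub> (qe (- qweight y) \<otimes>\<^bsub>schr_q\<^esub> qe (- qweight x))"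
        unfolding qe_central[OF k qgen_closed, symmetric] by (simp add: Q.m_assoc)
      finally show ?thesis by (simp only: qe_add[OF k k] add.commute)
    qed
    have "comm (opp schr_q) (S_gen x) (S_gen y) = S_gen y \<otimes>\<^bsub>schr_q\<^esub> S_gen x \<ominus>\<^bsub>schr_q\<^esub> S_gen x \<otimes>\<^bsub>schr_q\<^esub> S_gen y"
      by (simp add: comm_def S_gen_def Q.opp_diff)
    also have "\<dots> = (qgen y \<otimes>\<^bsub>schr_q\<^esub> qgen x \<ominus>\<^bsub>schr_q\<^esub> qgen x \<otimes>\<^bsub>schr_q\<^esub> qgen y) \<otimes>\<^bsub>schr_q\<^esub> qe (- qweight x + - qweight y)"
      unfolding p using qe_closed[OF kxy] by (simp only: Q.diff_mult_l add.commute[of "- qweight y"] Q.m_closed qgen_closed)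
    also have "qgen y \<otimes>\<^bsub>schr_q\<^esub> qgen x \<ominus>\<^bsub>schr_q\<^esub> qgen x \<otimes>\<^bsub>schr_q\<^esub> qgen y = \<ominus>\<^bsub>schr_q\<^esub> comm schr_q (qgen x) (qgen y)"
      by (simp add: comm_def Q.minus_eq Q.minus_add Q.a_comm)
    also have "(\<ominus>\<^bsub>schr_q\<^esub> comm schr_q (qgen x) (qgen y)) \<otimes>\<^bsub>schr_q\<^esub> qe (- qweight x + - qweight y) =
        \<ominus>\<^bsub>schr_q\<^esub> (comm schr_q (qgen x) (qgen y) \<otimes>\<^bsub>schr_q\<^esub> qe (- qweight x + - qweight y))"
      using qe_closed[OF kxy] by (intro Q.l_minus) (simp_all add: comm_def)
    finally show ?thesis .
  qed
  have "comm (opp schr_q) (S_gen x) (S_gen y) = kreal r \<odot>\<^bsub>opp schr_q\<^esub> S_gen z" if "(x, y, r, z) \<in> lin_rels" for x y r z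
  proof -
    have kxy: "kcoeff (- qweight x + - qweight y) 0 0 = 0" by (simp add: qweight_00)
    have E: "comm (opp schr_q) (S_gen x) (S_gen y) =
        kreal r \<odot>\<^bsub>schr_q\<^esub> (\<ominus>\<^bsub>schr_q\<^esub> (qgen z \<otimes>\<^bsub>schr_q\<^esub> qe (- qweight x + - qweight y)))"
      unfolding cc schr_repD(2)[OF schr_rep_q that] using qe_closed[OF kxy]
      by (simp add: Q.smult_mult_l Q.smult_minus_r)
    from qweight_rel[OF that] show ?thesis
    proof
      assume "r = 0"
      then show ?thesis unfolding E using qe_closed[OF kxy] cl by simp
    next
      assume w: "qweight z = qweight x + qweight y"
      have "- qweight x + - qweight y = - qweight z" by (simp add: w)
      then show ?thesis unfolding E by (simp add: S_gen_def[of z])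
    qed
  qed
  then show "case p of (x, y, r, z) \<Rightarrow> comm (opp schr_q) (S_gen x) (S_gen y) = kreal r \<odot>\<^bsub>opp schr_q\<^esub> S_gen z"
    if "p \<in> lin_rels" for p
    using that by auto
  have "mser (opp schr_q) (S_gen bM) = mser schr_q (\<ominus>\<^bsub>schr_q\<^esub> M)"
    by (simp add: S_gen_def qe_0 Q.mser_opp)
  also have "\<dots> = \<ominus>\<^bsub>schr_q\<^esub> (mser schr_q M \<otimes>\<^bsub>schr_q\<^esub> qe (2 * c2))"
    unfolding qe_def by (rule Q.mser_minus) simp
  also have "2 * c2 = - qweight bK + - qweight bP" by simp
  finally show "comm (opp schr_q) (S_gen bK) (S_gen bP) = mser (opp schr_q) (S_gen bM)"
    unfolding cc schr_repD(3)[OF schr_rep_q] by (rule sym)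
qed


interpretation QQQ: alg_triple schr_q schr_q schr_q ..

lemma alg_hom_qe:
  assumes B: "calg B" and F: "alg_hom schr_q B F" and t: "kcoeff t 0 0 = 0"
  shows "F (qe t) = fps_eval B (fps_exp 1) (t \<odot>\<^bsub>B\<^esub> F M)"
  unfolding qe_def
  by (simp add: alg_hom_fps_eval[OF Q.calg_axioms B F tM_nbhd[OF t]] alg_hom_smult[OF F])

lemma UNIV_schr: "UNIV = {bD, bH, bP, bK, bC, bM}"
  using schr.exhaust by blast

text \<open>A finite check over the basis; it shows that the exponents of the coproduct are dictated
  by \<open>schr_r\<close>.\<close>

lemma cocommutator_schr: "cocommutator schr_r x a b = qweight x * wedge x bM a b"
  unfolding cocommutator_def UNIV_schr
  by (cases x; cases a; cases b)
    (simp_all add: schr_r_def wedge_def schr_bracket_def kreal_2)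

section \<open>The Hopf algebra axioms\<close>

context
  fixes \<Delta> \<epsilon> S
  assumes \<Delta>: "alg_hom schr_q TT \<Delta>" "\<And>x. \<Delta> (qgen x) = Delta_gen x"
    and \<epsilon>: "alg_hom schr_q kalg \<epsilon>" "\<And>x. \<epsilon> (qgen x) = 0"
    and S: "alg_hom schr_q (opp schr_q) S" "\<And>x. S (qgen x) = S_gen x"
begin

text \<open>\<open>\<Delta>(M)\<close> is a sum of two commuting elements, so its exponential
  factorises. Being group-like, the exponentials reproduce themselves in coassociativity.\<close>

lemma Delta_qe:
  assumes t: "kcoeff t 0 0 = 0" shows "\<Delta> (qe t) = qe t \<otimes>q qe t"
proof -
  have e1: "QQ.T.ex (t \<odot>\<^bsub>TT\<^esub> (\<one>q \<otimes>q M)) = \<one>q \<otimes>q qe t"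
    by (rule alg_hom_qe[OF QQ.T.calg_axioms QQ.alg_hom_right t, symmetric])
  have e2: "QQ.T.ex (t \<odot>\<^bsub>TT\<^esub> (M \<otimes>q \<one>q)) = qe t \<otimes>q \<one>q"
    by (rule alg_hom_qe[OF QQ.T.calg_axioms QQ.alg_hom_left t, symmetric])
  have "\<Delta> (qe t) = QQ.T.ex (t \<odot>\<^bsub>TT\<^esub> (\<one>q \<otimes>q M) \<oplus>q t \<odot>\<^bsub>TT\<^esub> (M \<otimes>q \<one>q))"
    by (simp add: alg_hom_qe[OF QQ.T.calg_axioms \<Delta>(1) t] \<Delta>(2) Delta_gen_def qe_0 QQ.T.smult_r_distr)
  also have "\<dots> = (\<one>q \<otimes>q qe t) \<otimes>\<^bsub>TT\<^esub> (qe t \<otimes>q \<one>q)"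
    unfolding e1[symmetric] e2[symmetric]
    by (rule QQ.T.ex_add) (simp_all add: QQ.T.smult_nbhd_1 t QQ.T.smult_mult_l QQ.T.smult_mult_r
        QQ.tens_mult QQ.T.smult_comm)
  also have "\<dots> = qe t \<otimes>q qe t"
    using qe_closed[OF t] by (simp add: QQ.tens_left_right)
  finally show ?thesis .
qed

lemma eps_qe:
  assumes t: "kcoeff t 0 0 = 0" shows "\<epsilon> (qe t) = 1"
proof -
  interpret K: calg kalg by (rule calg_kalg)
  show ?thesis using K.ex_zero by (simp add: alg_hom_qe[OF calg_kalg \<epsilon>(1) t] \<epsilon>(2))
qed

lemma S_qe:
  assumes t: "kcoeff t 0 0 = 0" shows "S (qe t) = qe (- t)"
proof -
  have SM: "S M = \<ominus>\<^bsub>schr_q\<^esub> M" by (simp add: S(2) S_gen_def qe_0)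
  have nb: "t \<odot>\<^bsub>schr_q\<^esub> \<ominus>\<^bsub>schr_q\<^esub> M \<in> adic_nbhd schr_q 1"
    by (rule Q.smult_nbhd_1[OF t]) simp
  have "S (qe t) = Q.ex (t \<odot>\<^bsub>schr_q\<^esub> \<ominus>\<^bsub>schr_q\<^esub> M)"
    using alg_hom_qe[OF Q.calg_opp S(1) t] by (simp add: SM Q.fps_eval_opp[OF nb])
  then show ?thesis by (simp add: qe_def Q.smult_minus_l Q.smult_minus_r)
qed

lemmas q_closed = qe_closed[OF qweight_00]

text \<open>With \<open>g = exp (w M)\<close>, both sides send a generator to \<open>1 \<otimes> 1
  \<otimes> X + 1 \<otimes> X \<otimes> g + X \<otimes> g \<otimes> g\<close>.\<close>

lemma coassoc:
  assumes u: "u \<in> carrier schr_q"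
  shows "tensor_assoc schr_q schr_q schr_q (tensor_map schr_q schr_q TT schr_q \<Delta> (\<lambda>a. a) (\<Delta> u)) =
    tensor_map schr_q schr_q schr_q TT (\<lambda>a. a) \<Delta> (\<Delta> u)"
proof (rule schr_q_hom_eqI[OF QQQ.R.calg_ctensor _ _ _ u])
  let ?L = "tensor_map schr_q schr_q TT schr_q \<Delta> (\<lambda>a. a)"
  let ?R = "tensor_map schr_q schr_q schr_q TT (\<lambda>a. a) \<Delta>"
  let ?a = "tensor_assoc schr_q schr_q schr_q"
  have L: "alg_hom TT QQQ.L.T ?L"
    by (rule QQ.alg_hom_tensor_map[OF QQQ.L.alg_pair_axioms \<Delta>(1) alg_hom_id])
  have R: "alg_hom TT QQQ.R.T ?R"
    by (rule QQ.alg_hom_tensor_map[OF QQQ.R.alg_pair_axioms alg_hom_id \<Delta>(1)])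
  have Lt: "?L (a \<otimes>q b) = tens TT schr_q (\<Delta> a) b" if "a \<in> carrier schr_q" "b \<in> carrier schr_q" for a b
    by (rule QQ.tensor_map_tens[OF QQQ.L.alg_pair_axioms alg_hom_lin[OF \<Delta>(1)] lin_id that])
  have Rt: "?R (a \<otimes>q b) = tens schr_q TT a (\<Delta> b)" if "a \<in> carrier schr_q" "b \<in> carrier schr_q" for a b
    by (rule QQ.tensor_map_tens[OF QQQ.R.alg_pair_axioms lin_id alg_hom_lin[OF \<Delta>(1)] that])
  note as = QQQ.alg_hom_tensor_assoc
  show "alg_hom schr_q QQQ.R.T (\<lambda>u. ?a (?L (\<Delta> u)))"
    by (rule alg_hom_comp[OF alg_hom_comp[OF \<Delta>(1) L] as])
  show "alg_hom schr_q QQQ.R.T (\<lambda>u. ?R (\<Delta> u))"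
    by (rule alg_hom_comp[OF \<Delta>(1) R])
  fix x
  let ?g = "qe (qweight x)"
  note [simp] = q_closed[of x]
  have d1: "\<Delta> \<one>q = \<one>q \<otimes>q \<one>q" by (simp add: alg_hom_one[OF \<Delta>(1)] QQ.tens_one)
  have dx: "\<Delta> (qgen x) = \<one>q \<otimes>q qgen x \<oplus>q qgen x \<otimes>q ?g" by (simp add: \<Delta>(2) Delta_gen_def)
  have "?L (\<Delta> (qgen x)) = tens TT schr_q (\<one>q \<otimes>q \<one>q) (qgen x) \<oplus>\<^bsub>QQQ.L.T\<^esub>
      (tens TT schr_q (\<one>q \<otimes>q qgen x) ?g \<oplus>\<^bsub>QQQ.L.T\<^esub> tens TT schr_q (qgen x \<otimes>q ?g) ?g)"
    by (simp add: dx alg_hom_add[OF L] Lt d1 lin_add[OF QQQ.L.lin_tens(1)])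
  then have l: "?a (?L (\<Delta> (qgen x))) = tens schr_q TT \<one>q (\<one>q \<otimes>q qgen x) \<oplus>\<^bsub>QQQ.R.T\<^esub>
      (tens schr_q TT \<one>q (qgen x \<otimes>q ?g) \<oplus>\<^bsub>QQQ.R.T\<^esub> tens schr_q TT (qgen x) (?g \<otimes>q ?g))"
    by (simp add: alg_hom_add[OF as] QQQ.tensor_assoc_tens)
  have "?R (\<Delta> (qgen x)) = tens schr_q TT \<one>q (\<Delta> (qgen x)) \<oplus>\<^bsub>QQQ.R.T\<^esub> tens schr_q TT (qgen x) (?g \<otimes>q ?g)"
    by (simp add: dx alg_hom_add[OF R] Rt Delta_qe[OF qweight_00])
  then show "?a (?L (\<Delta> (qgen x))) = ?R (\<Delta> (qgen x))"
    unfolding l by (simp add: dx lin_add[OF QQQ.R.lin_tens(2)] QQQ.R.T.a_assoc)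
qed

text \<open>The contractions are multiplicative because \<open>\<epsilon>\<close> takes scalar
  values. On a generator only one summand survives, as \<open>\<epsilon>(X) = 0\<close> and
  \<open>\<epsilon>(exp (w M)) = 1\<close>.\<close>

lemma counit:
  assumes u: "u \<in> carrier schr_q"
  shows "tensor_lift schr_q schr_q schr_q (\<lambda>a b. \<epsilon> a \<odot>\<^bsub>schr_q\<^esub> b) (\<Delta> u) = u"
    and "tensor_lift schr_q schr_q schr_q (\<lambda>a b. \<epsilon> b \<odot>\<^bsub>schr_q\<^esub> a) (\<Delta> u) = u"
proof -
  note e = alg_hom_add[OF \<epsilon>(1), simplified] alg_hom_smult[OF \<epsilon>(1), simplified]
    alg_hom_mult[OF \<epsilon>(1), simplified] alg_hom_one[OF \<epsilon>(1), simplified]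
  have b1: "bilin schr_q schr_q schr_q (\<lambda>a b. \<epsilon> a \<odot>\<^bsub>schr_q\<^esub> b)"
    unfolding bilin_def
    by (auto intro!: linI simp: e Q.smult_l_distr Q.smult_r_distr Q.smult_assoc Q.smult_comm)
  have b2: "bilin schr_q schr_q schr_q (\<lambda>a b. \<epsilon> b \<odot>\<^bsub>schr_q\<^esub> a)"
    unfolding bilin_def
    by (auto intro!: linI simp: e Q.smult_l_distr Q.smult_r_distr Q.smult_assoc Q.smult_comm)
  have h1: "alg_hom TT schr_q (tensor_lift schr_q schr_q schr_q (\<lambda>a b. \<epsilon> a \<odot>\<^bsub>schr_q\<^esub> b))"
    by (rule QQ.alg_hom_tensor_lift[OF Q.calg_axioms b1])
      (simp_all add: e Q.smult_mult_l Q.smult_mult_r Q.smult_assoc Q.smult_comm)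
  have h2: "alg_hom TT schr_q (tensor_lift schr_q schr_q schr_q (\<lambda>a b. \<epsilon> b \<odot>\<^bsub>schr_q\<^esub> a))"
    by (rule QQ.alg_hom_tensor_lift[OF Q.calg_axioms b2])
      (simp_all add: e Q.smult_mult_l Q.smult_mult_r Q.smult_assoc Q.smult_comm)
  note t = QQ.tensor_lift_tens[OF Q.calg_axioms b1] QQ.tensor_lift_tens[OF Q.calg_axioms b2]
  note [simp] = q_closed
  show "tensor_lift schr_q schr_q schr_q (\<lambda>a b. \<epsilon> a \<odot>\<^bsub>schr_q\<^esub> b) (\<Delta> u) = u"
    by (rule schr_q_hom_eqI[OF Q.calg_axioms alg_hom_comp[OF \<Delta>(1) h1] alg_hom_id _ u])
      (simp add: \<Delta>(2) Delta_gen_def alg_hom_add[OF h1] t e \<epsilon>(2))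
  show "tensor_lift schr_q schr_q schr_q (\<lambda>a b. \<epsilon> b \<odot>\<^bsub>schr_q\<^esub> a) (\<Delta> u) = u"
    by (rule schr_q_hom_eqI[OF Q.calg_axioms alg_hom_comp[OF \<Delta>(1) h2] alg_hom_id _ u])
      (simp add: \<Delta>(2) Delta_gen_def alg_hom_add[OF h2] t e \<epsilon>(2) eps_qe[OF qweight_00])
qed

lemma lin_S: "lin schr_q schr_q S"
  using alg_hom_lin[OF S(1)] by (simp add: lin_def)

lemmas S_simps = alg_hom_mult[OF S(1), simplified] alg_hom_one[OF S(1), simplified]
  lin_closed[OF lin_S] lin_add[OF lin_S] lin_smult[OF lin_S]

text \<open>The antipode axioms only have to be checked on generators: \<open>S\<close> being antimultiplicative,
  the map \<open>a \<otimes> b \<mapsto> S a b\<close> sends \<open>z (a \<otimes> b)\<close> to the image of \<open>z\<close>, multiplied by \<open>S a\<close> on the left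
  and by \<open>b\<close> on the right.\<close>

lemma antipode:
  assumes u: "u \<in> carrier schr_q"
  shows "tensor_lift schr_q schr_q schr_q (\<lambda>a b. S a \<otimes>\<^bsub>schr_q\<^esub> b) (\<Delta> u) = \<epsilon> u \<odot>\<^bsub>schr_q\<^esub> \<one>q" (is "?l (\<Delta> u) = _")
    and "tensor_lift schr_q schr_q schr_q (\<lambda>a b. a \<otimes>\<^bsub>schr_q\<^esub> S b) (\<Delta> u) = \<epsilon> u \<odot>\<^bsub>schr_q\<^esub> \<one>q" (is "?r (\<Delta> u) = _")
proof -
  have b1: "bilin schr_q schr_q schr_q (\<lambda>a b. S a \<otimes>\<^bsub>schr_q\<^esub> b)"
    unfolding bilin_def
    by (auto intro!: linI simp: S_simps Q.l_distr Q.r_distr Q.smult_mult_l Q.smult_mult_r)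
  have b2: "bilin schr_q schr_q schr_q (\<lambda>a b. a \<otimes>\<^bsub>schr_q\<^esub> S b)"
    unfolding bilin_def
    by (auto intro!: linI simp: S_simps Q.l_distr Q.r_distr Q.smult_mult_l Q.smult_mult_r)
  note l = QQ.lin_tensor_lift[OF Q.calg_axioms b1] and r = QQ.lin_tensor_lift[OF Q.calg_axioms b2]
  note lt = QQ.tensor_lift_tens[OF Q.calg_axioms b1] and rt = QQ.tensor_lift_tens[OF Q.calg_axioms b2]
  note [simp] = q_closed
  have eps_lin: "lin schr_q schr_q (\<lambda>u. \<epsilon> u \<odot>\<^bsub>schr_q\<^esub> \<one>q)"
    using alg_hom_add[OF \<epsilon>(1)] alg_hom_smult[OF \<epsilon>(1)]
    by (auto intro!: linI simp: Q.smult_l_distr Q.smult_assoc)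
  have e1: "\<epsilon> \<one>q = 1" using alg_hom_one[OF \<epsilon>(1)] by simp
  have ex: "\<epsilon> (qgen x \<otimes>\<^bsub>schr_q\<^esub> u) = 0" if "u \<in> carrier schr_q" for x u
    using that alg_hom_mult[OF \<epsilon>(1)] \<epsilon>(2) by simp
  have dc: "\<Delta> u \<in> carrier TT" if "u \<in> carrier schr_q" for u using that by (rule alg_hom_closed[OF \<Delta>(1)])
  have dx: "\<Delta> (qgen x) = \<one>q \<otimes>q qgen x \<oplus>q qgen x \<otimes>q qe (qweight x)" for x
    by (simp add: \<Delta>(2) Delta_gen_def)
  have d1: "\<Delta> \<one>q = \<one>q \<otimes>q \<one>q" by (simp add: alg_hom_one[OF \<Delta>(1)] QQ.tens_one)
  have w: "kcoeff (- qweight x) 0 0 = 0" for x by (simp add: qweight_00)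
  note [simp] = qe_closed[OF w]
  have inv: "qe (- qweight x) \<otimes>\<^bsub>schr_q\<^esub> qe (qweight x) = \<one>q" for x
    by (simp add: qe_add[OF w qweight_00] qe_0)
  have SX: "S (qgen x) \<otimes>\<^bsub>schr_q\<^esub> qe (qweight x) = \<ominus>\<^bsub>schr_q\<^esub> qgen x" for x
    by (simp add: S(2) S_gen_def Q.l_minus Q.m_assoc inv)
  show "?l (\<Delta> u) = \<epsilon> u \<odot>\<^bsub>schr_q\<^esub> \<one>q"
  proof (rule schr_q_lin_eqI[OF Q.calg_axioms lin_comp[OF alg_hom_lin[OF \<Delta>(1)] l] eps_lin _ _ u])
    show "?l (\<Delta> \<one>q) = \<epsilon> \<one>q \<odot>\<^bsub>schr_q\<^esub> \<one>q"
      by (simp add: d1 lt e1 S_simps)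
    fix x u assume u: "u \<in> carrier schr_q"
    \<comment> \<open>No induction hypothesis is needed on this side: \<open>X b\<close> and
      \<open>S(X) exp (w M) b\<close> cancel between \<open>S a\<close> and whatever follows, so the
      image vanishes for every second factor.\<close>
    have "?l (\<Delta> (qgen x) \<otimes>\<^bsub>TT\<^esub> \<Delta> u) = \<zero>\<^bsub>schr_q\<^esub>"
    proof (rule QQ.tensor_lin_eqI[OF Q.calg_axioms QQ.lin_mult_T(2)[OF l dc[OF qgen_closed]] _ _ dc[OF u]])
      show "lin TT schr_q (\<lambda>u. \<zero>\<^bsub>schr_q\<^esub>)" by (rule linI) simp_all
      fix a b assume [simp]: "a \<in> carrier schr_q" "b \<in> carrier schr_q"
      have "?l (\<Delta> (qgen x) \<otimes>\<^bsub>TT\<^esub> (a \<otimes>q b)) =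
          S a \<otimes>\<^bsub>schr_q\<^esub> (qgen x \<otimes>\<^bsub>schr_q\<^esub> b) \<oplus>\<^bsub>schr_q\<^esub>
          S a \<otimes>\<^bsub>schr_q\<^esub> ((S (qgen x) \<otimes>\<^bsub>schr_q\<^esub> qe (qweight x)) \<otimes>\<^bsub>schr_q\<^esub> b)"
        by (simp add: dx QQ.T.l_distr QQ.tens_mult lin_add[OF l] lt S_simps Q.m_assoc)
      also have "\<dots> = \<zero>\<^bsub>schr_q\<^esub>"
        unfolding SX by (simp add: Q.l_minus Q.r_minus Q.r_neg S_simps)
      finally show "?l (\<Delta> (qgen x) \<otimes>\<^bsub>TT\<^esub> (a \<otimes>q b)) = \<zero>\<^bsub>schr_q\<^esub>" .
    qed
    then show "?l (\<Delta> (qgen x \<otimes>\<^bsub>schr_q\<^esub> u)) = \<epsilon> (qgen x \<otimes>\<^bsub>schr_q\<^esub> u) \<odot>\<^bsub>schr_q\<^esub> \<one>q"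
      using u by (simp add: alg_hom_mult[OF \<Delta>(1)] ex)
  qed
  show "?r (\<Delta> u) = \<epsilon> u \<odot>\<^bsub>schr_q\<^esub> \<one>q"
  proof (rule schr_q_lin_eqI[OF Q.calg_axioms lin_comp[OF alg_hom_lin[OF \<Delta>(1)] r] eps_lin _ _ u])
    show "?r (\<Delta> \<one>q) = \<epsilon> \<one>q \<odot>\<^bsub>schr_q\<^esub> \<one>q"
      by (simp add: d1 rt e1 S_simps)
    fix x u assume u: "u \<in> carrier schr_q" and IH: "?r (\<Delta> u) = \<epsilon> u \<odot>\<^bsub>schr_q\<^esub> \<one>q"
    have SXc: "S (qgen x) \<in> carrier schr_q" by (simp add: S_simps)
    \<comment> \<open>Here \<open>S(X)\<close> ends up on the outer right:
      \<open>a \<otimes> b\<close> gives \<open>a S(b) S(X) + X a S(b) exp (- w M)\<close>. Only the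
      induction hypothesis turns the inner part into a scalar, and then
      \<open>S(X) + X exp (- w M) = 0\<close> applies.\<close>
    have "?r (\<Delta> (qgen x) \<otimes>\<^bsub>TT\<^esub> \<Delta> u) =
        ?r (\<Delta> u) \<otimes>\<^bsub>schr_q\<^esub> S (qgen x) \<oplus>\<^bsub>schr_q\<^esub>
        qgen x \<otimes>\<^bsub>schr_q\<^esub> ?r (\<Delta> u) \<otimes>\<^bsub>schr_q\<^esub> qe (- qweight x)"
    proof (rule QQ.tensor_lin_eqI[OF Q.calg_axioms QQ.lin_mult_T(2)[OF r dc[OF qgen_closed]] _ _ dc[OF u]])
      show "lin TT schr_q (\<lambda>z. ?r z \<otimes>\<^bsub>schr_q\<^esub> S (qgen x) \<oplus>\<^bsub>schr_q\<^esub>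
          qgen x \<otimes>\<^bsub>schr_q\<^esub> ?r z \<otimes>\<^bsub>schr_q\<^esub> qe (- qweight x))"
        by (rule linI) (simp_all add: lin_closed[OF r] lin_add[OF r] lin_smult[OF r] SXc
            Q.l_distr Q.r_distr Q.a_ac Q.smult_mult_l Q.smult_mult_r Q.smult_r_distr)
      fix a b assume [simp]: "a \<in> carrier schr_q" "b \<in> carrier schr_q"
      show "?r (\<Delta> (qgen x) \<otimes>\<^bsub>TT\<^esub> (a \<otimes>q b)) =
          ?r (a \<otimes>q b) \<otimes>\<^bsub>schr_q\<^esub> S (qgen x) \<oplus>\<^bsub>schr_q\<^esub>
          qgen x \<otimes>\<^bsub>schr_q\<^esub> ?r (a \<otimes>q b) \<otimes>\<^bsub>schr_q\<^esub> qe (- qweight x)"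
        by (simp add: dx QQ.T.l_distr QQ.tens_mult lin_add[OF r] rt S_simps S_qe[OF qweight_00] Q.m_assoc)
    qed
    also have "\<dots> = \<zero>\<^bsub>schr_q\<^esub>"
      unfolding IH using SXc
      by (simp add: Q.smult_mult_l Q.smult_mult_r S(2) S_gen_def Q.smult_minus_r Q.l_neg)
    finally show "?r (\<Delta> (qgen x \<otimes>\<^bsub>schr_q\<^esub> u)) = \<epsilon> (qgen x \<otimes>\<^bsub>schr_q\<^esub> u) \<odot>\<^bsub>schr_q\<^esub> \<one>q"
      using u by (simp add: alg_hom_mult[OF \<Delta>(1)] ex)
  qed
qed

lemma hopf: "topological_hopf_algebra schr_q \<Delta> \<epsilon> S"
  unfolding topological_hopf_algebra_def klinear_eq_lin
  using Q.assoc_alg_axioms Q.adic_complete \<Delta>(1) \<epsilon>(1) lin_S coassoc counit antipode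
  by (simp add: kalgebra_iff_assoc_alg alg_hom_def)


subsection \<open>The first-order terms\<close>

lemma Delta_mod_1:
  "\<Delta> (qgen x) \<ominus>\<^bsub>TT\<^esub> (\<one>q \<otimes>q qgen x \<oplus>q qgen x \<otimes>q \<one>q) \<in> adic_nbhd TT 1"
proof -
  note [simp] = q_closed
  have "\<Delta> (qgen x) \<ominus>\<^bsub>TT\<^esub> (\<one>q \<otimes>q qgen x \<oplus>q qgen x \<otimes>q \<one>q) = qgen x \<otimes>q (qe (qweight x) \<ominus>\<^bsub>schr_q\<^esub> \<one>q)"
    by (simp add: \<Delta>(2) Delta_gen_def QQ.T.add_diff_add QQ.T.eq_diff_zero[THEN iffD2]
        lin_diff[OF Q.assoc_alg_axioms QQ.T.assoc_alg_axioms QQ.lin_tens(2)])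
  also have "\<dots> \<in> adic_nbhd TT 1"
    unfolding qe_def by (intro QQ.tens_nbhd_r Q.ex_mod_1 tM_nbhd qweight_00 qgen_closed)
  finally show ?thesis .
qed

lemma S_mod_1: "S (qgen x) \<oplus>\<^bsub>schr_q\<^esub> qgen x \<in> adic_nbhd schr_q 1"
proof -
  have w: "kcoeff (- qweight x) 0 0 = 0" by (simp add: qweight_00)
  note [simp] = qe_closed[OF w]
  have "S (qgen x) \<oplus>\<^bsub>schr_q\<^esub> qgen x = \<ominus>\<^bsub>schr_q\<^esub> (qgen x \<otimes>\<^bsub>schr_q\<^esub> (qe (- qweight x) \<ominus>\<^bsub>schr_q\<^esub> \<one>q))"
    by (simp add: S(2) S_gen_def Q.minus_eq Q.minus_add Q.r_distr Q.r_minus)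
  also have "\<dots> \<in> adic_nbhd schr_q 1"
    unfolding qe_def by (intro Q.nbhd_minus Q.nbhd_mult_l Q.ex_mod_1 tM_nbhd w qgen_closed)
  finally show ?thesis .
qed

lemma cocommutator_sum:
  "(\<Oplus>\<^bsub>TT\<^esub>p\<in>UNIV. cocommutator schr_r x (fst p) (snd p) \<odot>\<^bsub>TT\<^esub> qgen (fst p) \<otimes>q qgen (snd p)) =
    qweight x \<odot>\<^bsub>TT\<^esub> (qgen x \<otimes>q M) \<ominus>\<^bsub>TT\<^esub> qweight x \<odot>\<^bsub>TT\<^esub> (M \<otimes>q qgen x)" (is "?s = _")
\<comment> \<open>For \<open>x = bM\<close> the two index pairs of the wedge coincide, and the
  weight is zero.\<close>
proof (cases "x = bM")
  case True
  then have "?s = (\<Oplus>\<^bsub>TT\<^esub>p\<in>(UNIV::(schr \<times> schr) set). \<zero>\<^bsub>TT\<^esub>)"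
    by (intro QQ.T.finsum_cong') (simp_all add: cocommutator_schr)
  then show ?thesis by (simp add: True QQ.T.minus_eq)
next
  case False
  have fin: "finite (UNIV :: (schr \<times> schr) set)"
    unfolding UNIV_Times_UNIV[symmetric] UNIV_schr by simp
  have "?s = (\<Oplus>\<^bsub>TT\<^esub>p\<in>{(x, bM), (bM, x)}. cocommutator schr_r x (fst p) (snd p) \<odot>\<^bsub>TT\<^esub> qgen (fst p) \<otimes>q qgen (snd p))"
    by (rule QQ.T.add.finprod_mono_neutral_cong_right[OF fin])
      (auto simp: cocommutator_schr wedge_def)
  also have "\<dots> = qweight x \<odot>\<^bsub>TT\<^esub> (qgen x \<otimes>q M) \<ominus>\<^bsub>TT\<^esub> qweight x \<odot>\<^bsub>TT\<^esub> (M \<otimes>q qgen x)"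
    using False by (simp add: cocommutator_schr wedge_def QQ.T.smult_minus_l QQ.T.minus_eq)
  finally show ?thesis .
qed

text \<open>Let \<open>h = exp (w M) - 1 - w M\<close>, which has order two. After removing the
  cobracket the antisymmetrised coproduct is exactly
  \<open>X \<otimes> h - h \<otimes> X\<close>.\<close>

lemma Delta_antisym:
  "(\<Delta> (qgen x) \<ominus>\<^bsub>TT\<^esub> tensor_flip schr_q schr_q (\<Delta> (qgen x))) \<ominus>\<^bsub>TT\<^esub>
    (\<Oplus>\<^bsub>TT\<^esub>p\<in>UNIV. cocommutator schr_r x (fst p) (snd p) \<odot>\<^bsub>TT\<^esub> qgen (fst p) \<otimes>q qgen (snd p))
    \<in> adic_nbhd TT 2"
proof -
  note [simp] = q_closed
  let ?g = "qe (qweight x)" and ?z = "qweight x \<odot>\<^bsub>schr_q\<^esub> M"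
  let ?h = "?g \<ominus>\<^bsub>schr_q\<^esub> (\<one>q \<oplus>\<^bsub>schr_q\<^esub> ?z)"
  note flip = QQ.tensor_flip[OF QQ.alg_pair_axioms]
  have f: "tensor_flip schr_q schr_q (\<Delta> (qgen x)) = qgen x \<otimes>q \<one>q \<oplus>q ?g \<otimes>q qgen x"
    by (simp add: \<Delta>(2) Delta_gen_def lin_add[OF flip(1)] flip(2))
  have h: "?h \<in> adic_nbhd schr_q 2"
    unfolding qe_def by (intro Q.ex_mod_2 tM_nbhd qweight_00)
  have r: "qgen x \<otimes>q ?h = qgen x \<otimes>q ?g \<ominus>\<^bsub>TT\<^esub> (qgen x \<otimes>q \<one>q \<oplus>q qweight x \<odot>\<^bsub>TT\<^esub> (qgen x \<otimes>q M))"
    by (simp add: lin_diff[OF Q.assoc_alg_axioms QQ.T.assoc_alg_axioms QQ.lin_tens(2)]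
        lin_add[OF QQ.lin_tens(2)] lin_smult[OF QQ.lin_tens(2)])
  have l: "?h \<otimes>q qgen x = ?g \<otimes>q qgen x \<ominus>\<^bsub>TT\<^esub> (\<one>q \<otimes>q qgen x \<oplus>q qweight x \<odot>\<^bsub>TT\<^esub> (M \<otimes>q qgen x))"
    by (simp add: lin_diff[OF Q.assoc_alg_axioms QQ.T.assoc_alg_axioms QQ.lin_tens(1)]
        lin_add[OF QQ.lin_tens(1)] lin_smult[OF QQ.lin_tens(1)])
  have abel: "((a \<oplus>q b) \<ominus>\<^bsub>TT\<^esub> (c \<oplus>q d)) \<ominus>\<^bsub>TT\<^esub> (e \<ominus>\<^bsub>TT\<^esub> f) = (b \<ominus>\<^bsub>TT\<^esub> (c \<oplus>q e)) \<ominus>\<^bsub>TT\<^esub> (d \<ominus>\<^bsub>TT\<^esub> (a \<oplus>q f))"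
    if "a \<in> carrier TT" "b \<in> carrier TT" "c \<in> carrier TT" "d \<in> carrier TT" "e \<in> carrier TT" "f \<in> carrier TT"
    for a b c d e f
    using that by (simp add: QQ.T.minus_eq QQ.T.minus_add QQ.T.a_ac)
  show ?thesis
    unfolding f cocommutator_sum unfolding \<Delta>(2) Delta_gen_def
    by (subst abel) (simp_all add: QQ.T.nbhd_diff QQ.tens_nbhd_r[OF _ h] QQ.tens_nbhd_l[OF h] flip: r l)
qed

end


section \<open>Topological freeness\<close>

text \<open>Restriction of scalars to the reals, so that maps from the real algebra
  \<open>U(S)\<close> to \<open>kk\<close>-algebras can be treated as homomorphisms.\<close>

definition restr :: "(kk, 'a) module \<Rightarrow> (real, 'a) module" where
  "restr A = \<lparr>carrier = carrier A, monoid.mult = monoid.mult A, one = \<one>\<^bsub>A\<^esub>, zero = \<zero>\<^bsub>A\<^esub>,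
     add = add A, smult = (\<lambda>r x. kreal r \<odot>\<^bsub>A\<^esub> x)\<rparr>"

lemma restr_simps [simp]:
  "carrier (restr A) = carrier A" "x \<otimes>\<^bsub>restr A\<^esub> y = x \<otimes>\<^bsub>A\<^esub> y" "\<one>\<^bsub>restr A\<^esub> = \<one>\<^bsub>A\<^esub>"
  "\<zero>\<^bsub>restr A\<^esub> = \<zero>\<^bsub>A\<^esub>" "x \<oplus>\<^bsub>restr A\<^esub> y = x \<oplus>\<^bsub>A\<^esub> y" "r \<odot>\<^bsub>restr A\<^esub> x = kreal r \<odot>\<^bsub>A\<^esub> x"
  by (simp_all add: restr_def)

lemma real_lin_eq_lin: "real_lin A B h \<longleftrightarrow> lin A (restr B) h"
  by (simp add: real_lin_def lin_def)

lemma (in assoc_alg) neg_exists: "x \<in> carrier A \<Longrightarrow> \<exists>y\<in>carrier A. y \<oplus> x = \<zero>"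
  using l_neg by blast

lemma assoc_alg_restr:
  assumes "topalg A" shows "assoc_alg (restr A)"
proof -
  interpret topalg A by fact
  have "abelian_group (restr A)"
    by (rule abelian_groupI) (simp_all add: a_ac neg_exists)
  moreover have "Group.monoid (restr A)"
    by (rule monoidI) (simp_all add: m_assoc)
  ultimately have "ring (restr A)"
    by (rule ringI) (simp_all add: l_distr r_distr)
  then show ?thesis
    by (intro assoc_alg.intro assoc_alg_axioms.intro)
      (simp_all add: smult_l_distr smult_r_distr smult_assoc smult_mult_l smult_mult_r)
qed

lemma restr_diff:
  assumes "topalg A" "x \<in> carrier A" "y \<in> carrier A" shows "x \<ominus>\<^bsub>restr A\<^esub> y = x \<ominus>\<^bsub>A\<^esub> y"
proof -
  interpret topalg A by fact
  interpret R: assoc_alg "restr A" by (rule assoc_alg_restr) fact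
  have "\<ominus>\<^bsub>restr A\<^esub> y = \<ominus>\<^bsub>A\<^esub> y"
    using assms(3) by (intro R.minus_equality) (simp_all add: l_neg)
  then show ?thesis by (simp add: R.minus_eq minus_eq)
qed

section \<open>Presentation and universal property of the enveloping algebra\<close>

abbreviation wsingle :: "schr list \<Rightarrow> real \<Rightarrow> (schr list \<Rightarrow>\<^sub>0 real)" where
  "wsingle \<equiv> Poly_Mapping.single"

lemma wsingle_closed [simp]: "wsingle w r \<in> carrier (monalg words)"
  by (simp add: monalg_simps)

lemma wsingle_Cons: "wsingle (x # w) r = wsingle [x] 1 \<otimes>\<^bsub>monalg words\<^esub> wsingle w r"
  by (simp add: monalg_mult_single)

definition env_rel :: "schr \<Rightarrow> schr \<Rightarrow> (schr list \<Rightarrow>\<^sub>0 real)" where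
  "env_rel x y = wsingle [x, y] 1 - wsingle [y, x] 1 - (\<Sum>z\<in>UNIV. wsingle [z] (schr_bracket x y z))"

lemma monalg_words_minus: "p \<ominus>\<^bsub>monalg words\<^esub> q = p - q"
proof -
  have c: "p \<in> carrier (monalg words)" for p by (simp add: monalg_simps)
  have "(p \<ominus>\<^bsub>monalg words\<^esub> q) + q = p"
    using W.diff_add_cancel[OF c c, of p q] by (simp add: monalg_simps(2))
  then show ?thesis by (simp add: eq_diff_eq)
qed

abbreviation "lie_rels \<equiv> insert (bK, bP, 1, bM) lin_rels"

text \<open>Each pair of distinct basis vectors is listed in at least one order, so antisymmetry
  reduces all relators of \<open>U(S)\<close> to the listed ones.\<close>

lemma lie_rels_cases:
  "x = y \<or> (\<exists>r z. (x, y, r, z) \<in> lie_rels) \<or> (\<exists>r z. (y, x, r, z) \<in> lie_rels)"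
  by (cases x; cases y) (simp_all add: lin_rels_def)

lemma schr_bracket_lie_rels:
  "(x, y, r, z) \<in> lie_rels \<Longrightarrow> schr_bracket x y z' = (if z' = z then r else 0)"
  unfolding lin_rels_def
  by (cases x; cases z') (auto simp: schr_bracket_def elim: schr_half.elims)

lemma env_rel_lie_rels:
  assumes "(x, y, r, z) \<in> lie_rels"
  shows "env_rel x y = wsingle [x, y] 1 - wsingle [y, x] 1 - wsingle [z] r"
proof -
  have "(\<Sum>z'\<in>UNIV. wsingle [z'] (schr_bracket x y z')) = (\<Sum>z'\<in>UNIV. if z' = z then wsingle [z] r else 0)"
    by (intro sum.cong) (simp_all add: schr_bracket_lie_rels[OF assms])
  then show ?thesis
    unfolding env_rel_def by (cases z) (simp_all add: UNIV_schr)
qed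

lemma env_rel_swap: "env_rel y x = - env_rel x y"
proof -
  have "wsingle [z] (schr_bracket y x z) = - wsingle [z] (schr_bracket x y z)" for z
    by (simp add: schr_bracket_def flip: single_uminus)
  then show ?thesis by (simp add: env_rel_def sum_negf)
qed

lemma env_rel_self: "env_rel x x = 0"
  by (simp add: env_rel_def schr_bracket_def)

lemma env_ideal_eq: "env_ideal = Idl\<^bsub>monalg words\<^esub> {env_rel x y | x y. True}"
  by (simp add: env_ideal_def env_rel_def)

lemma env_rel_closed: "{env_rel x y | x y. True} \<subseteq> carrier (monalg words)"
  by (auto simp: monalg_simps)

lemma ideal_env: "ideal env_ideal (monalg words)"
  unfolding env_ideal_eq by (rule W.genideal_ideal[OF env_rel_closed])

interpretation U: real_alg schr_env
  unfolding schr_env_def real_alg_def by (rule W.assoc_alg_quot[OF ideal_env])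

definition upr :: "(schr list \<Rightarrow>\<^sub>0 real) \<Rightarrow> (schr list \<Rightarrow>\<^sub>0 real) set" where
  "upr x = env_ideal +>\<^bsub>monalg words\<^esub> x"

lemma alg_hom_upr: "alg_hom (monalg words) schr_env upr"
  unfolding upr_def[abs_def] schr_env_def by (rule W.alg_hom_rcos[OF ideal_env])

lemma upr_surj: "upr ` carrier (monalg words) = carrier schr_env"
  unfolding upr_def[abs_def] schr_env_def by (simp add: W.quot_alg_simps(1)[OF ideal_env])

lemma upr_eq_zero_iff: "x \<in> carrier (monalg words) \<Longrightarrow> upr x = \<zero>\<^bsub>schr_env\<^esub> \<longleftrightarrow> x \<in> env_ideal"
  unfolding upr_def schr_env_def by (rule W.rcos_eq_zero_iff[OF ideal_env])

lemma env_gen_upr: "env_gen x = upr (wsingle [x] 1)"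
  by (simp add: env_gen_def upr_def)

lemma env_gen_closed [simp]: "env_gen x \<in> carrier schr_env"
  unfolding env_gen_upr by (intro alg_hom_closed[OF alg_hom_upr] wsingle_closed)

lemma alg_hom_env_rel:
  assumes B: "assoc_alg B" and f: "alg_hom (monalg words) B f" and rel: "(x, y, r, z) \<in> lie_rels"
  shows "f (env_rel x y) = \<zero>\<^bsub>B\<^esub> \<longleftrightarrow>
    comm B (f (wsingle [x] 1)) (f (wsingle [y] 1)) = r \<odot>\<^bsub>B\<^esub> f (wsingle [z] 1)"
proof -
  interpret B: assoc_alg B by fact
  note fc = alg_hom_closed[OF f wsingle_closed]
  have c: "comm (monalg words) (wsingle [x] 1) (wsingle [y] 1) = wsingle [x, y] 1 - wsingle [y, x] 1"
    by (simp add: comm_def monalg_mult_single monalg_words_minus)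
  have "env_rel x y = comm (monalg words) (wsingle [x] 1) (wsingle [y] 1) \<ominus>\<^bsub>monalg words\<^esub>
      r \<odot>\<^bsub>monalg words\<^esub> wsingle [z] 1"
    unfolding c monalg_words_minus env_rel_lie_rels[OF rel] by (simp add: monalg_smult_single)
  moreover have "comm (monalg words) (wsingle [x] 1) (wsingle [y] 1) \<in> carrier (monalg words)"
    by (simp add: comm_def)
  ultimately have "f (env_rel x y) =
      comm B (f (wsingle [x] 1)) (f (wsingle [y] 1)) \<ominus>\<^bsub>B\<^esub> r \<odot>\<^bsub>B\<^esub> f (wsingle [z] 1)"
    by (simp add: lin_diff[OF W.assoc_alg_axioms B alg_hom_lin[OF f]] alg_hom_smult[OF f]
        alg_hom_comm[OF W.assoc_alg_axioms B f])
  then show ?thesis using fc by (simp add: B.eq_diff_zero comm_def)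
qed

lemma env_comm:
  assumes "(x, y, r, z) \<in> lie_rels"
  shows "comm schr_env (env_gen x) (env_gen y) = r \<odot>\<^bsub>schr_env\<^esub> env_gen z"
proof -
  have "env_rel x y \<in> env_ideal"
    unfolding env_ideal_eq using W.genideal_self[OF env_rel_closed] by blast
  then have "upr (env_rel x y) = \<zero>\<^bsub>schr_env\<^esub>"
    by (subst upr_eq_zero_iff) (auto simp: monalg_simps)
  then show ?thesis
    unfolding alg_hom_env_rel[OF U.assoc_alg_axioms alg_hom_upr assms] env_gen_upr .
qed

lemma schr_env_extend:
  assumes B: "calg B" and Y: "\<And>x. Y x \<in> carrier B"
    and rel: "\<And>x y r z. (x, y, r, z) \<in> lie_rels \<Longrightarrow> comm B (Y x) (Y y) = kreal r \<odot>\<^bsub>B\<^esub> Y z"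
  obtains F where "alg_hom schr_env (restr B) F" "\<And>x. F (env_gen x) = Y x"
proof -
  interpret B: calg B by fact
  interpret RB: assoc_alg "restr B" by (rule assoc_alg_restr[OF B.topalg_axioms])
  \<comment> \<open>The real free algebra sits in \<open>qfree\<close> as the constants, so its map
    to \<open>B\<close> is obtained by restricting a homomorphism from \<open>qfree\<close>.\<close>
  obtain g where g: "alg_hom qfree B g" "\<And>x. g (letter x) = Y x"
    by (rule qfree_extend[OF B, of Y, OF Y]) (rule that)
  define f where "f p = g (W.pconst p)" for p
  have f: "alg_hom (monalg words) (restr B) f"
    unfolding f_def using alg_hom_one[OF g(1)] W.pconst_one
    by (intro alg_homI linI)
      (simp_all add: alg_hom_closed[OF g(1)] alg_hom_add[OF g(1)] alg_hom_mult[OF g(1)] alg_hom_smult[OF g(1)]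
        W.pconst_add W.pconst_mult W.pconst_smult)
  have fx: "f (wsingle [x] 1) = Y x" for x
    using g(2)[of x] by (simp add: f_def letter_def cmon_eq_pconst[OF W.real_alg_axioms])
  have f0: "f (env_rel x y) = \<zero>\<^bsub>restr B\<^esub>" if "(x, y, r, z) \<in> lie_rels" for x y r z
    unfolding alg_hom_env_rel[OF RB.assoc_alg_axioms f that] fx
    using rel[OF that] Y by (simp add: comm_def restr_diff[OF B.topalg_axioms])
  have all: "f (env_rel x y) = \<zero>\<^bsub>restr B\<^esub>" for x y
    using lie_rels_cases[of x y]
  proof (elim disjE exE)
    assume "x = y"
    then show ?thesis
      using lin_zero[OF W.assoc_alg_axioms RB.assoc_alg_axioms alg_hom_lin[OF f]]
      by (simp add: env_rel_self monalg_simps)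
  next
    fix r z assume "(y, x, r, z) \<in> lie_rels"
    then have 0: "f (env_rel y x) = \<zero>\<^bsub>restr B\<^esub>" by (rule f0)
    have "env_rel x y = (-1) \<odot>\<^bsub>monalg words\<^esub> env_rel y x"
      by (rule poly_mapping_eqI) (simp add: lookup_monalg_smult env_rel_swap[of x y])
    then show ?thesis
      using alg_hom_smult[OF f, of "env_rel y x" "-1"] 0 by (simp add: monalg_simps del: kreal_simps)
  qed (rule f0)
  have k: "f p = \<zero>\<^bsub>restr B\<^esub>" if p: "p \<in> carrier (monalg words)" "upr p = \<zero>\<^bsub>schr_env\<^esub>" for p
  proof -
    have "env_ideal \<subseteq> {p \<in> carrier (monalg words). f p = \<zero>\<^bsub>restr B\<^esub>}"
      unfolding env_ideal_eq
      by (rule W.genideal_mono_ideal[OF kernel_ideal[OF W.assoc_alg_axioms RB.assoc_alg_axioms f]])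
        (use all in \<open>auto simp: monalg_simps\<close>)
    then show ?thesis using p by (auto simp: upr_eq_zero_iff)
  qed
  obtain F where F: "alg_hom schr_env (restr B) F" "\<And>p. p \<in> carrier (monalg words) \<Longrightarrow> F (upr p) = f p"
    by (rule alg_hom_factor[OF alg_hom_upr upr_surj f k W.assoc_alg_axioms U.assoc_alg_axioms
          RB.assoc_alg_axioms]) auto
  show ?thesis
    by (rule that[OF F(1)]) (simp add: env_gen_upr F(2) fx)
qed

lemma schr_env_hom_eqI:
  assumes F: "alg_hom schr_env B F" and G: "alg_hom schr_env B G" and B: "assoc_alg B"
    and eq: "\<And>x. F (env_gen x) = G (env_gen x)" and u: "u \<in> carrier schr_env"
  shows "F u = G u"
proof -
  note F' = alg_hom_comp[OF alg_hom_upr F] and G' = alg_hom_comp[OF alg_hom_upr G]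
  have w: "F (upr (wsingle w 1)) = G (upr (wsingle w 1))" for w
  proof (induction w)
    case Nil
    show ?case using alg_hom_one[OF F'] alg_hom_one[OF G'] by (simp add: monalg_simps)
  next
    case (Cons x w)
    then show ?case
      using eq[of x] unfolding wsingle_Cons[of x w] alg_hom_mult[OF F' wsingle_closed wsingle_closed]
        alg_hom_mult[OF G' wsingle_closed wsingle_closed] env_gen_upr by simp
  qed
  have "u \<in> upr ` carrier (monalg words)" using u upr_surj by simp
  then obtain p where p: "p \<in> carrier (monalg words)" "u = upr p" by auto
  have "F (upr p) = G (upr p)"
    using p(1)
  proof (induction rule: monalg_induct)
    case zero
    show ?case
      using lin_zero[OF W.assoc_alg_axioms B alg_hom_lin[OF F']] lin_zero[OF W.assoc_alg_axioms B alg_hom_lin[OF G']]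
      by (simp add: monalg_simps)
  next
    case (single a r)
    have "wsingle a r = r \<odot>\<^bsub>monalg words\<^esub> wsingle a 1" by (simp add: monalg_smult_single)
    then show ?case using w by (simp add: alg_hom_smult[OF F'] alg_hom_smult[OF G'])
  next
    case (add p q)
    then show ?case
      using alg_hom_add[OF F' add(1,2)] alg_hom_add[OF G' add(1,2)] by (simp add: monalg_simps(2))
  qed
  with p show ?thesis by simp
qed

text \<open>Rescaling \<open>P\<close> and \<open>K\<close> by the square root of \<open>(1 - exp (-2 c2 M)) / (2 c2 M)\<close> turns the relations
  of \<open>U(S)\<close> into those of the quantum algebra.\<close>

fun rescale :: "schr \<Rightarrow> real fps" where
  "rescale bP = sqrt_mfps"
| "rescale bK = sqrt_mfps"
| "rescale _ = 1"

lemma rescale_0: "fps_nth (rescale x) 0 = 1"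
  by (cases x) (simp_all add: sqrt_mfps)

text \<open>Counting \<open>P\<close> and \<open>K\<close> with degree one and the other generators
  with degree zero, the degree is additive on nonzero linear brackets. At \<open>[K, P]\<close> the
  product of the factors is \<open>mfps\<close> instead.\<close>

lemma rescale_rel: "(x, y, r, z) \<in> lin_rels \<Longrightarrow> r = 0 \<or> rescale x * rescale y = rescale z"
  by (auto simp: lin_rels_def)

lemma rescale_inverse: "inverse (rescale x) * rescale x = 1"
  using inverse_mult_eq_1[of "rescale x"] rescale_0[of x] by simp

section \<open>Rescaled generators and the isomorphism with \<open>U(S)[[c1, c2]]\<close>\<close>

context calg
begin

lemma comm_rescale:
  assumes z: "z \<in> adic_nbhd A 1" and x: "x \<in> carrier A" and y: "y \<in> carrier A"
    and c: "x \<otimes> z = z \<otimes> x" "y \<otimes> z = z \<otimes> y"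
  shows "comm A (fps_eval A p z \<otimes> x) (fps_eval A q z \<otimes> y) = fps_eval A (p * q) z \<otimes> comm A x y"
proof -
  have 1: "(fps_eval A p z \<otimes> x) \<otimes> (fps_eval A q z \<otimes> y) = fps_eval A (p * q) z \<otimes> (x \<otimes> y)"
    if x: "x \<in> carrier A" and y: "y \<in> carrier A" and c: "x \<otimes> z = z \<otimes> x" for p q x y
  proof -
    have "(fps_eval A p z \<otimes> x) \<otimes> (fps_eval A q z \<otimes> y) = fps_eval A p z \<otimes> (x \<otimes> fps_eval A q z) \<otimes> y"
      using x y z by (simp add: m_assoc)
    then show ?thesis
      using x y z by (simp add: fps_eval_commute[OF z x c] fps_eval_mult[OF z] m_assoc)
  qed
  show ?thesis
    unfolding comm_def 1[OF x y c(1)] 1[OF y x c(2)] mult.commute[of q p]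
    using x y z by (simp add: diff_mult_r)
qed

end

lemmas PU = U.pser.calg_axioms

abbreviation "ugen x \<equiv> U.pconst (env_gen x)"

text \<open>The image of a quantum generator: rescaled \<open>K\<close> and \<open>P\<close> have
  bracket \<open>mfps(c2 M) M\<close>, which is \<open>mser\<close> of \<open>M\<close>.\<close>

definition uresc where
  "uresc x = fps_eval (pser schr_env) (rescale x) (c2 \<odot>\<^bsub>pser schr_env\<^esub> ugen bM) \<otimes>\<^bsub>pser schr_env\<^esub> ugen x"

lemma ugen_comm:
  assumes "(x, y, r, z) \<in> lie_rels"
  shows "comm (pser schr_env) (ugen x) (ugen y) = kreal r \<odot>\<^bsub>pser schr_env\<^esub> ugen z"
proof -
  have h: "alg_hom schr_env (restr (pser schr_env)) U.pconst"
    by (intro alg_homI linI) (simp_all add: U.pconst_add U.pconst_smult U.pconst_mult U.pconst_one)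
  have "U.pconst (comm schr_env (env_gen x) (env_gen y)) = comm (restr (pser schr_env)) (ugen x) (ugen y)"
    by (rule alg_hom_comm[OF U.assoc_alg_axioms assoc_alg_restr[OF U.pser.topalg_axioms] h]) simp_all
  then show ?thesis
    unfolding env_comm[OF assms] by (simp add: U.pconst_smult comm_def restr_diff[OF U.pser.topalg_axioms])
qed

lemma central_if_comm:
  assumes "assoc_alg B" "x \<in> carrier B" "y \<in> carrier B" "comm B y x = kreal 0 \<odot>\<^bsub>B\<^esub> y"
  shows "x \<otimes>\<^bsub>B\<^esub> (c2 \<odot>\<^bsub>B\<^esub> y) = (c2 \<odot>\<^bsub>B\<^esub> y) \<otimes>\<^bsub>B\<^esub> x"
proof -
  interpret assoc_alg B by fact
  show ?thesis using assms by (simp add: comm_def eq_diff_zero smult_mult_l smult_mult_r)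
qed

lemma schr_rep_uresc: "schr_rep (pser schr_env) uresc"
proof -
  let ?P = "pser schr_env" and ?z = "c2 \<odot>\<^bsub>pser schr_env\<^esub> ugen bM"
  have z: "?z \<in> adic_nbhd ?P 1" by simp
  have c: "ugen x \<otimes>\<^bsub>?P\<^esub> ?z = ?z \<otimes>\<^bsub>?P\<^esub> ugen x" for x
    by (rule central_if_comm[OF U.pser.assoc_alg_axioms]) (simp_all add: ugen_comm lin_rels_def del: kreal_simps)
  have cc: "comm ?P (uresc x) (uresc y) = fps_eval ?P (rescale x * rescale y) ?z \<otimes>\<^bsub>?P\<^esub> comm ?P (ugen x) (ugen y)" for x y
    unfolding uresc_def by (intro U.pser.comm_rescale z c U.pconst_closed env_gen_closed)
  have "comm ?P (uresc x) (uresc y) = kreal r \<odot>\<^bsub>?P\<^esub> uresc z" if "(x, y, r, z) \<in> lin_rels" for x y r z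
  proof -
    have E: "comm ?P (uresc x) (uresc y) = kreal r \<odot>\<^bsub>?P\<^esub> (fps_eval ?P (rescale x * rescale y) ?z \<otimes>\<^bsub>?P\<^esub> ugen z)"
      unfolding cc ugen_comm[OF insertI2[OF that]] by (simp add: U.pser.smult_mult_r)
    from rescale_rel[OF that] show ?thesis
    proof
      assume "r = 0" then show ?thesis unfolding E by (simp add: uresc_def)
    next
      assume w: "rescale x * rescale y = rescale z"
      show ?thesis unfolding E unfolding uresc_def[of z] w by (rule refl)
    qed
  qed
  moreover have "comm ?P (uresc bK) (uresc bP) = mser ?P (uresc bM)"
    unfolding cc ugen_comm[OF insertI1] using U.pser.fps_eval_commute[OF z U.pconst_closed[OF env_gen_closed] c, where p = mfps]
    by (simp add: sqrt_mfps mser_def uresc_def)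
  ultimately show ?thesis by (auto simp: schr_rep_def uresc_def)
qed

text \<open>The inverse rescaling inside the quantum algebra; it divides the deformed bracket by
  \<open>mfps(c2 M)\<close> and so restores the undeformed Lie relations.\<close>

definition qresc where
  "qresc x = fps_eval schr_q (inverse (rescale x)) (c2 \<odot>\<^bsub>schr_q\<^esub> M) \<otimes>\<^bsub>schr_q\<^esub> qgen x"

lemma qresc_closed [simp]: "qresc x \<in> carrier schr_q"
  by (simp add: qresc_def)

lemma qresc_comm:
  assumes "(x, y, r, z) \<in> lie_rels" shows "comm schr_q (qresc x) (qresc y) = kreal r \<odot>\<^bsub>schr_q\<^esub> qresc z"
proof -
  let ?z = "c2 \<odot>\<^bsub>schr_q\<^esub> M"
  have z: "?z \<in> adic_nbhd schr_q 1" by simp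
  have c: "qgen x \<otimes>\<^bsub>schr_q\<^esub> ?z = ?z \<otimes>\<^bsub>schr_q\<^esub> qgen x" for x
    by (rule central_if_comm[OF Q.assoc_alg_axioms])
      (simp_all add: schr_repD(2)[OF schr_rep_q] lin_rels_def del: kreal_simps)
  have cc: "comm schr_q (qresc x) (qresc y) =
      fps_eval schr_q (inverse (rescale x * rescale y)) ?z \<otimes>\<^bsub>schr_q\<^esub> comm schr_q (qgen x) (qgen y)" for x y
    unfolding qresc_def fps_inverse_mult by (intro Q.comm_rescale z c qgen_closed)
  show ?thesis
  proof (cases "(x, y, r, z) \<in> lin_rels")
    case True
    have E: "comm schr_q (qresc x) (qresc y) =
        kreal r \<odot>\<^bsub>schr_q\<^esub> (fps_eval schr_q (inverse (rescale x * rescale y)) ?z \<otimes>\<^bsub>schr_q\<^esub> qgen z)"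
      unfolding cc schr_repD(2)[OF schr_rep_q True] by (simp add: Q.smult_mult_r)
    from rescale_rel[OF True] show ?thesis
    proof
      assume "r = 0" then show ?thesis unfolding E by simp
    next
      assume w: "rescale x * rescale y = rescale z"
      show ?thesis unfolding E unfolding qresc_def[of z] w by (rule refl)
    qed
  next
    case False
    then have xy: "x = bK" "y = bP" "r = 1" "z = bM" using assms by auto
    have inv: "inverse mfps * mfps = 1"
      by (rule inverse_mult_eq_1) (simp add: mfps_def)
    have "comm schr_q (qresc bK) (qresc bP) =
        fps_eval schr_q (inverse mfps) ?z \<otimes>\<^bsub>schr_q\<^esub> (fps_eval schr_q mfps ?z \<otimes>\<^bsub>schr_q\<^esub> M)"
      unfolding cc schr_repD(3)[OF schr_rep_q] mser_def Q.fps_eval_commute[OF z qgen_closed c]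
      by (simp add: sqrt_mfps)
    also have "\<dots> = M"
      by (simp add: inv flip: Q.m_assoc Q.fps_eval_mult)
    finally show ?thesis by (simp add: xy qresc_def)
  qed
qed

text \<open>Both rescalings fix \<open>M\<close>, so each composite multiplies a generator by the
  value at \<open>c2 M\<close> of a series times its inverse, and is the identity on generators. On
  the side of power series this is first known on \<open>U(S)\<close> and then extended from
  constants.\<close>

lemma schr_q_trivialization:
  obtains \<phi> \<psi> where "alg_hom schr_q (pser schr_env) \<phi>" "alg_hom (pser schr_env) schr_q \<psi>"
    "\<And>x. \<phi> (qgen x) = uresc x"
    "\<And>u. u \<in> carrier schr_q \<Longrightarrow> \<psi> (\<phi> u) = u" "\<And>f. f \<in> carrier (pser schr_env) \<Longrightarrow> \<phi> (\<psi> f) = f"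
proof -
  let ?P = "pser schr_env"
  obtain \<phi> where \<phi>: "alg_hom schr_q ?P \<phi>" "\<And>x. \<phi> (qgen x) = uresc x"
    by (rule schr_q_extend[OF PU schr_rep_uresc]) (rule that)
  obtain \<psi>0 where \<psi>0: "alg_hom schr_env (restr schr_q) \<psi>0" "\<And>x. \<psi>0 (env_gen x) = qresc x"
    by (rule schr_env_extend[OF Q.calg_axioms, of qresc, OF qresc_closed qresc_comm]) auto
  \<comment> \<open>The map back is built in two stages: over the reals on \<open>U(S)\<close>, then
    along the parameters.\<close>
  obtain \<psi> where \<psi>: "alg_hom ?P schr_q \<psi>" "\<And>u. u \<in> carrier schr_env \<Longrightarrow> \<psi> (U.pconst u) = \<psi>0 u"
  proof (rule U.pser_extend_hom[OF Q.calg_axioms, of \<psi>0])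
    show "real_lin schr_env schr_q \<psi>0" unfolding real_lin_eq_lin by (rule alg_hom_lin[OF \<psi>0(1)])
  qed (use alg_hom_mult[OF \<psi>0(1)] alg_hom_one[OF \<psi>0(1)] in auto)
  have \<psi>x: "\<psi> (ugen x) = qresc x" for x by (simp add: \<psi>(2) \<psi>0(2))
  have M1: "\<psi> (ugen bM) = M" by (simp add: \<psi>x qresc_def)
  have M2: "\<phi> M = ugen bM" by (simp add: \<phi>(2) uresc_def)
  have 1: "\<psi> (\<phi> u) = u" if u: "u \<in> carrier schr_q" for u
  proof (rule schr_q_hom_eqI[OF Q.calg_axioms alg_hom_comp[OF \<phi>(1) \<psi>(1)] alg_hom_id _ u])
    show "\<psi> (\<phi> (qgen x)) = qgen x" for x
      using rescale_inverse[of x]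
      by (simp add: \<phi>(2) uresc_def alg_hom_mult[OF \<psi>(1)] alg_hom_fps_eval[OF PU Q.calg_axioms \<psi>(1)]
          alg_hom_smult[OF \<psi>(1)] \<psi>x M1 qresc_def mult.commute flip: Q.m_assoc Q.fps_eval_mult)
  qed
  have \<phi>\<psi>x: "\<phi> (\<psi> (ugen x)) = ugen x" for x
    using rescale_inverse[of x]
    by (simp add: \<psi>x qresc_def alg_hom_mult[OF \<phi>(1)] alg_hom_fps_eval[OF Q.calg_axioms PU \<phi>(1)]
        alg_hom_smult[OF \<phi>(1)] \<phi>(2) M2 flip: U.pser.m_assoc U.pser.fps_eval_mult)
      (simp add: uresc_def flip: U.pser.m_assoc U.pser.fps_eval_mult)
  note c = alg_hom_comp[OF \<psi>(1) \<phi>(1)]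
  have h: "alg_hom schr_env (restr ?P) U.pconst"
    by (intro alg_homI linI) (simp_all add: U.pconst_add U.pconst_smult U.pconst_mult U.pconst_one)
  have h': "alg_hom schr_env (restr ?P) (\<lambda>u. \<phi> (\<psi> (U.pconst u)))"
    using alg_hom_one[OF c] alg_hom_closed[OF c]
    by (intro alg_homI linI) (simp_all add: U.pconst_add U.pconst_smult U.pconst_mult U.pconst_one
        alg_hom_add[OF c] alg_hom_smult[OF c] alg_hom_mult[OF c])
  have "\<phi> (\<psi> (U.pconst u)) = U.pconst u" if "u \<in> carrier schr_env" for u
    by (rule schr_env_hom_eqI[OF h' h assoc_alg_restr[OF U.pser.topalg_axioms] \<phi>\<psi>x that])
  then have 2: "\<phi> (\<psi> f) = f" if "f \<in> carrier ?P" for f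
    by (rule U.pser_lin_eqI[OF PU alg_hom_lin[OF c] lin_id _ that])
  show ?thesis by (rule that[OF \<phi>(1) \<psi>(1) \<phi>(2) 1 2])
qed

lemma ring_hom_augment: "alg_hom B (pser schr_env) \<phi> \<Longrightarrow> (\<lambda>u. \<phi> u 0 0) \<in> ring_hom B schr_env"
  by (rule ring_hom_memI)
    (use alg_hom_closed[of B "pser schr_env" \<phi>] in
      \<open>auto simp: pser_simps alg_hom_add alg_hom_one alg_hom_mult U.pser_mult\<close>)

text \<open>The identification modulo the parameters is the constant coefficient of the isomorphism.
  Its kernel is found on the side of power series, as the isomorphism and its inverse both preserve
  neighbourhoods.\<close>

lemma schr_q_free:
  "\<exists>\<pi>. \<pi> \<in> ring_hom schr_q schr_env \<and>
    (\<forall>t. \<forall>x\<in>carrier schr_q. \<pi> (t \<odot>\<^bsub>schr_q\<^esub> x) = kcoeff t 0 0 \<odot>\<^bsub>schr_env\<^esub> \<pi> x) \<and>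
    \<pi> ` carrier schr_q = carrier schr_env \<and>
    (\<forall>x\<in>carrier schr_q. \<pi> x = \<zero>\<^bsub>schr_env\<^esub> \<longleftrightarrow> x \<in> adic_nbhd schr_q 1) \<and>
    (\<forall>x. \<pi> (qgen x) = env_gen x) \<and>
    (\<exists>\<phi>. klinear schr_q (pser schr_env) \<phi> \<and>
       bij_betw \<phi> (carrier schr_q) (carrier (pser schr_env)) \<and>
       (\<forall>x\<in>carrier schr_q. \<phi> x 0 0 = \<pi> x))"
proof -
  let ?P = "pser schr_env"
  obtain \<phi> \<psi> where \<phi>: "alg_hom schr_q ?P \<phi>" and \<psi>: "alg_hom ?P schr_q \<psi>"
    and gen: "\<And>x. \<phi> (qgen x) = uresc x"
    and inv: "\<And>u. u \<in> carrier schr_q \<Longrightarrow> \<psi> (\<phi> u) = u" "\<And>f. f \<in> carrier ?P \<Longrightarrow> \<phi> (\<psi> f) = f"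
    by (rule schr_q_trivialization) (rule that)
  note c = alg_hom_closed[OF \<phi>] and c' = alg_hom_closed[OF \<psi>]
  have c00: "\<phi> u 0 0 \<in> carrier schr_env" if "u \<in> carrier schr_q" for u
    using c[OF that] by (simp add: pser_simps)
  define \<pi> where "\<pi> u = \<phi> u 0 0" for u
  show ?thesis
  proof (intro exI[of _ \<pi>] conjI ballI allI)
    show "\<pi> \<in> ring_hom schr_q schr_env"
      unfolding \<pi>_def[abs_def] by (rule ring_hom_augment[OF \<phi>])
    show "\<pi> (t \<odot>\<^bsub>schr_q\<^esub> u) = kcoeff t 0 0 \<odot>\<^bsub>schr_env\<^esub> \<pi> u" if "u \<in> carrier schr_q" for t u
      using that c[OF that] c00[OF that] by (simp add: \<pi>_def alg_hom_smult[OF \<phi>] U.pser_smult)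
    show "\<pi> ` carrier schr_q = carrier schr_env"
    proof
      show "\<pi> ` carrier schr_q \<subseteq> carrier schr_env" using c00 by (auto simp: \<pi>_def)
      show "carrier schr_env \<subseteq> \<pi> ` carrier schr_q"
      proof
        fix u assume u: "u \<in> carrier schr_env"
        then have "\<pi> (\<psi> (U.pconst u)) = u" by (simp add: \<pi>_def inv U.pconst_def[of u 0 0])
        then show "u \<in> \<pi> ` carrier schr_q" using c'[OF U.pconst_closed[OF u]] by (metis imageI)
      qed
    qed
    show "\<pi> u = \<zero>\<^bsub>schr_env\<^esub> \<longleftrightarrow> u \<in> adic_nbhd schr_q 1" if u: "u \<in> carrier schr_q" for u
    proof
      assume "\<pi> u = \<zero>\<^bsub>schr_env\<^esub>"
      then have "\<phi> u \<in> adic_nbhd ?P 1"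
        using c[OF u] by (simp add: U.pser_nbhd \<pi>_def)
      then have "\<psi> (\<phi> u) \<in> adic_nbhd schr_q 1"
        by (rule lin_nbhd[OF U.pser.topalg_axioms Q.topalg_axioms alg_hom_lin[OF \<psi>]])
      then show "u \<in> adic_nbhd schr_q 1" by (simp add: inv u)
    next
      assume "u \<in> adic_nbhd schr_q 1"
      then have "\<phi> u \<in> adic_nbhd ?P 1"
        by (rule lin_nbhd[OF Q.topalg_axioms U.pser.topalg_axioms alg_hom_lin[OF \<phi>]])
      then show "\<pi> u = \<zero>\<^bsub>schr_env\<^esub>" by (simp add: U.pser_nbhd \<pi>_def)
    qed
    show "\<pi> (qgen x) = env_gen x" for x
    proof -
      let ?e = "fps_eval ?P (rescale x) (c2 \<odot>\<^bsub>?P\<^esub> ugen bM)"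
      have z: "c2 \<odot>\<^bsub>?P\<^esub> ugen bM \<in> adic_nbhd ?P 1" by simp
      have e: "?e \<in> carrier ?P" by simp
      \<comment> \<open>The rescaling series start with \<open>1\<close>, so the factor
        \<open>?e\<close> is invisible in the constant coefficient and the generator reduces to the
        undeformed one.\<close>
      have "?e \<ominus>\<^bsub>?P\<^esub> \<one>\<^bsub>?P\<^esub> \<in> adic_nbhd ?P 1"
        using U.pser.fps_eval_cong_mod[OF z, of "rescale x" 1] by (simp add: rescale_0)
      then have "(?e \<ominus>\<^bsub>?P\<^esub> \<one>\<^bsub>?P\<^esub>) 0 0 = \<zero>\<^bsub>schr_env\<^esub>"
        unfolding U.pser_nbhd by simp
      moreover have "?e 0 0 \<in> carrier schr_env"
        using e unfolding pser_simps(1) by blast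
      ultimately have "?e 0 0 = \<one>\<^bsub>schr_env\<^esub>"
        unfolding U.pser_diff[OF e U.pser.one_closed] pser_simps(3) by (simp add: U.eq_diff_zero)
      then show ?thesis
        using e by (simp add: \<pi>_def gen uresc_def U.pser_mult pser_simps(1) U.pconst_def)
    qed
    show "\<exists>\<phi>. klinear schr_q ?P \<phi> \<and> bij_betw \<phi> (carrier schr_q) (carrier ?P) \<and>
       (\<forall>x\<in>carrier schr_q. \<phi> x 0 0 = \<pi> x)"
    proof (intro exI[of _ \<phi>] conjI ballI)
      show "klinear schr_q ?P \<phi>" unfolding klinear_eq_lin by (rule alg_hom_lin[OF \<phi>])
      show "bij_betw \<phi> (carrier schr_q) (carrier ?P)"
        by (rule bij_betwI[where g = \<psi>]) (use c c' inv in auto)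
    qed (simp add: \<pi>_def)
  qed
qed

theorem mainTheorem7:
  shows "\<exists>\<Delta> \<epsilon> S.
    topological_hopf_algebra schr_q \<Delta> \<epsilon> S \<and>
    quantum_deformation schr_q qgen \<Delta> \<epsilon> S schr_r \<and>
    \<Delta> (qgen bD) = \<one>q \<otimes>q qgen bD \<oplus>q qgen bD \<otimes>q \<one>q \<and>
    \<Delta> (qgen bM) = \<one>q \<otimes>q qgen bM \<oplus>q qgen bM \<otimes>q \<one>q \<and>
    \<Delta> (qgen bP) = \<one>q \<otimes>q qgen bP \<oplus>q qgen bP \<otimes>q qexp (c1 - c2) \<and>
    \<Delta> (qgen bK) = \<one>q \<otimes>q qgen bK \<oplus>q qgen bK \<otimes>q qexp (- (c1 + c2)) \<and>
    \<Delta> (qgen bH) = \<one>q \<otimes>q qgen bH \<oplus>q qgen bH \<otimes>q qexp (2 * c1) \<and>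
    \<Delta> (qgen bC) = \<one>q \<otimes>q qgen bC \<oplus>q qgen bC \<otimes>q qexp (- 2 * c1) \<and>
    (\<forall>x. \<epsilon> (qgen x) = 0)"
proof -
  interpret QQ: alg_pair schr_q schr_q ..
  obtain \<Delta> where \<Delta>: "alg_hom schr_q TT \<Delta>" "\<And>x. \<Delta> (qgen x) = Delta_gen x"
    by (rule schr_q_extend[OF QQ.calg_ctensor schr_rep_Delta]) (rule that)
  obtain \<epsilon> where \<epsilon>: "alg_hom schr_q kalg \<epsilon>" "\<And>x. \<epsilon> (qgen x) = 0"
    by (rule schr_q_extend[OF calg_kalg schr_rep_eps]) (rule that)
  obtain S where S: "alg_hom schr_q (opp schr_q) S" "\<And>x. S (qgen x) = S_gen x"
    by (rule schr_q_extend[OF Q.calg_opp schr_rep_S]) (rule that)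
  interpret K: topalg kalg by (rule topalg_kalg)
  have h: "topological_hopf_algebra schr_q \<Delta> \<epsilon> S"
    by (rule hopf[OF \<Delta> \<epsilon> S])
  have d: "quantum_deformation schr_q qgen \<Delta> \<epsilon> S schr_r"
    unfolding quantum_deformation_def
    using schr_q_free Delta_mod_1[OF \<Delta> \<epsilon> S] S_mod_1[OF \<Delta> \<epsilon> S] Delta_antisym[OF \<Delta> \<epsilon> S]
      K.nbhd_zero[of 1] \<epsilon>(2) by simp
  have q: "qexp (qweight x) = qe (qweight x)" for x by (rule qexp_eq[OF qweight_00])
  show ?thesis
    using h d q[of bP] q[of bK] q[of bH] q[of bC] \<epsilon>(2)
    by (intro exI[of _ \<Delta>] exI[of _ \<epsilon>] exI[of _ S]) (simp add: \<Delta>(2) Delta_gen_def qe_0)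
qed

end
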